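(* Let $K$ be a field of characteristic $0$, let $n\geq 2$, let $\Gamma_1$ be an infinite subgroup of $K^*$ of finite rank, and let $\Gamma:=\Gamma_1^n=\{(x_1,\ldots,x_n): x_i\in\Gamma_1 \text{ for } i=1,\ldots,n\}$, which is a subgroup of $(K^* )^n$ of finite rank. Then there are infinitely many $\Gamma$-equivalence classes of tuples $\mathbf{a}=(a_1,\ldots,a_n)\in (K^* )^n$ such that the set of non-degenerate solutions of $$a_1x_1+\cdots+a_nx_n=1\quad\text{in }\mathbf{x}=(x_1,\ldots,x_n)\in\Gamma$$ cannot be covered by fewer than $n$ proper linear subspaces of $K^n$.
   Context: $K^*$ is the multiplicative group of $K$, and $(K^* )^n$ is its $n$-fold direct product with coordinatewise multiplication. A subgroup $\Gamma$ of $(K^* )^n$ (for any $n\geq 1$) is said to be of finite rank if there are $\mathbf{u}_1,\ldots,\mathbf{u}_r\in\Gamma$ such that for every $\mathbf{x}\in\Gamma$ there are $z\in\mathbb{Z}_{>0}$ and $z_1,\ldots,z_r\in\mathbb{Z}$ with $\mathbf{x}^z=\mathbf{u}_1^{z_1}\cdots\mathbf{u}_r^{z_r}$. Two tuples $\mathbf{a},\mathbf{b}\in (K^* )^n$ are called $\Gamma$-equivalent if $\mathbf{b}=\mathbf{u}\cdot\mathbf{a}$ for some $\mathbf{u}\in\Gamma$. A solution $\mathbf{x}\in\Gamma$ of $a_1x_1+\cdots+a_nx_n=1$ is called non-degenerate if $\sum_{i\in I}a_ix_i\neq 0$ for each non-empty subset $I$ of $\{1,\ldots,n\}$. *)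

theory Defs
  imports "HOL-Analysis.Analysis" "HOL-Algebra.FiniteProduct"
begin

definition mult_grp :: "'a::field monoid" where
  "mult_grp = \<lparr>carrier = {x. x \<noteq> 0}, mult = (*), one = 1\<rparr>"

text \<open>The multiplication and the unit of the type \<^typ>\<open>'a ^ 'n\<close> are the coordinatewise ones.\<close>

definition mult_grp_power :: "('a::field ^ 'n::finite) monoid" where
  "mult_grp_power = \<lparr>carrier = {x. \<forall>i. x $ i \<noteq> 0}, mult = (*), one = 1\<rparr>"

definition finite_rank :: "('g, 'b) monoid_scheme \<Rightarrow> 'g set \<Rightarrow> bool" where
  "finite_rank G H \<longleftrightarrow>
     (\<exists>(r::nat) u. (\<forall>j<r. u j \<in> H) \<and>
        (\<forall>x\<in>H. \<exists>(z::int) (e :: nat \<Rightarrow> int). z > 0 \<and>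
           x [^]\<^bsub>G\<^esub> z = (\<Otimes>\<^bsub>G\<^esub>j\<in>{..<r}. u j [^]\<^bsub>G\<^esub> e j)))"

definition set_power :: "'a set \<Rightarrow> ('a ^ 'n::finite) set" where
  "set_power A = {x. \<forall>i. x $ i \<in> A}"

definition Gamma_equiv ::
    "('a::field ^ 'n::finite) set \<Rightarrow> (('a ^ 'n) \<times> ('a ^ 'n)) set" where
  "Gamma_equiv \<Gamma> =
     {(a, b). a \<in> carrier mult_grp_power \<and> b \<in> carrier mult_grp_power \<and>
              (\<exists>u\<in>\<Gamma>. b = u * a)}"

definition nondegenerate_solutions ::
    "('a::field ^ 'n::finite) set \<Rightarrow> 'a ^ 'n \<Rightarrow> ('a ^ 'n) set" where
  "nondegenerate_solutions \<Gamma> a =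
     {x \<in> \<Gamma>. (\<Sum>i\<in>UNIV. a $ i * x $ i) = 1 \<and>
              (\<forall>I. I \<noteq> {} \<longrightarrow> (\<Sum>i\<in>I. a $ i * x $ i) \<noteq> 0)}"

definition coverable_by_fewer ::
    "nat \<Rightarrow> ('a::field ^ 'n::finite) set \<Rightarrow> bool" where
  "coverable_by_fewer m S \<longleftrightarrow>
     (\<exists>F. finite F \<and> card F < m \<and>
          (\<forall>V\<in>F. vec.subspace V \<and> V \<noteq> UNIV) \<and> S \<subseteq> \<Union>F)"

lemma comm_group_mult_grp: "comm_group (mult_grp :: 'a::field monoid)"
proof (rule comm_groupI)
  fix x :: 'a
  assume "x \<in> carrier mult_grp"
  then show "\<exists>y\<in>carrier mult_grp. y \<otimes>\<^bsub>mult_grp\<^esub> x = \<one>\<^bsub>mult_grp\<^esub>"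
    by (intro bexI[of _ "inverse x"]) (auto simp: mult_grp_def)
qed (auto simp: mult_grp_def)

lemma comm_group_mult_grp_power:
  "comm_group (mult_grp_power :: ('a::field ^ 'n::finite) monoid)"
proof (rule comm_groupI)
  fix x :: "'a ^ 'n"
  assume "x \<in> carrier mult_grp_power"
  then show "\<exists>y\<in>carrier mult_grp_power.
      y \<otimes>\<^bsub>mult_grp_power\<^esub> x = \<one>\<^bsub>mult_grp_power\<^esub>"
    by (intro bexI[of _ "\<chi> i. inverse (x $ i)"]) (auto simp: mult_grp_power_def vec_eq_iff)
qed (auto simp: mult_grp_power_def mult_ac)

lemma equiv_Gamma_equiv:
  assumes "subgroup \<Gamma> (mult_grp_power :: ('a::field ^ 'n::finite) monoid)"
  shows "equiv (carrier mult_grp_power) (Gamma_equiv \<Gamma>)"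
proof -
  interpret G: comm_group "mult_grp_power :: ('a ^ 'n) monoid"
    by (rule comm_group_mult_grp_power)
  interpret H: subgroup \<Gamma> "mult_grp_power :: ('a ^ 'n) monoid"
    by (rule assms)
  have mult: "x \<otimes>\<^bsub>mult_grp_power\<^esub> y = x * y" for x y :: "'a ^ 'n"
    by (simp add: mult_grp_power_def)
  have one: "\<one>\<^bsub>mult_grp_power\<^esub> = (1 :: 'a ^ 'n)"
    by (simp add: mult_grp_power_def)
  show ?thesis
  proof (rule equivI)
    show "Gamma_equiv \<Gamma> \<subseteq> carrier mult_grp_power \<times> carrier mult_grp_power"
      by (auto simp: Gamma_equiv_def)
    show "refl_on (carrier mult_grp_power) (Gamma_equiv \<Gamma>)"
      using H.one_closed by (auto simp: Gamma_equiv_def refl_on_def one intro!: bexI[of _ 1])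
    show "sym (Gamma_equiv \<Gamma>)"
    proof (rule symI)
      fix a b assume "(a, b) \<in> Gamma_equiv \<Gamma>"
      then obtain u where u: "u \<in> \<Gamma>" "b = u * a"
        and ab: "a \<in> carrier mult_grp_power" "b \<in> carrier mult_grp_power"
        by (auto simp: Gamma_equiv_def)
      have "inv\<^bsub>mult_grp_power\<^esub> u * u = 1"
        using G.l_inv[of u] u(1) H.subset by (auto simp: mult one)
      then have "a = inv\<^bsub>mult_grp_power\<^esub> u * b"
        by (simp add: u(2) mult.assoc[symmetric])
      then show "(b, a) \<in> Gamma_equiv \<Gamma>"
        using H.m_inv_closed[OF u(1)] ab by (auto simp: Gamma_equiv_def)
    qed
    show "trans (Gamma_equiv \<Gamma>)"
    proof (rule transI)
      fix a b c assume "(a, b) \<in> Gamma_equiv \<Gamma>" "(b, c) \<in> Gamma_equiv \<Gamma>"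
      then obtain u v where "u \<in> \<Gamma>" "v \<in> \<Gamma>" "c = v * u * a"
        and ac: "a \<in> carrier mult_grp_power" "c \<in> carrier mult_grp_power"
        by (auto simp: Gamma_equiv_def mult.assoc)
      moreover from this have "v * u \<in> \<Gamma>"
        using H.m_closed[of v u] by (simp add: mult)
      ultimately show "(a, c) \<in> Gamma_equiv \<Gamma>"
        by (auto simp: Gamma_equiv_def)
    qed
  qed
qed

end

theory Submission
  imports Defs "HOL-Computational_Algebra.Computational_Algebra"
begin

text \<open>
Fix a set \<open>V\<close> of \<open>n\<close> elements of \<open>\<Gamma>\<^sub>1\<close> with sum \<open>T \<noteq> 0\<close> and give all unknowns the coefficient
\<open>1 / T\<close>. Then every arrangement of the elements of \<open>V\<close> in a tuple is a solution, and it is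
non-degenerate when no subsum of \<open>V\<close> vanishes. The theorem needs two facts: for suitable \<open>V\<close> the
arrangements do not lie in \<open>n - 1\<close> hyperplanes, and such \<open>V\<close> give infinitely many classes, that is,
infinitely many values of \<open>T\<close> modulo \<open>\<Gamma>\<^sub>1\<close>.

Covering. In a \<open>generic\<close> set the elements are chosen one after another, each outside a finite
set that depends on the earlier ones, so generic sets exist inside every infinite set. The condition
\<open>dominant\<close> makes every hyperplane avoid all arrangements that put the last element \<open>v\<close> at some
position \<open>p\<close>. Fixing \<open>v\<close> at \<open>p\<close> leaves arrangements of a smaller generic set, and the remaining
hyperplanes become hyperplanes for it, except for one exceptional hyperplane, which contains all
arrangements with \<open>v\<close> at \<open>p\<close> and no other. By induction a cover with too few hyperplanes must contain
the exceptional hyperplane of every position, and these are already too many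
(\<open>generic_bijection_avoids\<close>).

Classes. Keep all elements of \<open>V\<close> but one fixed, with sum \<open>S\<close>. If there were finitely many classes,
then all \<open>S + v\<close>, with \<open>v\<close> in \<open>\<Gamma>\<^sub>1\<close> outside a finite set, would lie in finitely many cosets of
\<open>\<Gamma>\<^sub>1\<close>. The general theorem on unit equations excludes this; the freedom in the choice of \<open>v\<close> allows an
elementary argument.

If all elements of \<open>\<Gamma>\<^sub>1\<close> are roots of unity, then three different \<open>S + v\<close> differ by roots of unity.
Everything takes place in the field generated by one root of unity, which embeds in the complex
numbers, and there three points of the unit circle would have the same distance from \<open>- S \<noteq> 0\<close>.

Otherwise \<open>\<Gamma>\<^sub>1\<close> contains some \<open>t\<close> of infinite order, and one takes \<open>v = t ^ k\<close> and \<open>S\<close> a sum of powers of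
\<open>t\<close>. Let \<open>g k\<close> be the norm of \<open>S + t ^ k\<close>, a rational number (for transcendental \<open>t\<close>, specialise to
\<open>t = 2\<close> first). As \<open>\<Gamma>\<^sub>1\<close> has finite rank, all \<open>g k\<close> are composed of the primes of a finite set. For a prime
\<open>p\<close> and a valuation above \<open>p\<close>, the powers of a conjugate of \<open>t\<close> along a suitable arithmetic progression
of exponents are close to \<open>0\<close>, to \<open>1\<close> or to infinity, so the valuation of \<open>g k\<close> is linear in \<open>k\<close> there
(\<open>translated_powers_geometric\<close>). Hence \<open>g k ^ 2\<close> is a geometric sequence along an arithmetic
progression. But \<open>g k\<close> is a product of factors \<open>s + x ^ k\<close>, and no multiple of such a factor by an
exponential sum is geometric (\<open>exp_sum_not_geometric\<close>).
\<close>

section \<open>Arrangements of a generic set\<close>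

text \<open>Eigenvectors of different eigenvalues are linearly independent: applying \<open>B - l0\<close> to a relation
removes one eigenvector and multiplies the other coefficients by nonzero factors.\<close>

lemma eigenvectors_lincomb:
  fixes B :: "'a::field ^ 'n::finite ^ 'n" and x :: "'a \<Rightarrow> 'a ^ 'n"
  assumes "finite L" "\<And>l. l \<in> L \<Longrightarrow> x l \<noteq> 0 \<and> B *v x l = l *s x l"
    and "(\<Sum>l\<in>L. a l *s x l) = 0" "l \<in> L"
  shows "a l = 0"
  using assms
proof (induction L arbitrary: a l rule: finite_induct)
  case (insert l0 L)
  have "B *v (\<Sum>l\<in>insert l0 L. a l *s x l) = (\<Sum>l\<in>insert l0 L. a l *s (B *v x l))"
    by (simp add: vec.sum vec.scale)
  also have "\<dots> = (\<Sum>l\<in>insert l0 L. a l *s (l *s x l))"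
    using insert.prems(1) by (intro sum.cong) auto
  finally have 1: "(\<Sum>l\<in>insert l0 L. (a l * l) *s x l) = 0"
    using insert.prems(2) by simp
  have "(\<Sum>l\<in>insert l0 L. (a l * (l - l0)) *s x l)
      = (\<Sum>l\<in>insert l0 L. (a l * l) *s x l) - l0 *s (\<Sum>l\<in>insert l0 L. a l *s x l)"
    by (simp only: vec.scale_sum_right sum_subtractf[symmetric])
       (intro sum.cong; simp add: algebra_simps vec_eq_iff)
  also have "\<dots> = 0" using 1 insert.prems(2) by simp
  finally have "(\<Sum>l\<in>L. (a l * (l - l0)) *s x l) = 0"
    using insert.hyps by simp
  then have *: "a l * (l - l0) = 0" if "l \<in> L" for l
    using insert.IH[of "\<lambda>l. a l * (l - l0)"] insert.prems(1) that by auto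
  then have **: "a l = 0" if "l \<in> L" for l
    using that insert.hyps(2) by force
  then have "a l0 *s x l0 = 0"
    using insert.prems(2) insert.hyps by simp
  then have "a l0 = 0" using insert.prems(1)[of l0] by auto
  with ** insert.prems(3) show ?case by auto
qed auto

lemma finite_eigenvalues:
  fixes B :: "'a::field ^ 'n::finite ^ 'n"
  shows "finite {l. \<exists>x. x \<noteq> 0 \<and> B *v x = l *s x}" (is "finite ?E")
proof -
  have "\<forall>l\<in>?E. \<exists>x. x \<noteq> 0 \<and> B *v x = l *s x" by simp
  from bchoice[OF this] obtain x where "\<forall>l\<in>?E. x l \<noteq> 0 \<and> B *v x l = l *s x l" ..
  then have x: "x l \<noteq> 0 \<and> B *v x l = l *s x l" if "l \<in> ?E" for l
    using that by (rule bspec)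
  have inj: "inj_on x ?E"
  proof (rule inj_onI)
    fix l m assume lm: "l \<in> ?E" "m \<in> ?E" "x l = x m"
    have "B *v x l = l *s x l" "B *v x m = m *s x m" "x l \<noteq> 0"
      using x[OF lm(1)] x[OF lm(2)] by auto
    then show "l = m" unfolding lm(3) by (metis vec.scale_cancel_right)
  qed
  have "vec.independent (x ` ?E)"
    unfolding vec.independent_explicit_finite_subsets
  proof (intro allI impI ballI)
    fix S u v assume S: "S \<subseteq> x ` ?E" and fin: "finite S" and sum: "(\<Sum>v\<in>S. u v *s v) = 0" and v: "v \<in> S"
    obtain L where L: "L \<subseteq> ?E" "S = x ` L" using S by (auto simp: subset_image_iff)
    have injL: "inj_on x L" using inj L inj_on_subset by blast
    have finL: "finite L" using fin injL L finite_imageD by blast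
    have suml: "(\<Sum>l\<in>L. u (x l) *s x l) = 0"
      using sum unfolding L(2) by (simp add: sum.reindex[OF injL])
    have xL: "x l \<noteq> 0 \<and> B *v x l = l *s x l" if "l \<in> L" for l
      using that L(1) by (intro x) (rule subsetD)
    have "u (x l) = 0" if "l \<in> L" for l
      using finL xL suml that by (rule eigenvectors_lincomb)
    then show "u v = 0" using v L by auto
  qed
  then have "finite (x ` ?E)" by (rule vec.finiteI_independent)
  then show ?thesis using inj finite_imageD by blast
qed

text \<open>Square matrices with \<open>v\<close> on the diagonal and entries of \<open>V\<close> elsewhere are injective. The index type
is a parameter because only finitely many \<open>v\<close> are excluded as long as the size of the matrices is bounded.\<close>

definition dominant :: "'n::finite itself \<Rightarrow> 'a::field set \<Rightarrow> 'a \<Rightarrow> bool" where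
  "dominant N V v \<longleftrightarrow>
     (\<forall>(I :: 'n set) M c. (\<forall>p\<in>I. M p p = v \<and> (\<forall>i\<in>I - {p}. M p i \<in> V) \<and> (\<Sum>i\<in>I. M p i * c i) = 0)
        \<longrightarrow> (\<forall>i\<in>I. c i = 0))"

text \<open>If \<open>v\<close> is not dominant, then \<open>- v\<close> is an eigenvalue of one of the finitely many matrices that have zero
diagonal and entries in \<open>V \<union> {0}\<close>. A matrix on a subset of the index type is extended by zero.\<close>

lemma finite_not_dominant:
  fixes V :: "'a::field set"
  assumes "finite V"
  shows "finite {v. \<not> dominant TYPE('n::finite) V v}"
proof -
  define Bs where "Bs = (\<lambda>f. (\<chi> p i. f (p, i)) :: 'a ^ 'n ^ 'n) ` (UNIV \<rightarrow>\<^sub>E insert 0 V)"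
  have "finite Bs" unfolding Bs_def using assms by (intro finite_imageI finite_PiE) auto
  have "{v. \<not> dominant TYPE('n) V v} \<subseteq>
      (\<Union>B\<in>Bs. uminus ` {l. \<exists>x. x \<noteq> 0 \<and> B *v x = l *s x})"
  proof
    fix v assume "v \<in> {v. \<not> dominant TYPE('n) V v}"
    then obtain I :: "'n set" and M c i0 where
      M: "\<And>p. p \<in> I \<Longrightarrow> M p p = v \<and> (\<forall>i\<in>I - {p}. M p i \<in> V) \<and> (\<Sum>i\<in>I. M p i * c i) = 0"
      and i0: "i0 \<in> I" "c i0 \<noteq> 0"
      unfolding dominant_def by blast
    define f where "f = (\<lambda>(p, i). if p \<in> I \<and> i \<in> I - {p} then M p i else 0)"
    define B :: "'a ^ 'n ^ 'n" where "B = (\<chi> p i. f (p, i))"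
    define x :: "'a ^ 'n" where "x = (\<chi> i. if i \<in> I then c i else 0)"
    have "f \<in> UNIV \<rightarrow>\<^sub>E insert 0 V" using M by (auto simp: f_def)
    then have B: "B \<in> Bs" unfolding Bs_def B_def by blast
    have "x \<noteq> 0" using i0 by (auto simp: x_def vec_eq_iff)
    moreover have "(B *v x) $ p = (- v) * x $ p" for p
    proof (cases "p \<in> I")
      case True
      have "(B *v x) $ p = (\<Sum>i\<in>UNIV. f (p, i) * (if i \<in> I then c i else 0))"
        by (simp add: matrix_vector_mult_def B_def x_def)
      also have "\<dots> = (\<Sum>i\<in>I - {p}. M p i * c i)"
        using True by (intro sum.mono_neutral_cong_right) (auto simp: f_def)
      also have "\<dots> = (\<Sum>i\<in>I. M p i * c i) - M p p * c p"
        using True by (simp add: sum_diff1)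
      finally show ?thesis using M[OF True] True by (simp add: x_def)
    next
      case False
      then show ?thesis by (simp add: matrix_vector_mult_def B_def x_def f_def)
    qed
    then have "B *v x = (- v) *s x" by (simp add: vec_eq_iff)
    ultimately have "v \<in> uminus ` {l. \<exists>x. x \<noteq> 0 \<and> B *v x = l *s x}"
      by (intro image_eqI[of _ _ "- v"]) auto
    with B show "v \<in> (\<Union>B\<in>Bs. uminus ` {l. \<exists>x. x \<noteq> 0 \<and> B *v x = l *s x})" by blast
  qed
  moreover have "finite (\<Union>B\<in>Bs. uminus ` {l. \<exists>x. x \<noteq> 0 \<and> B *v x = l *s x})"
    using \<open>finite Bs\<close> finite_eigenvalues by blast
  ultimately show ?thesis by (rule finite_subset)
qed

text \<open>The second condition ensures non-degeneracy; it also provides the nonzero sums by which the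
covering argument divides.\<close>

inductive generic :: "'n::finite itself \<Rightarrow> 'a::field set \<Rightarrow> bool" for N where
  generic_empty: "generic N {}"
| generic_insert: "generic N V \<Longrightarrow> v \<notin> V \<Longrightarrow> (\<And>W. W \<subseteq> insert v V \<Longrightarrow> W \<noteq> {} \<Longrightarrow> \<Sum>W \<noteq> 0) \<Longrightarrow>
    dominant N V v \<Longrightarrow> generic N (insert v V)"

lemma generic_finite: "generic N V \<Longrightarrow> finite V"
  by (induction rule: generic.induct) auto

lemma generic_sum: "generic N V \<Longrightarrow> W \<subseteq> V \<Longrightarrow> W \<noteq> {} \<Longrightarrow> \<Sum>W \<noteq> 0"
  by (induction arbitrary: W rule: generic.induct) auto

lemma finite_not_generic_insert:
  fixes V :: "'a::field set"
  assumes "generic TYPE('n::finite) V"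
  shows "finite {v. \<not> generic TYPE('n) (insert v V)}"
proof -
  let ?F = "V \<union> (\<lambda>W. - \<Sum>W) ` Pow V \<union> {v. \<not> dominant TYPE('n) V v}"
  have fin: "finite V" using assms by (rule generic_finite)
  have "generic TYPE('n) (insert v V)" if "v \<notin> ?F" for v
  proof (rule generic_insert[OF assms])
    fix W assume W: "W \<subseteq> insert v V" "W \<noteq> {}"
    show "\<Sum>W \<noteq> 0"
    proof (cases "v \<in> W")
      case True
      then have "\<Sum>W = v + \<Sum>(W - {v})"
        using W fin finite_subset[of W "insert v V"] by (intro sum.remove) auto
      moreover have "W - {v} \<in> Pow V" using W by auto
      then have "- \<Sum>(W - {v}) \<in> (\<lambda>W. - \<Sum>W) ` Pow V" by (rule imageI)
      then have "- \<Sum>(W - {v}) \<noteq> v" using that by auto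
      ultimately show ?thesis by (auto simp: add_eq_0_iff2)
    next
      case False
      then show ?thesis using W generic_sum[OF assms] by blast
    qed
  qed (use that in auto)
  then have "{v. \<not> generic TYPE('n) (insert v V)} \<subseteq> ?F" by blast
  moreover have "finite ?F" using fin finite_not_dominant by auto
  ultimately show ?thesis by (rule finite_subset)
qed

lemma ex_generic:
  fixes D :: "'a::field set"
  assumes "infinite D"
  shows "\<exists>V\<subseteq>D. generic TYPE('n::finite) V \<and> card V = m"
proof (induction m)
  case 0
  then show ?case by (intro exI[of _ "{}"]) (auto intro: generic_empty)
next
  case (Suc m)
  then obtain V where V: "V \<subseteq> D" "generic TYPE('n) V" "card V = m" by blast
  have "finite ({v. \<not> generic TYPE('n) (insert v V)} \<union> V)"
    using finite_not_generic_insert[OF V(2)] generic_finite[OF V(2)] by simp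
  then have "infinite (D - ({v. \<not> generic TYPE('n) (insert v V)} \<union> V))"
    using assms by (rule Diff_infinite_finite)
  then obtain v where "v \<in> D" "v \<notin> V" "generic TYPE('n) (insert v V)"
    by (metis (no_types, lifting) DiffE UnI1 UnI2 all_not_in_conv finite.emptyI mem_Collect_eq)
  then show ?case using V generic_finite[OF V(2)] by (intro exI[of _ "insert v V"]) auto
qed

lemma bij_betw_fun_upd_insert:
  assumes "bij_betw s (I - {p}) V" "p \<in> I" "v \<notin> V"
  shows "bij_betw (s(p := v)) I (insert v V)"
proof -
  have "bij_betw (s(p := v)) (I - {p}) V"
    using assms(1) by (subst bij_betw_cong[of _ _ s]) auto
  then have "bij_betw (s(p := v)) ((I - {p}) \<union> {p}) (V \<union> {v})"
    using assms(3) by (intro bij_betw_combine) (auto simp: bij_betw_def)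
  then show ?thesis using assms(2) by (simp add: insert_absorb)
qed

text \<open>The arrangements of \<open>V\<close> at the positions \<open>I\<close> are not covered by fewer than \<open>card I\<close> hyperplanes. In
the induction step let \<open>T\<close> be the sum of the smaller set \<open>V\<close>. The hyperplane of \<open>c\<close> is the exceptional
one for \<open>p\<close> (called \<open>tight\<close>) if \<open>T * c i + v * c p = 0\<close> for all \<open>i \<noteq> p\<close>: its equation on arrangements
then reads \<open>\<sigma> p = v\<close>. If it is not, then on the arrangements with \<open>\<sigma> p = v\<close> the constant term \<open>c p * v\<close>
can be absorbed by means of the relation that the other entries have sum \<open>T\<close>, and \<open>c\<close> becomes the nonzero
functional \<open>T * c i + v * c p\<close>.\<close>

lemma generic_bijection_avoids:
  fixes C :: "('n::finite \<Rightarrow> 'a::field) set"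
  assumes "generic TYPE('n) V" "card I = card V" "finite C" "card C < card I"
    and "\<And>c. c \<in> C \<Longrightarrow> \<exists>i\<in>I. c i \<noteq> 0"
  shows "\<exists>\<sigma>. bij_betw \<sigma> I V \<and> (\<forall>c\<in>C. (\<Sum>i\<in>I. c i * \<sigma> i) \<noteq> 0)"
  using assms
proof (induction arbitrary: I C rule: generic.induct)
  case generic_empty
  then show ?case by simp
next
  case (generic_insert V v)
  have finV: "finite V" using generic_insert.hyps(1) by (rule generic_finite)
  have cardI: "card I = Suc (card V)" using generic_insert.prems(1) generic_insert.hyps(2) finV by simp
  have bij_ex: "\<exists>\<sigma>. bij_betw \<sigma> I (insert v V) \<and> \<sigma> p = v" if "p \<in> I" for p
  proof -
    have "card (I - {p}) = card V" using cardI that by simp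
    then obtain s where s: "bij_betw s (I - {p}) V"
      using finite_same_card_bij[of "I - {p}" V] finV by auto
    then show ?thesis using bij_betw_fun_upd_insert[OF s that generic_insert.hyps(2)]
      by (intro exI[of _ "s(p := v)"]) simp
  qed
  show ?case
  proof (cases "C = {}")
    case True
    have "I \<noteq> {}" using cardI by auto
    then show ?thesis using bij_ex True by auto
  next
    case False
    then have "card C \<noteq> 0" using generic_insert.prems(2) by simp
    then have "V \<noteq> {}" using generic_insert.prems(3) cardI by auto
    define T where "T = \<Sum>V"
    have T: "T \<noteq> 0"
      using generic_insert.hyps(3)[of V] \<open>V \<noteq> {}\<close> by (auto simp: T_def)
    have Tv: "T + v \<noteq> 0"
      using generic_insert.hyps(3)[of "insert v V"] generic_insert.hyps(2) finV
      by (simp add: T_def add.commute)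
    show ?thesis
    proof (rule ccontr)
      assume no: "\<not> ?thesis"
      define tight where "tight = (\<lambda>p c. \<forall>i\<in>I - {p}. T * c i + v * c p = 0)"
      define avoids where "avoids = (\<lambda>p c. \<forall>\<sigma>. bij_betw \<sigma> I (insert v V) \<longrightarrow> \<sigma> p = v \<longrightarrow>
         (\<Sum>i\<in>I. c i * \<sigma> i) \<noteq> 0)"
      \<comment> \<open>Otherwise the arrangements that fail the claim, one for each p, form a matrix with diagonal v and kernel vector c.\<close>
      have ex_avoids: "\<exists>p\<in>I. avoids p c" if c: "c \<in> C" for c
      proof (rule ccontr)
        assume "\<not> ?thesis"
        then have "\<forall>p\<in>I. \<exists>\<sigma>. bij_betw \<sigma> I (insert v V) \<and> \<sigma> p = v \<and> (\<Sum>i\<in>I. c i * \<sigma> i) = 0"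
          by (auto simp: avoids_def)
        then obtain M where M: "\<And>p. p \<in> I \<Longrightarrow> bij_betw (M p) I (insert v V) \<and> M p p = v \<and>
            (\<Sum>i\<in>I. c i * M p i) = 0"
          by metis
        have "M p p = v \<and> (\<forall>i\<in>I - {p}. M p i \<in> V) \<and> (\<Sum>i\<in>I. M p i * c i) = 0" if p: "p \<in> I" for p
        proof (intro conjI ballI)
          fix i assume i: "i \<in> I - {p}"
          have "M p i \<in> insert v V" using M[OF p] i by (auto simp: bij_betw_def)
          moreover have "M p i \<noteq> M p p"
            using M[OF p] i p by (auto simp: bij_betw_def inj_on_def)
          ultimately show "M p i \<in> V" using M[OF p] by auto
        qed (use M[OF p] in \<open>simp_all add: mult.commute\<close>)
        then have "\<forall>i\<in>I. c i = 0"
          using generic_insert.hyps(4) unfolding dominant_def by blast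
        then show False using generic_insert.prems(4)[OF c] by blast
      qed
      have avoids_tight: "\<exists>c\<in>C. tight p c" if p: "p \<in> I" and c0: "c0 \<in> C" "avoids p c0" for p c0
      proof (rule ccontr)
        assume nt: "\<not> ?thesis"
        define g where "g = (\<lambda>c i. T * c i + v * c p)"
        let ?C' = "g ` (C - {c0})"
        have "card ?C' \<le> card (C - {c0})"
          using generic_insert.prems(2) by (intro card_image_le) simp
        also have "\<dots> < card (I - {p})"
          using generic_insert.prems(2,3) c0(1) p cardI
          by (simp add: card_Diff_singleton_if) (use \<open>card C \<noteq> 0\<close> in linarith)
        finally have card: "card ?C' < card (I - {p})" .
        have "\<exists>i\<in>I - {p}. c i \<noteq> 0" if "c \<in> ?C'" for c
          using that nt by (auto simp: tight_def g_def)
        moreover have "card (I - {p}) = card V" using p cardI by simp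
        ultimately obtain s where s: "bij_betw s (I - {p}) V"
            "\<And>c. c \<in> ?C' \<Longrightarrow> (\<Sum>i\<in>I - {p}. c i * s i) \<noteq> 0"
          using generic_insert.IH[of "I - {p}" ?C'] card generic_insert.prems(2) by auto
        define \<sigma> where "\<sigma> = s(p := v)"
        have bij: "bij_betw \<sigma> I (insert v V)"
          unfolding \<sigma>_def by (rule bij_betw_fun_upd_insert[OF s(1) p generic_insert.hyps(2)])
        have sumV: "(\<Sum>i\<in>I - {p}. s i) = T"
          unfolding T_def using s(1) by (rule sum.reindex_bij_betw)
        have "(\<Sum>i\<in>I. c i * \<sigma> i) \<noteq> 0" if c: "c \<in> C" for c
        proof (cases "c = c0")
          case True
          have "\<sigma> p = v" by (simp add: \<sigma>_def)
          then show ?thesis using c0(2) bij True unfolding avoids_def by blast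
        next
          case False
          have "(\<Sum>i\<in>I. c i * \<sigma> i) = c p * v + (\<Sum>i\<in>I - {p}. c i * s i)"
            using p by (subst sum.remove[of _ p]) (auto simp: \<sigma>_def)
          then have "T * (\<Sum>i\<in>I. c i * \<sigma> i) = v * c p * (\<Sum>i\<in>I - {p}. s i) + T * (\<Sum>i\<in>I - {p}. c i * s i)"
            by (simp add: sumV algebra_simps)
          also have "\<dots> = (\<Sum>i\<in>I - {p}. g c i * s i)"
            by (simp add: g_def sum_distrib_left sum.distrib algebra_simps)
          also have "\<dots> \<noteq> 0" using s(2)[of "g c"] c False by blast
          finally show ?thesis by auto
        qed
        then show False using no bij by blast
      qed
      \<comment> \<open>So the exceptional hyperplane for p consists exactly of the arrangements with v at p.\<close>
      have tight_sum: "T * (\<Sum>i\<in>I. c i * \<sigma> i) = c p * (T + v) * (\<sigma> p - v)"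
        if c: "tight p c" "p \<in> I" and \<sigma>: "bij_betw \<sigma> I (insert v V)" for p c \<sigma>
      proof -
        have "(\<Sum>i\<in>I. \<sigma> i) = \<Sum>(insert v V)" using \<sigma> by (rule sum.reindex_bij_betw)
        then have s: "(\<Sum>i\<in>I - {p}. \<sigma> i) = T + v - \<sigma> p"
          using c(2) generic_insert.hyps(2) finV by (simp add: sum_diff1 T_def algebra_simps)
        have "T * (\<Sum>i\<in>I. c i * \<sigma> i) = T * c p * \<sigma> p + (\<Sum>i\<in>I - {p}. (T * c i) * \<sigma> i)"
          using c(2) by (subst sum.remove[of _ p]) (auto simp: sum_distrib_left algebra_simps)
        also have "(\<Sum>i\<in>I - {p}. (T * c i) * \<sigma> i) = (\<Sum>i\<in>I - {p}. (- v * c p) * \<sigma> i)"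
          using c(1) by (intro sum.cong) (auto simp: tight_def add_eq_0_iff2)
        also have "\<dots> = - v * c p * (T + v - \<sigma> p)"
          by (simp only: sum_distrib_left[symmetric] s)
        finally show ?thesis by (simp add: algebra_simps)
      qed
      have tight_nz: "c p \<noteq> 0" if "tight p c" "p \<in> I" "c \<in> C" for p c
      proof
        assume "c p = 0"
        then have "\<forall>i\<in>I. c i = 0" using that(1) T by (auto simp: tight_def)
        then show False using generic_insert.prems(4)[OF that(3)] by blast
      qed
      have tight_avoids: "avoids q c" if "tight p c" "p \<in> I" "c \<in> C" "q \<in> I" "q \<noteq> p" for p q c
        unfolding avoids_def
      proof (intro allI impI notI)
        fix \<sigma> assume \<sigma>: "bij_betw \<sigma> I (insert v V)" "\<sigma> q = v" "(\<Sum>i\<in>I. c i * \<sigma> i) = 0"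
        have "\<sigma> p = v" using tight_sum[OF that(1,2) \<sigma>(1)] \<sigma>(3) tight_nz[OF that(1-3)] Tv by auto
        then show False using \<sigma> that by (auto simp: bij_betw_def inj_on_def)
      qed
      obtain c1 where c1: "c1 \<in> C" using False by blast
      obtain p1 where p1: "p1 \<in> I" "avoids p1 c1" using ex_avoids[OF c1] by blast
      obtain cE where cE: "cE \<in> C" "tight p1 cE" using avoids_tight[OF p1(1) c1 p1(2)] by blast
      have "\<exists>c\<in>C. tight p c" if "p \<in> I" for p
      proof (cases "p = p1")
        case False
        then show ?thesis using avoids_tight[OF that cE(1)] tight_avoids[OF cE(2) p1(1) cE(1) that] by blast
      qed (use cE in blast)
      then obtain f where f: "\<And>p. p \<in> I \<Longrightarrow> f p \<in> C \<and> tight p (f p)" by metis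
      have "inj_on f I"
      proof (rule inj_onI, rule ccontr)
        fix p q assume pq: "p \<in> I" "q \<in> I" "f p = f q" "p \<noteq> q"
        obtain \<sigma> where \<sigma>: "bij_betw \<sigma> I (insert v V)" "\<sigma> p = v" using bij_ex[OF pq(1)] by blast
        have "T * (\<Sum>i\<in>I. f p i * \<sigma> i) = 0" using tight_sum[of p "f p" \<sigma>] f[OF pq(1)] pq(1) \<sigma> by simp
        moreover have "avoids p (f p)" using tight_avoids[of q "f p" p] f[OF pq(2)] f[OF pq(1)] pq by simp
        ultimately show False using \<sigma> T unfolding avoids_def by auto
      qed
      then have "card I \<le> card C"
        using f generic_insert.prems(2) by (intro card_inj_on_le[of f]) auto
      then show False using generic_insert.prems(3) by simp
    qed
  qed
qed

section \<open>Valuation rings above a prime\<close>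

definition is_subring :: "'a::field set \<Rightarrow> bool" where
  "is_subring A \<longleftrightarrow> 1 \<in> A \<and> (\<forall>x\<in>A. \<forall>y\<in>A. x - y \<in> A \<and> x * y \<in> A)"

lemma is_subringD:
  assumes "is_subring A"
  shows "1 \<in> A" "0 \<in> A" "x \<in> A \<Longrightarrow> y \<in> A \<Longrightarrow> x - y \<in> A" "x \<in> A \<Longrightarrow> y \<in> A \<Longrightarrow> x * y \<in> A"
    "x \<in> A \<Longrightarrow> - x \<in> A" "x \<in> A \<Longrightarrow> y \<in> A \<Longrightarrow> x + y \<in> A"
proof -
  show 1: "1 \<in> A" and d: "x \<in> A \<Longrightarrow> y \<in> A \<Longrightarrow> x - y \<in> A" and "x \<in> A \<Longrightarrow> y \<in> A \<Longrightarrow> x * y \<in> A"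
    for x y using assms by (auto simp: is_subring_def)
  show 0: "0 \<in> A" using d[OF 1 1] by simp
  show m: "x \<in> A \<Longrightarrow> - x \<in> A" for x using d[OF 0] by simp
  show "x \<in> A \<Longrightarrow> y \<in> A \<Longrightarrow> x + y \<in> A" for x y using d[OF _ m] by fastforce
qed

lemma is_subring_sum:
  assumes "is_subring A" "\<And>i. i \<in> I \<Longrightarrow> f i \<in> A"
  shows "sum f I \<in> A"
  using assms(2) by (induction I rule: infinite_finite_induct) (auto intro: is_subringD[OF assms(1)])

lemma is_subring_power: "is_subring A \<Longrightarrow> x \<in> A \<Longrightarrow> x ^ n \<in> A"
  by (induction n) (auto intro: is_subringD)

lemma is_subring_of_nat: "is_subring A \<Longrightarrow> of_nat n \<in> A"
  by (induction n) (auto intro: is_subringD)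

lemma is_subring_of_int: "is_subring A \<Longrightarrow> of_int n \<in> A"
  by (cases n rule: int_cases2) (auto intro: is_subringD is_subring_of_nat)

lemma is_subring_adjoin:
  assumes A: "is_subring A"
  shows "is_subring {poly q x | q. \<forall>i. coeff q i \<in> A}" (is "is_subring ?B")
  unfolding is_subring_def
proof (intro conjI ballI)
  show "1 \<in> ?B"
    by (rule CollectI, rule exI[of _ 1]) (auto simp: coeff_1 intro: is_subringD[OF A])
  fix a b assume "a \<in> ?B" "b \<in> ?B"
  then obtain q r where q: "a = poly q x" "\<forall>i. coeff q i \<in> A" and r: "b = poly r x" "\<forall>i. coeff r i \<in> A"
    by auto
  show "a - b \<in> ?B" using q r by (intro CollectI exI[of _ "q - r"]) (auto intro: is_subringD[OF A])
  show "a * b \<in> ?B" using q r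
    by (intro CollectI exI[of _ "q * r"])
       (auto simp: coeff_mult intro!: is_subring_sum[OF A] is_subringD(4)[OF A])
qed

lemma poly_eq_sum:
  fixes q :: "'a::comm_semiring_1 poly"
  assumes "degree q \<le> n"
  shows "poly q x = (\<Sum>i\<le>n. coeff q i * x ^ i)"
  unfolding poly_altdef using assms by (intro sum.mono_neutral_left) (auto simp: coeff_eq_0)

text \<open>If neither \<open>x\<close> nor \<open>1 / x\<close> lies in \<open>M\<close>, maximality writes \<open>1 / w\<close> as a polynomial in \<open>x\<close> and as a
polynomial in \<open>1 / x\<close>. The expression of larger degree can be rewritten with smaller degree, because
\<open>1 - w b\<close> is invertible in \<open>M\<close> for \<open>b\<close> in \<open>M\<close>; so minimal degrees are impossible.\<close>

lemma maximal_subring_is_valuation_ring: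
  fixes M :: "'a::field set" and w :: 'a
  assumes M: "is_subring M" and w: "inverse w \<notin> M" "w \<in> M" "w \<noteq> 0"
    and max: "\<And>A. is_subring A \<Longrightarrow> M \<subseteq> A \<Longrightarrow> inverse w \<notin> A \<Longrightarrow> A = M"
  shows "x \<in> M \<or> inverse x \<in> M"
proof (rule ccontr)
  assume "\<not> ?thesis"
  then have x: "x \<notin> M" "inverse x \<notin> M" by auto
  have x0: "x \<noteq> 0" using x is_subringD(2)[OF M] by auto
  define Rep where "Rep = (\<lambda>y n. \<exists>q. (\<forall>i. coeff q i \<in> M) \<and> degree q \<le> n \<and> poly q y = inverse w)"
  have ex_Rep: "\<exists>n. Rep y n" if y: "y \<notin> M" for y
  proof -
    let ?B = "{poly q y | q. \<forall>i. coeff q i \<in> M}"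
    have "M \<subseteq> ?B"
    proof
      fix a assume "a \<in> M"
      then show "a \<in> ?B"
        by (intro CollectI exI[of _ "[:a:]"]) (auto simp: coeff_pCons split: nat.splits intro: is_subringD(1,2)[OF M])
    qed
    moreover have "y \<in> ?B"
      by (intro CollectI exI[of _ "[:0, 1:]"]) (auto simp: coeff_pCons split: nat.splits intro: is_subringD(1,2)[OF M])
    ultimately have "inverse w \<in> ?B" using max[OF is_subring_adjoin[OF M], of y] y by blast
    then obtain q where "inverse w = poly q y" "\<forall>i. coeff q i \<in> M" by blast
    then show ?thesis unfolding Rep_def by (intro exI[of _ "degree q"] exI[of _ q]) simp
  qed
  \<comment> \<open>Otherwise adjoining this inverse y would produce 1 / w; multiplying by a power of y, which is 1 modulo w, puts 1 / w into M.\<close>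
  have unit: "inverse (1 - w * b) \<in> M" if b: "b \<in> M" for b
  proof (rule ccontr)
    assume "inverse (1 - w * b) \<notin> M"
    define y where "y = 1 - w * b"
    have y0: "y \<noteq> 0"
    proof
      assume "y = 0"
      then have "w * b = 1" by (simp add: y_def)
      then have "b = inverse w" by (simp add: inverse_unique)
      then show False using w b by simp
    qed
    have yM: "y \<in> M" using b w by (auto simp: y_def intro: is_subringD[OF M])
    obtain q n where q: "\<And>i. coeff q i \<in> M" "degree q \<le> n" "poly q (inverse y) = inverse w"
      using ex_Rep \<open>inverse (1 - w * b) \<notin> M\<close> unfolding Rep_def y_def by meson
    have pow: "\<exists>b'\<in>M. y ^ k = 1 - w * b'" for k
    proof (induction k)
      case 0 then show ?case by (intro bexI[of _ 0]) (auto intro: is_subringD[OF M])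
    next
      case (Suc k)
      then obtain b' where b': "b' \<in> M" "y ^ k = 1 - w * b'" by blast
      have "y ^ Suc k = (1 - w * b) * (1 - w * b')"
        by (simp only: power_Suc b'(2)) (simp add: y_def)
      then have "y ^ Suc k = 1 - w * (b' + b - w * b * b')"
        by (simp add: algebra_simps)
      moreover have "b' + b - w * b * b' \<in> M" using b b' w by (intro is_subringD[OF M])
      ultimately show ?case by blast
    qed
    obtain b' where b': "b' \<in> M" "y ^ n = 1 - w * b'" using pow by blast
    have "y ^ n * inverse w = (\<Sum>i\<le>n. coeff q i * (y ^ n * inverse y ^ i))"
      unfolding q(3)[symmetric] poly_eq_sum[OF q(2)] by (simp add: sum_distrib_left algebra_simps)
    also have "\<dots> = (\<Sum>i\<le>n. coeff q i * y ^ (n - i))"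
      using y0 by (intro sum.cong) (auto simp: power_diff field_simps)
    also have "\<dots> \<in> M" using q(1) yM
      by (intro is_subring_sum[OF M] is_subringD(4)[OF M] is_subring_power[OF M])
    finally have "y ^ n * inverse w + b' \<in> M" using b' by (intro is_subringD(6)[OF M])
    also have "y ^ n * inverse w + b' = inverse w" using w by (simp add: b' field_simps)
    finally show False using w by simp
  qed
  have pos: "n > 0" if Rn: "Rep y n" for y n
  proof (rule ccontr)
    assume "\<not> n > 0"
    then obtain q where "\<forall>i. coeff q i \<in> M" "degree q = 0" "poly q y = inverse w"
      using Rn unfolding Rep_def by auto
    then show False using w(1) by (metis degree_eq_zeroE poly_const_conv coeff_pCons_0)
  qed
  have reduce: "Rep y (n - 1)" if Rn: "Rep y n" and Rm: "Rep (inverse y) m" and mn: "m \<le> n" and y0: "y \<noteq> 0" for y n m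
  proof -
    obtain q where q: "\<And>i. coeff q i \<in> M" "degree q \<le> n" "poly q y = inverse w"
      using Rn by (auto simp: Rep_def)
    obtain r where r: "\<And>i. coeff r i \<in> M" "degree r \<le> n" "poly r (inverse y) = inverse w"
      using Rm mn unfolding Rep_def by (metis order.trans)
    define u where "u = 1 - w * coeff r 0"
    have uM: "inverse u \<in> M" using unit r(1) by (simp add: u_def)
    have u0: "u \<noteq> 0"
    proof
      assume "u = 0"
      then have "w * coeff r 0 = 1" by (simp add: u_def)
      then have "coeff r 0 = inverse w" by (simp add: inverse_unique)
      then show False using w(1) r(1)[of 0] by simp
    qed
    have n0: "n > 0" using pos[OF Rn] .
    have "1 = w * (\<Sum>i\<le>n. coeff r i * inverse y ^ i)"
      using w by (simp add: r(3) poly_eq_sum[OF r(2), symmetric])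
    also have "{..n} = insert 0 {1..n}" by auto
    finally have u_eq: "u = w * (\<Sum>i\<in>{1..n}. coeff r i * inverse y ^ i)"
      by (simp add: u_def algebra_simps)
    have "y ^ n * u = w * (\<Sum>i\<in>{1..n}. coeff r i * (y ^ n * inverse y ^ i))"
      unfolding u_eq by (simp add: sum_distrib_left algebra_simps)
    also have "(\<Sum>i\<in>{1..n}. coeff r i * (y ^ n * inverse y ^ i)) = (\<Sum>i\<in>{1..n}. coeff r i * y ^ (n - i))"
      using y0 by (intro sum.cong) (auto simp: power_diff field_simps)
    also have "\<dots> = (\<Sum>k<n. coeff r (n - k) * y ^ k)"
      by (intro sum.reindex_bij_witness[of _ "\<lambda>k. n - k" "\<lambda>i. n - i"]) (use n0 in auto)
    finally have yn: "y ^ n = inverse u * w * (\<Sum>k<n. coeff r (n - k) * y ^ k)"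
      using u0 by (simp add: field_simps)
    define c where "c = (\<lambda>k. coeff q k + coeff q n * (inverse u * w * coeff r (n - k)))"
    \<comment> \<open>The leading term of q is replaced by means of the equation for y ^ n.\<close>
    define q' where "q' = (\<Sum>k<n. monom (c k) k)"
    have "inverse w = (\<Sum>i<n. coeff q i * y ^ i) + coeff q n * y ^ n"
      by (simp add: q(3)[symmetric] poly_eq_sum[OF q(2)] lessThan_Suc_atMost[symmetric])
    also have "\<dots> = (\<Sum>k<n. c k * y ^ k)"
      unfolding yn by (simp add: c_def sum_distrib_left sum.distrib algebra_simps)
    finally have "poly q' y = inverse w" by (simp add: q'_def poly_sum poly_monom)
    moreover have "c k \<in> M" for k unfolding c_def using q(1) r(1) uM w(2)
      by (intro is_subringD(4,6)[OF M])
    then have "coeff q' i \<in> M" for i unfolding q'_def coeff_sum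
      by (intro is_subring_sum[OF M]) (auto simp: is_subringD(2)[OF M])
    moreover have "degree q' \<le> n - 1" unfolding q'_def
      by (intro degree_sum_le) (auto intro: order.trans[OF degree_monom_le])
    ultimately show ?thesis unfolding Rep_def by blast
  qed
  define n where "n = (LEAST n. Rep x n)"
  define m where "m = (LEAST n. Rep (inverse x) n)"
  have n: "Rep x n" unfolding n_def using ex_Rep[OF x(1)] by (rule LeastI_ex)
  have m: "Rep (inverse x) m" unfolding m_def using ex_Rep[OF x(2)] by (rule LeastI_ex)
  show False
  proof (cases "m \<le> n")
    case True
    have "n \<le> n - 1" using reduce[OF n m True x0] unfolding n_def by (rule Least_le)
    then show False using pos[OF n] by linarith
  next
    case False
    have "m \<le> m - 1" using reduce[of "inverse x" m n] n m False x0 unfolding m_def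
      by (intro Least_le) auto
    then show False using pos[OF m] by linarith
  qed
qed

text \<open>Only the ring is recorded, not a value group: \<open>x\<close> and \<open>y\<close> have the same valuation iff \<open>x / y\<close> is a unit.\<close>

locale valuation_ring =
  fixes V :: "'a::field_char_0 set" and p :: nat
  assumes subring: "is_subring V"
    and total: "x \<in> V \<or> inverse x \<in> V"
    and prime: "prime p"
    and p_nonunit: "inverse (of_nat p) \<notin> V"

text \<open>Zorn's lemma applied to the subrings that do not contain \<open>1 / p\<close>; the integers are one of them.\<close>

lemma ex_valuation_ring:
  assumes p: "prime p"
  shows "\<exists>V :: 'a::field_char_0 set. valuation_ring V p"
proof -
  define w :: 'a where "w = of_nat p"
  have w0: "w \<noteq> 0" using p by (auto simp: w_def)
  let ?F = "{A :: 'a set. is_subring A \<and> inverse w \<notin> A}"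
  have "\<exists>M\<in>?F. \<forall>A\<in>?F. M \<subseteq> A \<longrightarrow> A = M"
  proof (rule subset_Zorn_nonempty)
    have "is_subring (\<int> :: 'a set)" by (auto simp: is_subring_def)
    moreover have "inverse w \<notin> \<int>"
    proof
      assume "inverse w \<in> \<int>"
      then obtain k where "inverse w = of_int k" by (auto elim: Ints_cases)
      then have "of_int (k * int p) = (1 :: 'a)" using w0 by (simp add: w_def field_simps)
      then have "k * int p = 1" by (simp only: of_int_eq_1_iff)
      then show False using p by (metis dvd_triv_right int_dvd_int_iff not_prime_unit of_nat_1)
    qed
    ultimately show "?F \<noteq> {}" by blast
    fix C assume C: "C \<noteq> {}" "subset.chain ?F C"
    have CF: "C \<subseteq> ?F" using C(2) by (simp add: subset.chain_def)
    have "is_subring (\<Union>C)"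
      unfolding is_subring_def
    proof (intro conjI ballI)
      show "1 \<in> \<Union>C" using C(1) CF by (auto simp: is_subring_def)
      fix x y assume "x \<in> \<Union>C" "y \<in> \<Union>C"
      then obtain A B where AB: "A \<in> C" "x \<in> A" "B \<in> C" "y \<in> B" by auto
      have "A \<subseteq> B \<or> B \<subseteq> A" using C(2) AB by (auto simp: subset.chain_def)
      then obtain D where D: "D \<in> C" "x \<in> D" "y \<in> D" using AB by blast
      then have "is_subring D" using CF by blast
      then show "x - y \<in> \<Union>C" "x * y \<in> \<Union>C" using D by (auto dest: is_subringD)
    qed
    then show "\<Union>C \<in> ?F" using CF by auto
  qed
  then obtain M where M: "is_subring M" "inverse w \<notin> M" "\<And>A. is_subring A \<Longrightarrow> inverse w \<notin> A \<Longrightarrow> M \<subseteq> A \<Longrightarrow> A = M"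
    by auto
  have "x \<in> M \<or> inverse x \<in> M" for x
    by (rule maximal_subring_is_valuation_ring[of M w])
       (use M w0 in \<open>auto simp: w_def intro: is_subring_of_nat\<close>)
  then have "valuation_ring M p" using M p by unfold_locales (auto simp: w_def)
  then show ?thesis by blast
qed

context valuation_ring
begin

lemmas closed = is_subringD[OF subring]
lemmas sum_closed = is_subring_sum[OF subring]
lemmas power_closed = is_subring_power[OF subring]
lemmas of_int_closed = is_subring_of_int[OF subring]
lemmas of_nat_closed = is_subring_of_nat[OF subring]

definition unit :: "'a \<Rightarrow> bool" where "unit x \<longleftrightarrow> x \<noteq> 0 \<and> x \<in> V \<and> inverse x \<in> V"

definition small :: "'a \<Rightarrow> bool" where "small x \<longleftrightarrow> x \<in> V \<and> \<not> unit x"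

definition p_bounded :: "'a \<Rightarrow> bool" where "p_bounded x \<longleftrightarrow> (\<exists>e. of_nat p ^ e * x \<in> V)"

lemma unit_1: "unit 1" by (simp add: unit_def closed)

lemma unit_mult: "unit x \<Longrightarrow> unit y \<Longrightarrow> unit (x * y)"
  by (auto simp: unit_def closed)

lemma unit_inverse: "unit x \<Longrightarrow> unit (inverse x)"
  by (auto simp: unit_def)

lemma unit_divide: "unit x \<Longrightarrow> unit y \<Longrightarrow> unit (x / y)"
  by (simp add: divide_inverse unit_mult unit_inverse)

lemma unit_power: "unit x \<Longrightarrow> unit (x ^ n)"
  by (induction n) (auto intro: unit_1 unit_mult)

lemma unit_powi: "unit x \<Longrightarrow> unit (x powi n)"
  by (auto simp: power_int_def intro: unit_power unit_inverse)

lemma unit_prod: "(\<And>i. i \<in> I \<Longrightarrow> unit (f i)) \<Longrightarrow> unit (prod f I)"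
  by (induction I rule: infinite_finite_induct) (auto intro: unit_1 unit_mult)

lemma unit_prod_mset: "(\<And>x. x \<in># A \<Longrightarrow> unit (f x)) \<Longrightarrow> unit (\<Prod>x\<in>#A. f x)"
  by (induction A) (auto intro: unit_1 unit_mult)

lemma small_mult: assumes "a \<in> V" "small x" shows "small (a * x)"
proof -
  have "\<not> unit (a * x)"
  proof
    assume u: "unit (a * x)"
    then have "inverse x = a * inverse (a * x)" by (auto simp: unit_def)
    moreover have "a * inverse (a * x) \<in> V" using u assms(1) unfolding unit_def by (intro closed) auto
    ultimately have "inverse x \<in> V" by metis
    then show False using u assms(2) by (auto simp: small_def unit_def)
  qed
  then show ?thesis using assms by (auto simp: small_def closed)
qed

text \<open>One of \<open>x / y\<close> and \<open>y / x\<close> lies in the ring, so the sum is a multiple of one of the summands.\<close>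

lemma small_add: assumes "small x" "small y" shows "small (x + y)"
proof -
  have *: "small (x + y)" if "small x" "y \<noteq> 0" "small y" "x / y \<in> V" for x y
  proof -
    have "small ((x / y + 1) * y)" using that by (intro small_mult closed)
    moreover have "(x / y + 1) * y = x + y" using that(2) by (simp add: distrib_right)
    ultimately show ?thesis by simp
  qed
  show ?thesis
  proof (cases "x = 0 \<or> y = 0")
    case False
    have "x / y \<in> V \<or> y / x \<in> V" using total[of "x / y"] by simp
    then show ?thesis using *[of x y] *[of y x] assms False by (auto simp: add.commute)
  qed (use assms in auto)
qed

lemma small_uminus: "small x \<Longrightarrow> small (- x)"
  using small_mult[of "-1" x] closed by simp

lemma unit_1_plus_small: assumes "small x" shows "unit (1 + x)"
proof (rule ccontr)
  assume "\<not> unit (1 + x)"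
  then have "small (1 + x)" using assms by (auto simp: small_def closed)
  then have "small 1" using small_add[OF _ small_uminus[OF assms], of "1 + x"] by simp
  then show False using unit_1 by (simp add: small_def)
qed

lemma small_p: "small (of_nat p)"
  using p_nonunit of_nat_closed by (auto simp: small_def unit_def)

lemma p_nz: "of_nat p \<noteq> (0 :: 'a)"
  using prime by auto

lemma unit_power_D: assumes "unit (x ^ n)" "n > 0" shows "unit x"
proof (rule ccontr)
  assume nu: "\<not> unit x"
  have x0: "x \<noteq> 0" using assms by (auto simp: unit_def zero_power)
  obtain k where k: "n = Suc k" using assms(2) gr0_conv_Suc by blast
  consider "small x" | "small (inverse x)"
    using total[of x] nu x0 by (auto simp: small_def unit_def)
  then show False
  proof cases
    case 1
    then have "small (x ^ k * x)" by (intro small_mult power_closed) (auto simp: small_def)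
    then show False using assms k by (simp add: small_def mult.commute)
  next
    case 2
    then have "small (inverse x ^ k * inverse x)" by (intro small_mult power_closed) (auto simp: small_def)
    then have "small (inverse (x ^ n))" using k by (simp add: power_inverse mult.commute)
    then show False using unit_inverse[OF assms(1)] by (simp add: small_def)
  qed
qed

lemma unit_of_int: assumes "\<not> int p dvd a" shows "unit (of_int a)"
proof -
  have "coprime a (int p)" using assms prime by (metis coprime_commute prime_imp_coprime prime_nat_int_transfer)
  then obtain x y where xy: "x * a + y * int p = 1" by (metis bezout_int coprime_iff_gcd_eq_1)
  then have "of_int (x * a + y * int p) = (1 :: 'a)" by simp
  then have eq: "of_int x * of_int a = (1 :: 'a) + (- of_int y) * of_nat p" by (simp add: algebra_simps)
  have "small ((- of_int y) * of_nat p)" by (intro small_mult small_p closed of_int_closed)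
  then have u: "unit (of_int x * of_int a)" unfolding eq by (rule unit_1_plus_small)
  show ?thesis
  proof (rule ccontr)
    assume "\<not> ?thesis"
    then have "small (of_int a)" using of_int_closed by (simp add: small_def)
    then show False using u small_mult[OF of_int_closed[of x]] by (auto simp: small_def)
  qed
qed

lemma small_of_int: assumes "int p dvd a" shows "small (of_int a)"
proof -
  obtain k where "a = int p * k" using assms by (rule dvdE)
  then have "a = k * int p" by (simp add: mult.commute)
  then show ?thesis using small_mult[OF of_int_closed[of k] small_p] by simp
qed

lemma p_bounded_of_V: "x \<in> V \<Longrightarrow> p_bounded x"
  unfolding p_bounded_def by (rule exI[of _ 0]) simp

lemma p_bounded_mult: assumes "p_bounded x" "p_bounded y" shows "p_bounded (x * y)"
proof -
  obtain d e where "of_nat p ^ d * x \<in> V" "of_nat p ^ e * y \<in> V" using assms by (auto simp: p_bounded_def)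
  then have "(of_nat p ^ d * x) * (of_nat p ^ e * y) \<in> V" by (rule closed)
  then show ?thesis unfolding p_bounded_def by (intro exI[of _ "d + e"]) (simp add: power_add algebra_simps)
qed

lemma p_bounded_add: assumes "p_bounded x" "p_bounded y" shows "p_bounded (x + y)"
proof -
  obtain d e where "of_nat p ^ d * x \<in> V" "of_nat p ^ e * y \<in> V" using assms by (auto simp: p_bounded_def)
  then have "of_nat p ^ e * (of_nat p ^ d * x) + of_nat p ^ d * (of_nat p ^ e * y) \<in> V"
    using closed(4,6) power_closed[OF of_nat_closed] by blast
  then show ?thesis unfolding p_bounded_def by (intro exI[of _ "d + e"]) (simp add: power_add algebra_simps)
qed

lemma p_bounded_prod_mset: "(\<And>x. x \<in># A \<Longrightarrow> p_bounded (f x)) \<Longrightarrow> p_bounded (\<Prod>x\<in>#A. f x)"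
  by (induction A) (auto intro: p_bounded_mult p_bounded_of_V closed)

text \<open>The prime-to-\<open>p\<close> part of an integer is a unit.\<close>

lemma p_bounded_inverse_of_int: assumes "a \<noteq> 0" shows "p_bounded (inverse (of_int a))"
proof -
  obtain e b where eb: "a = int p ^ e * b" "\<not> int p dvd b"
    using assms prime by (metis multiplicity_decompose' not_prime_unit prime_nat_int_transfer)
  have "unit (of_int b :: 'a)" using eb(2) by (rule unit_of_int)
  then have "inverse (of_int b :: 'a) \<in> V" by (simp add: unit_def)
  moreover have "of_nat p ^ e * inverse (of_int a) = (inverse (of_int b) :: 'a)"
    using p_nz by (simp add: eb(1) field_simps)
  ultimately show ?thesis unfolding p_bounded_def by metis
qed

lemma p_bounded_of_rat: "p_bounded (of_rat r)"
proof (cases r)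
  case (Fract a b)
  then have "of_rat r = of_int a * (inverse (of_int b) :: 'a)"
    by (simp add: of_rat_rat divide_inverse)
  then show ?thesis using Fract p_bounded_mult[OF p_bounded_of_V[OF of_int_closed] p_bounded_inverse_of_int] by simp
qed

lemma small_p_power_mult: assumes "of_nat p ^ e * x \<in> V" shows "small (of_nat p ^ Suc e * x)"
  using small_mult[OF assms small_p] by (simp add: algebra_simps)

text \<open>If \<open>x\<close> is not in the ring, then \<open>1 / x\<close> is; dividing the equation of \<open>x\<close> by \<open>x ^ (degree f - 1)\<close>
shows that the leading coefficient times \<open>x\<close> lies in the ring.\<close>

lemma p_bounded_algebraic:
  assumes f: "f \<noteq> 0" "poly (map_poly of_int f) x = 0"
  shows "p_bounded x"
proof (cases "x \<in> V")
  case False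
  then have ix: "inverse x \<in> V" and x0: "x \<noteq> 0" using total[of x] closed(2) by auto
  let ?r = "degree f"
  have deg: "degree (map_poly of_int f :: 'a poly) = ?r"
    by (intro degree_map_poly) auto
  have r0: "?r > 0"
  proof (rule ccontr)
    assume "\<not> ?r > 0"
    then obtain c where "f = [:c:]" by (metis degree_eq_zeroE gr0I)
    then show False using f by (simp add: map_poly_pCons)
  qed
  have "0 = (\<Sum>i\<le>?r. of_int (coeff f i) * x ^ i)"
    using f(2) by (simp add: poly_altdef deg coeff_map_poly)
  also have "\<dots> = (\<Sum>i<?r. of_int (coeff f i) * x ^ i) + of_int (lead_coeff f) * x ^ ?r"
    by (simp add: lessThan_Suc_atMost[symmetric])
  finally have "of_int (lead_coeff f) * x ^ ?r = - (\<Sum>i<?r. of_int (coeff f i) * x ^ i)"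
    by (simp add: eq_neg_iff_add_eq_0 add.commute)
  then have "of_int (lead_coeff f) * x ^ ?r * inverse x ^ (?r - 1) =
      - (\<Sum>i<?r. of_int (coeff f i) * (x ^ i * inverse x ^ (?r - 1)))"
    by (simp add: sum_distrib_right mult.assoc)
  also have "of_int (lead_coeff f) * x ^ ?r * inverse x ^ (?r - 1) = of_int (lead_coeff f) * x"
    using r0 x0 by (cases ?r) (auto simp: power_inverse)
  also have "(\<Sum>i<?r. of_int (coeff f i) * (x ^ i * inverse x ^ (?r - 1))) =
      (\<Sum>i<?r. of_int (coeff f i) * inverse x ^ (?r - 1 - i))"
  proof (intro sum.cong refl)
    fix i assume "i \<in> {..<?r}"
    then have "?r - 1 = i + (?r - 1 - i)" by auto
    then have "inverse x ^ (?r - 1) = inverse x ^ i * inverse x ^ (?r - 1 - i)" by (metis power_add)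
    then show "of_int (coeff f i) * (x ^ i * inverse x ^ (?r - 1)) = of_int (coeff f i) * inverse x ^ (?r - 1 - i)"
      using x0 by (simp add: power_inverse)
  qed
  finally have eq: "of_int (lead_coeff f) * x = - (\<Sum>i<?r. of_int (coeff f i) * inverse x ^ (?r - 1 - i))" .
  have "of_int (lead_coeff f) * x \<in> V"
    unfolding eq by (intro closed(5) sum_closed closed(4) of_int_closed power_closed ix)
  then have "p_bounded (inverse (of_int (lead_coeff f)) * (of_int (lead_coeff f) * x))"
    using f(1) by (intro p_bounded_mult p_bounded_inverse_of_int p_bounded_of_V) auto
  then show ?thesis using f(1) by (simp add: mult.assoc[symmetric])
qed (rule p_bounded_of_V)

text \<open>The powers of an algebraic \<open>x\<close> in the ring take finitely many values modulo \<open>p ^ e\<close>. The equation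
of \<open>x\<close> need not be monic. But after removing the content, let \<open>r\<close> be the largest index of a coefficient
prime to \<open>p\<close>: modulo \<open>p\<close>, the power \<open>x ^ r\<close> is an integral combination of lower powers, and substituting
this into the terms of higher index improves the modulus by one factor \<open>p\<close> at a time. So every power
is, modulo \<open>p ^ e\<close>, a combination of \<open>1, \<dots>, x ^ (r - 1)\<close> with integers modulo \<open>p ^ e\<close> as coefficients.\<close>

lemma finite_powers_mod:
  assumes V: "x \<in> V" and f: "f \<noteq> 0" "poly (map_poly of_int f) x = 0"
  shows "\<exists>a b. a < b \<and> (x ^ a - x ^ b) / of_nat p ^ e \<in> V"
proof -
  define F where "F = primitive_part f"
  have "map_poly of_int f = smult (of_int (content f)) (map_poly of_int F :: 'a poly)"
    unfolding F_def by (subst content_times_primitive_part[of f, symmetric])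
      (simp add: poly_eq_iff coeff_map_poly del: content_times_primitive_part)
  moreover have "content f \<noteq> 0" using f(1) by simp
  ultimately have Fx: "poly (map_poly of_int F) x = 0" using f(2) by simp
  have F0: "F \<noteq> 0" using f(1) by (simp add: F_def)
  have deg: "degree (map_poly of_int F :: 'a poly) = degree F" by (intro degree_map_poly) auto
  have "\<exists>i. \<not> int p dvd coeff F i"
  proof (rule ccontr)
    assume "\<not> ?thesis"
    then have "[:int p:] dvd F" by (simp add: const_poly_dvd_iff)
    then have "int p dvd content F" by (simp add: const_poly_dvd_iff_dvd_content)
    then show False using f(1) prime by (simp add: F_def not_prime_unit)
  qed
  then obtain i0 where i0: "\<not> int p dvd coeff F i0" ..
  define r where "r = Max {i. i \<le> degree F \<and> \<not> int p dvd coeff F i}"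
  have fin: "finite {i. i \<le> degree F \<and> \<not> int p dvd coeff F i}" by simp
  have ne: "i0 \<in> {i. i \<le> degree F \<and> \<not> int p dvd coeff F i}"
    using i0 by (auto intro: le_degree)
  then have rr: "r \<le> degree F" "\<not> int p dvd coeff F r"
    using Max_in[OF fin] unfolding r_def by blast+
  have high: "int p dvd coeff F i" if "i > r" for i
  proof (rule ccontr)
    assume n: "\<not> int p dvd coeff F i"
    then have "i \<le> degree F" by (auto intro: le_degree)
    then have "i \<le> r" unfolding r_def using n by (intro Max_ge fin) simp
    then show False using that by simp
  qed
  \<comment> \<open>The predicate near e z says that z is an integral combination of 1, ..., x ^ (r - 1) modulo p ^ e.\<close>
  define near where "near = (\<lambda>e z. \<exists>c. (z - (\<Sum>i<r. of_int (c i) * x ^ i)) / of_nat p ^ e \<in> V)"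
  have near_add: "near e (y + z)" if "near e y" "near e z" for e y z
  proof -
    from that obtain c d where cd: "(y - (\<Sum>i<r. of_int (c i) * x ^ i)) / of_nat p ^ e \<in> V"
        "(z - (\<Sum>i<r. of_int (d i) * x ^ i)) / of_nat p ^ e \<in> V"
      unfolding near_def by blast
    have "(y + z - (\<Sum>i<r. of_int (c i + d i) * x ^ i)) / of_nat p ^ e =
       (y - (\<Sum>i<r. of_int (c i) * x ^ i)) / of_nat p ^ e + (z - (\<Sum>i<r. of_int (d i) * x ^ i)) / of_nat p ^ e"
      by (simp add: sum.distrib algebra_simps add_divide_distrib diff_divide_distrib)
    then show ?thesis unfolding near_def using closed(6)[OF cd] by metis
  qed
  have near_scale: "near e (of_int k * y)" if "near e y" for e k y
  proof -
    from that obtain c where c: "(y - (\<Sum>i<r. of_int (c i) * x ^ i)) / of_nat p ^ e \<in> V"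
      unfolding near_def by blast
    have "(of_int k * y - (\<Sum>i<r. of_int (k * c i) * x ^ i)) / of_nat p ^ e =
       of_int k * ((y - (\<Sum>i<r. of_int (c i) * x ^ i)) / of_nat p ^ e)"
      by (simp add: sum_distrib_left algebra_simps)
    then show ?thesis unfolding near_def using closed(4)[OF of_int_closed c] by metis
  qed
  have near_p: "near (Suc e) (of_int (int p * k) * y)" if "near e y" for e k y
  proof -
    from near_scale[OF that, of k] obtain c
      where c: "(of_int k * y - (\<Sum>i<r. of_int (c i) * x ^ i)) / of_nat p ^ e \<in> V"
      unfolding near_def by blast
    have "of_int (int p * k) * y - (\<Sum>i<r. of_int (int p * c i) * x ^ i) =
        of_nat p * (of_int k * y - (\<Sum>i<r. of_int (c i) * x ^ i))"
      by (simp add: sum_distrib_left algebra_simps)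
    then have "(of_int (int p * k) * y - (\<Sum>i<r. of_int (int p * c i) * x ^ i)) / of_nat p ^ Suc e =
       (of_int k * y - (\<Sum>i<r. of_int (c i) * x ^ i)) / of_nat p ^ e"
      using p_nz by simp
    then show ?thesis unfolding near_def using c by metis
  qed
  have near_low: "near e (x ^ i)" if "i < r" for e i
  proof -
    have "(\<Sum>j<r. of_int (if j = i then 1 else 0) * x ^ j) = (\<Sum>j<r. if j = i then x ^ j else 0)"
      by (intro sum.cong) auto
    also have "\<dots> = x ^ i" using that by simp
    finally have "(x ^ i - (\<Sum>j<r. of_int (if j = i then 1 else 0) * x ^ j)) / of_nat p ^ e = 0"
      by simp
    then show ?thesis unfolding near_def using closed(2) by metis
  qed
  have near_0: "near e 0" for e
    unfolding near_def by (rule exI[of _ "\<lambda>_. 0"]) (simp add: closed(2))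
  have near_sum: "near e (sum g I)" if "\<And>i. i \<in> I \<Longrightarrow> near e (g i)" for e g and I :: "nat set"
    using that by (induction I rule: infinite_finite_induct) (auto intro: near_0 near_add)
  have near_V: "\<exists>c. (z - (\<Sum>i<r. of_int (c i) * x ^ i)) / of_nat p ^ e \<in> V" if "near e z" for e z
    using that by (simp add: near_def)
  have near_eV: "near e z" if "z / of_nat p ^ e \<in> V" for e z
    unfolding near_def using that by (intro exI[of _ "\<lambda>_. 0"]) simp
  have all_near: "near e (x ^ k)" for e k
  proof (induction e arbitrary: k)
    case 0
    show ?case by (rule near_eV) (simp add: power_closed V)
  next
    case (Suc e)
    obtain c z where cz: "c * coeff F r = 1 + int p * z"
    proof -
      have "coprime (coeff F r) (int p)" using rr(2) prime
        by (metis coprime_commute prime_imp_coprime prime_nat_int_transfer)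
      then obtain u w where "u * coeff F r + w * int p = 1"
        by (metis bezout_int coprime_iff_gcd_eq_1)
      then have "u * coeff F r = 1 + int p * (- w)" by (simp add: algebra_simps)
      then show ?thesis using that by blast
    qed
    have "0 = (\<Sum>i\<le>degree F. of_int (coeff F i) * x ^ i)"
      using Fx by (simp add: poly_altdef deg coeff_map_poly)
    also have "\<dots> = of_int (coeff F r) * x ^ r + (\<Sum>i\<in>{..degree F} - {r}. of_int (coeff F i) * x ^ i)"
      using rr(1) by (subst sum.remove[of _ r]) auto
    finally have "of_int (coeff F r) * x ^ r = - (\<Sum>i\<in>{..degree F} - {r}. of_int (coeff F i) * x ^ i)"
      by (simp add: eq_neg_iff_add_eq_0)
    then have "of_int (c * coeff F r) * x ^ r = of_int (- c) * (\<Sum>i\<in>{..degree F} - {r}. of_int (coeff F i) * x ^ i)"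
      by (simp add: algebra_simps)
    moreover have "of_int (c * coeff F r) * x ^ r = x ^ r - of_int (int p * - z) * x ^ r"
      unfolding cz by (simp add: algebra_simps)
    ultimately have xr: "x ^ r = of_int (- c) * (\<Sum>i\<in>{..degree F} - {r}. of_int (coeff F i) * x ^ i) + of_int (int p * - z) * x ^ r"
      by (simp only: eq_diff_eq diff_eq_eq)
    have near_i: "near (Suc e) (of_int (coeff F i) * x ^ i)" if i: "i \<in> {..degree F} - {r}" for i
      proof (cases "i < r")
        case True then show ?thesis by (intro near_scale near_low)
      next
        case False
        then have "int p dvd coeff F i" using i by (intro high) auto
        then obtain k where "coeff F i = int p * k" by (rule dvdE)
        then show ?thesis using near_p[OF Suc, of k i] by simp
      qed
    have near_r: "near (Suc e) (x ^ r)"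
      by (subst xr, rule near_add[OF near_scale near_p]) (use near_i Suc in \<open>auto intro: near_sum\<close>)
    have near_le: "near (Suc e) (x ^ i)" if "i \<le> r" for i
      using that near_r near_low by (cases "i = r") auto
    show ?case
    proof (induction k)
      case 0 show ?case using near_le[of 0] by simp
    next
      case (Suc k)
      obtain c where c: "(x ^ k - (\<Sum>i<r. of_int (c i) * x ^ i)) / of_nat p ^ Suc e \<in> V"
        using Suc unfolding near_def by blast
      have "x * ((x ^ k - (\<Sum>i<r. of_int (c i) * x ^ i)) / of_nat p ^ Suc e) \<in> V"
        using V c by (rule closed)
      then have "near (Suc e) (x * (x ^ k - (\<Sum>i<r. of_int (c i) * x ^ i)))"
        by (intro near_eV) simp
      moreover have "near (Suc e) (\<Sum>i<r. of_int (c i) * x ^ Suc i)"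
        by (intro near_sum near_scale near_le) auto
      ultimately have "near (Suc e) (x * (x ^ k - (\<Sum>i<r. of_int (c i) * x ^ i)) + (\<Sum>i<r. of_int (c i) * x ^ Suc i))"
        by (rule near_add)
      then show ?case by (simp add: algebra_simps sum_distrib_left)
    qed
  qed
  have "\<forall>k. \<exists>c. (x ^ k - (\<Sum>i<r. of_int (c i) * x ^ i)) / of_nat p ^ e \<in> V"
    using all_near near_V by blast
  then obtain c where c: "\<And>k. (x ^ k - (\<Sum>i<r. of_int (c k i) * x ^ i)) / of_nat p ^ e \<in> V"
    by metis
  define d where "d = (\<lambda>k. restrict (\<lambda>i. c k i mod int p ^ e) {..<r})"
  have "range d \<subseteq> {..<r} \<rightarrow>\<^sub>E {0..<int p ^ e}"
    using prime by (auto simp: d_def prime_gt_0_nat PiE_def extensional_def)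
  then have "finite (range d)" by (rule finite_subset) (auto intro: finite_PiE)
  then have "\<not> inj d" using finite_imageD infinite_UNIV_nat by blast
  then obtain a b where ab: "a < b" "d a = d b"
    unfolding inj_def by (metis linorder_neqE_nat)
  have cong: "\<exists>q. c a i - c b i = int p ^ e * q" if "i < r" for i
  proof -
    have "c a i mod int p ^ e = c b i mod int p ^ e"
      using fun_cong[OF ab(2), of i] that by (simp add: d_def)
    then have "int p ^ e dvd c a i - c b i" by (simp add: mod_eq_dvd_iff)
    then show ?thesis by (auto elim: dvdE)
  qed
  then obtain q where q: "\<And>i. i < r \<Longrightarrow> c a i - c b i = int p ^ e * q i" by metis
  have "(\<Sum>i<r. of_int (c a i) * x ^ i) - (\<Sum>i<r. of_int (c b i) * x ^ i) = (\<Sum>i<r. of_int (c a i - c b i) * x ^ i)"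
    by (simp add: sum_subtractf algebra_simps)
  also have "\<dots> = (\<Sum>i<r. of_int (int p ^ e * q i) * x ^ i)"
    using q by (intro sum.cong) auto
  also have "\<dots> = of_nat p ^ e * (\<Sum>i<r. of_int (q i) * x ^ i)"
    by (simp add: sum_distrib_left algebra_simps)
  finally have eq0: "x ^ a - x ^ b = (x ^ a - (\<Sum>i<r. of_int (c a i) * x ^ i)) -
     (x ^ b - (\<Sum>i<r. of_int (c b i) * x ^ i)) + of_nat p ^ e * (\<Sum>i<r. of_int (q i) * x ^ i)"
    by (simp add: algebra_simps)
  have eq: "(x ^ a - x ^ b) / of_nat p ^ e = (x ^ a - (\<Sum>i<r. of_int (c a i) * x ^ i)) / of_nat p ^ e -
     (x ^ b - (\<Sum>i<r. of_int (c b i) * x ^ i)) / of_nat p ^ e + (\<Sum>i<r. of_int (q i) * x ^ i)"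
    using p_nz unfolding eq0 by (simp add: add_divide_distrib diff_divide_distrib)
  have "(\<Sum>i<r. of_int (q i) * x ^ i) \<in> V"
    by (intro sum_closed closed(4) of_int_closed power_closed V)
  then have "(x ^ a - x ^ b) / of_nat p ^ e \<in> V"
    unfolding eq using c[of a] c[of b] by (intro closed(6)[OF closed(3)])
  then show ?thesis using ab(1) by blast
qed

lemma unit_power_near_1:
  assumes "unit x" and f: "f \<noteq> 0" "poly (map_poly of_int f) x = 0"
  shows "\<exists>m>0. (x ^ m - 1) / of_nat p ^ e \<in> V"
proof -
  have xV: "x \<in> V" using assms(1) by (simp add: unit_def)
  obtain a b where ab: "a < b" "(x ^ a - x ^ b) / of_nat p ^ e \<in> V"
    using finite_powers_mod[OF xV f] by blast
  have x0: "x \<noteq> 0" using assms(1) by (simp add: unit_def)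
  have "x ^ b = x ^ a * x ^ (b - a)" using ab(1) by (simp add: power_add[symmetric])
  then have "(x ^ (b - a) - 1) / of_nat p ^ e = (- inverse (x ^ a)) * ((x ^ a - x ^ b) / of_nat p ^ e)"
    using x0 p_nz by (simp add: field_simps)
  moreover have "- inverse (x ^ a) \<in> V"
    using unit_inverse[OF unit_power[OF assms(1), of a]] by (intro closed(5)) (simp add: unit_def)
  ultimately have "(x ^ (b - a) - 1) / of_nat p ^ e \<in> V" using ab(2) closed(4) by metis
  then show ?thesis using ab(1) by (intro exI[of _ "b - a"]) simp
qed

lemma small_power_near_0:
  assumes "small x" and f: "f \<noteq> 0" "poly (map_poly of_int f) x = 0"
  shows "\<exists>m>0. x ^ m / of_nat p ^ e \<in> V"
proof -
  have xV: "x \<in> V" using assms(1) by (simp add: small_def)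
  obtain a b where ab: "a < b" "(x ^ a - x ^ b) / of_nat p ^ e \<in> V"
    using finite_powers_mod[OF xV f] by blast
  have ba: "x ^ b = x ^ a * x ^ (b - a)" using ab(1) by (simp add: power_add[symmetric])
  have "x ^ (b - a) = x ^ (b - a - 1) * x" using ab(1) power_minus_mult[of "b - a" x] by simp
  then have "small (- (x ^ (b - a)))"
    using small_mult[OF power_closed[OF xV] assms(1)] small_uminus by metis
  then have u: "unit (1 + - (x ^ (b - a)))" by (rule unit_1_plus_small)
  have "x ^ a / of_nat p ^ e = inverse (1 + - (x ^ (b - a))) * ((x ^ a - x ^ b) / of_nat p ^ e)"
    using u p_nz by (simp add: unit_def ba field_simps)
  then have *: "x ^ a / of_nat p ^ e \<in> V" using u ab(2) closed(4) unfolding unit_def by metis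
  have "x * (x ^ a / of_nat p ^ e) \<in> V" using xV * by (rule closed)
  then show ?thesis by (intro exI[of _ "Suc a"]) simp
qed

text \<open>Depending on whether \<open>x\<close> is a unit, small, or the inverse of a small element, choose \<open>m\<close> such that \<open>x ^ m\<close>
is close to \<open>1\<close>, to \<open>0\<close> or to infinity. Then \<open>s + x ^ (c + m * j)\<close> differs by a unit from \<open>s + x ^ c\<close>,
from \<open>s\<close>, or from \<open>x ^ (c + m * j)\<close>.\<close>

lemma translated_powers_geometric:
  assumes x0: "x \<noteq> 0" and f: "f \<noteq> 0" "poly (map_poly of_int f) x = 0"
    and s: "s \<noteq> 0" "p_bounded s" "p_bounded (inverse s)"
    and sc: "s + x ^ c \<noteq> 0" "p_bounded (inverse (s + x ^ c))"
  shows "\<exists>m>0. \<exists>\<alpha> \<theta>. \<alpha> \<noteq> 0 \<and> \<theta> \<noteq> 0 \<and> (\<forall>j\<ge>1. unit ((s + x ^ (c + m * j)) / (\<alpha> * \<theta> ^ j)))"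
proof -
  consider "unit x" | "small x" | "small (inverse x)"
    using total[of x] x0 by (auto simp: small_def unit_def)
  then show ?thesis
  proof cases
    case 1
    obtain e where "of_nat p ^ e * inverse (s + x ^ c) \<in> V" using sc(2) by (auto simp: p_bounded_def)
    then have sm: "small (of_nat p ^ Suc e * inverse (s + x ^ c))" by (rule small_p_power_mult)
    obtain m where m: "m > 0" "(x ^ m - 1) / of_nat p ^ Suc e \<in> V"
      using unit_power_near_1[OF 1 f] by blast
    have xV: "x \<in> V" using 1 by (simp add: unit_def)
    have alg: "w + y * (a * b) = w * (1 + y * (a / q) * b * (q * inverse w))"
      if "w \<noteq> 0" "q \<noteq> 0" for w q y a b :: 'a
      using that by (simp add: field_simps)
    have "unit ((s + x ^ (c + m * j)) / ((s + x ^ c) * 1 ^ j))" for j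
    proof -
      have "s + x ^ (c + m * j) = (s + x ^ c) + x ^ c * ((x ^ m) ^ j - 1)"
        by (simp only: power_add power_mult) (simp add: algebra_simps)
      also have "(x ^ m) ^ j - 1 = (x ^ m - 1) * (\<Sum>i<j. (x ^ m) ^ i)"
        by (rule power_diff_1_eq)
      also have "(s + x ^ c) + x ^ c * ((x ^ m - 1) * (\<Sum>i<j. (x ^ m) ^ i)) =
         (s + x ^ c) * (1 + x ^ c * ((x ^ m - 1) / of_nat p ^ Suc e) * (\<Sum>i<j. (x ^ m) ^ i) * (of_nat p ^ Suc e * inverse (s + x ^ c)))"
        using sc(1) p_nz by (intro alg) auto
      finally have "(s + x ^ (c + m * j)) / (s + x ^ c) =
         1 + (x ^ c * ((x ^ m - 1) / of_nat p ^ Suc e) * (\<Sum>i<j. (x ^ m) ^ i)) * (of_nat p ^ Suc e * inverse (s + x ^ c))"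
        using sc(1) by simp
      then have eq: "(s + x ^ (c + m * j)) / ((s + x ^ c) * 1 ^ j) = 1 + x ^ c * ((x ^ m - 1) / of_nat p ^ Suc e) * (\<Sum>i<j. (x ^ m) ^ i) * (of_nat p ^ Suc e * inverse (s + x ^ c))"
        by (simp only: power_one mult_1_right)
      have "x ^ c * ((x ^ m - 1) / of_nat p ^ Suc e) * (\<Sum>i<j. (x ^ m) ^ i) \<in> V"
        by (intro closed(4) power_closed sum_closed m xV)
      then show ?thesis unfolding eq by (intro unit_1_plus_small small_mult sm)
    qed
    then show ?thesis using m(1) sc(1) by (intro exI[of _ m] conjI exI[of _ "s + x ^ c"] exI[of _ 1]) auto
  next
    case 2
    obtain e where "of_nat p ^ e * inverse s \<in> V" using s(3) by (auto simp: p_bounded_def)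
    then have sm: "small (of_nat p ^ Suc e * inverse s)" by (rule small_p_power_mult)
    obtain m where m: "m > 0" "x ^ m / of_nat p ^ Suc e \<in> V"
      using small_power_near_0[OF 2 f] by blast
    have xV: "x \<in> V" using 2 by (simp add: small_def)
    have "unit ((s + x ^ (c + m * j)) / (s * 1 ^ j))" if j: "j \<ge> 1" for j
    proof -
      obtain i where i: "j = Suc i" using j by (cases j) auto
      have eq: "(s + x ^ (c + m * j)) / (s * 1 ^ j) = 1 + (x ^ c * (x ^ m / of_nat p ^ Suc e) * (x ^ m) ^ i) * (of_nat p ^ Suc e * inverse s)"
        using s(1) p_nz by (simp only: i power_add power_mult power_Suc[of "x ^ m"]) (simp add: field_simps)
      have "x ^ c * (x ^ m / of_nat p ^ Suc e) * (x ^ m) ^ i \<in> V"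
        by (intro closed(4) power_closed m xV)
      then show ?thesis unfolding eq by (intro unit_1_plus_small small_mult sm)
    qed
    then show ?thesis using m(1) s(1) by (intro exI[of _ m] conjI exI[of _ s] exI[of _ 1]) auto
  next
    case 3
    obtain e where "of_nat p ^ e * s \<in> V" using s(2) by (auto simp: p_bounded_def)
    then have sm: "small (of_nat p ^ Suc e * s)" by (rule small_p_power_mult)
    have g: "reflect_poly f \<noteq> 0" "poly (map_poly of_int (reflect_poly f)) (inverse x) = 0"
    proof -
      show "reflect_poly f \<noteq> 0" using f(1) by simp
      have deg: "degree (map_poly of_int f :: 'a poly) = degree f" by (intro degree_map_poly) auto
      have "map_poly of_int (reflect_poly f) = reflect_poly (map_poly of_int f :: 'a poly)"
        by (auto simp: poly_eq_iff coeff_map_poly coeff_reflect_poly deg)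
      then show "poly (map_poly of_int (reflect_poly f)) (inverse x) = 0"
        using poly_reflect_poly_nz[of "inverse x" "map_poly of_int f"] x0 f(2) by simp
    qed
    obtain m where m: "m > 0" "inverse x ^ m / of_nat p ^ Suc e \<in> V"
      using small_power_near_0[OF 3 g] by blast
    have xV: "inverse x \<in> V" using 3 by (simp add: small_def)
    have "unit ((s + x ^ (c + m * j)) / (x ^ c * (x ^ m) ^ j))" if j: "j \<ge> 1" for j
    proof -
      obtain i where i: "j = Suc i" using j by (cases j) auto
      have "(s + x ^ (c + m * j)) / (x ^ c * (x ^ m) ^ j) = 1 + s * (inverse x ^ c * (inverse x ^ m) ^ j)"
        using x0 by (simp only: power_add power_mult) (simp add: field_simps power_inverse)
      also have "s * (inverse x ^ c * (inverse x ^ m) ^ j) = 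
        (inverse x ^ c * (inverse x ^ m / of_nat p ^ Suc e) * (inverse x ^ m) ^ i) * (of_nat p ^ Suc e * s)"
        using p_nz by (simp add: i)
      finally have eq: "(s + x ^ (c + m * j)) / (x ^ c * (x ^ m) ^ j) = 1 + (inverse x ^ c * (inverse x ^ m / of_nat p ^ Suc e) * (inverse x ^ m) ^ i) * (of_nat p ^ Suc e * s)" .
      have "inverse x ^ c * (inverse x ^ m / of_nat p ^ Suc e) * (inverse x ^ m) ^ i \<in> V"
        by (intro closed(4) power_closed m xV)
      then show ?thesis unfolding eq by (intro unit_1_plus_small small_mult sm)
    qed
    then show ?thesis using m(1) x0 by (intro exI[of _ m] conjI exI[of _ "x ^ c"] exI[of _ "x ^ m"]) auto
  qed
qed

end

section \<open>Rational polynomials at algebraic and transcendental points\<close>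

text \<open>Rational polynomials serve to compare equations at an element of the given field with equations at its
complex conjugates.\<close>

definition ev :: "rat poly \<Rightarrow> 'a::field_char_0 \<Rightarrow> 'a" where
  "ev h x = poly (map_poly of_rat h) x"

lemma ev_0 [simp]: "ev 0 x = 0" by (simp add: ev_def)

lemma ev_pCons [simp]: "ev (pCons a h) x = of_rat a + x * ev h x"
  by (simp add: ev_def map_poly_pCons)

lemma ev_1 [simp]: "ev 1 x = 1" by (simp add: one_pCons)

lemma ev_add [simp]: "ev (g + h) x = ev g x + ev h x"
proof -
  have "map_poly of_rat (g + h) = map_poly of_rat g + (map_poly of_rat h :: 'a poly)"
    by (simp add: poly_eq_iff coeff_map_poly of_rat_add)
  then show ?thesis by (simp add: ev_def)
qed

lemma ev_smult [simp]: "ev (smult c h) x = of_rat c * ev h x"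
proof -
  have "map_poly of_rat (smult c h) = smult (of_rat c) (map_poly of_rat h :: 'a poly)"
    by (simp add: poly_eq_iff coeff_map_poly of_rat_mult)
  then show ?thesis by (simp add: ev_def)
qed

lemma ev_minus [simp]: "ev (- h) x = - ev h x"
  using ev_smult[of "-1" h x] by (simp add: of_rat_minus)

lemma ev_diff [simp]: "ev (g - h) x = ev g x - ev h x"
  using ev_add[of g "- h" x] by simp

lemma ev_mult [simp]: "ev (g * h) x = ev g x * ev h x"
  by (induction g) (simp_all add: algebra_simps)

lemma ev_power [simp]: "ev (h ^ n) x = ev h x ^ n"
  by (induction n) simp_all

lemma ev_monom [simp]: "ev (monom c n) x = of_rat c * x ^ n"
  by (simp add: ev_def map_poly_monom poly_monom)

lemma ev_sum [simp]: "ev (sum f I) x = (\<Sum>i\<in>I. ev (f i) x)"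
  by (induction I rule: infinite_finite_induct) simp_all

lemma ev_prod [simp]: "ev (prod f I) x = (\<Prod>i\<in>I. ev (f i) x)"
  by (induction I rule: infinite_finite_induct) simp_all

lemma ev_dvd: "g dvd h \<Longrightarrow> ev g x = 0 \<Longrightarrow> ev h x = 0"
  by (auto elim: dvdE)

lemma ev_eq_0_int_poly:
  assumes "f \<noteq> 0" "ev f x = 0"
  shows "\<exists>F :: int poly. F \<noteq> 0 \<and> poly (map_poly of_int F) x = 0"
proof -
  have "algebraic x" unfolding algebraic_altdef
    by (rule exI[of _ "map_poly of_rat f"])
       (use assms in \<open>auto simp: ev_def coeff_map_poly map_poly_eq_0_iff\<close>)
  then show ?thesis by (rule algebraicE') blast
qed

definition root_mset :: "rat poly \<Rightarrow> complex multiset \<Rightarrow> bool" where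
  "root_mset f A \<longleftrightarrow> map_poly of_rat f = smult (of_rat (lead_coeff f)) (\<Prod>x\<in>#A. [:- x, 1:])"

lemma ex_root_mset:
  assumes "f \<noteq> 0" shows "\<exists>A. root_mset f A \<and> size A = degree f"
proof -
  have *: "degree (map_poly of_rat f :: complex poly) = degree f"
    by (intro degree_map_poly) auto
  have "map_poly of_rat f \<noteq> (0 :: complex poly)" using assms by (simp add: map_poly_eq_0_iff)
  from alg_closed_imp_factorization[OF this] show ?thesis
    by (auto simp: root_mset_def * coeff_map_poly)
qed

lemma ev_root_mset:
  assumes "root_mset f A" shows "ev f y = of_rat (lead_coeff f) * (\<Prod>x\<in>#A. y - x)"
  using assms by (simp add: ev_def root_mset_def poly_prod_mset image_mset.compositionality o_def)

lemma root_mset_root: "root_mset f A \<Longrightarrow> x \<in># A \<Longrightarrow> ev f x = 0"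
  by (auto simp: ev_root_mset prod_mset_zero_iff)

text \<open>The norm of \<open>g\<close> modulo \<open>f\<close>, the product of the values of \<open>g\<close> at the roots of \<open>f\<close>, is rational. This follows the
Euclidean algorithm: one may reduce \<open>g\<close> modulo \<open>f\<close>, and the products of \<open>g\<close> over the roots of \<open>f\<close> and of \<open>f\<close>
over the roots of \<open>g\<close> agree up to sign and powers of the leading coefficients.\<close>

lemma prod_mset_rational:
  assumes "f \<noteq> 0" "root_mset f A"
  shows "\<exists>q :: rat. (\<Prod>x\<in>#A. ev g x) = of_rat q"
  using assms
proof (induction "degree f" arbitrary: f g A rule: less_induct)
  case less
  define h where "h = g mod f"
  have "ev g x = ev h x" if "x \<in># A" for x
  proof -
    have "ev g x = ev (g div f * f + h) x" by (simp only: h_def div_mult_mod_eq)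
    then show ?thesis using root_mset_root[OF less.prems(2) that] by simp
  qed
  then have gh: "(\<Prod>x\<in>#A. ev g x) = (\<Prod>x\<in>#A. ev h x)"
    by (intro arg_cong[of _ _ prod_mset] image_mset_cong) auto
  show ?case
  proof (cases "h = 0")
    case True
    then have "(\<Prod>x\<in>#A. ev g x) = of_rat (if A = {#} then 1 else 0)"
      unfolding gh by (cases A) auto
    then show ?thesis by blast
  next
    case False
    show ?thesis
    proof (cases "A = {#}")
      case True then show ?thesis by (intro exI[of _ 1]) simp
    next
      case ne: False
      then obtain x where "x \<in># A" by blast
      have "degree f > 0"
      proof (rule ccontr)
        assume "\<not> degree f > 0"
        then obtain c where "f = [:c:]" by (metis degree_eq_zeroE gr0I)
        then show False using root_mset_root[OF less.prems(2) \<open>x \<in># A\<close>] less.prems(1) by simp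
      qed
      then have deg: "degree h < degree f"
        unfolding h_def using less.prems(1) False h_def degree_mod_less by blast
      obtain B where B: "root_mset h B" using ex_root_mset[OF False] by blast
      obtain q where q: "(\<Prod>y\<in>#B. ev f y) = of_rat q"
        using less.hyps[OF deg False B] by blast
      have "(\<Prod>x\<in>#A. ev h x) = (\<Prod>x\<in>#A. of_rat (lead_coeff h) * (\<Prod>y\<in>#B. x - y))"
        by (simp add: ev_root_mset[OF B])
      also have "\<dots> = of_rat (lead_coeff h) ^ size A * (\<Prod>x\<in>#A. \<Prod>y\<in>#B. x - y)"
        by (simp add: prod_mset.distrib)
      also have "(\<Prod>x\<in>#A. \<Prod>y\<in>#B. x - y) = (\<Prod>x\<in>#A. (-1) ^ size B * (\<Prod>y\<in>#B. y - x))"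
      proof -
        have "(\<Prod>y\<in>#B. x - y) = (-1) ^ size B * (\<Prod>y\<in>#B. y - x)" for x :: complex
          by (induction B) (auto simp: algebra_simps)
        then show ?thesis by simp
      qed
      also have "\<dots> = ((-1) ^ size B) ^ size A * (\<Prod>x\<in>#A. \<Prod>y\<in>#B. y - x)"
        by (simp add: prod_mset.distrib)
      also have "(\<Prod>x\<in>#A. \<Prod>y\<in>#B. y - x) = (\<Prod>y\<in>#B. \<Prod>x\<in>#A. y - x)"
        by (rule prod_mset.swap)
      finally have 1: "(\<Prod>x\<in>#A. ev h x) = of_rat (lead_coeff h) ^ size A * (((-1) ^ size B) ^ size A * (\<Prod>y\<in>#B. \<Prod>x\<in>#A. y - x))" .
      have "of_rat q = (\<Prod>y\<in>#B. of_rat (lead_coeff f) * (\<Prod>x\<in>#A. y - x))"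
        by (simp only: q[symmetric] ev_root_mset[OF less.prems(2)])
      also have "\<dots> = of_rat (lead_coeff f) ^ size B * (\<Prod>y\<in>#B. \<Prod>x\<in>#A. y - x)"
        by (simp add: prod_mset.distrib)
      finally have "(\<Prod>y\<in>#B. \<Prod>x\<in>#A. y - x) = of_rat (q / lead_coeff f ^ size B)"
        using less.prems(1) by (simp add: of_rat_divide of_rat_power field_simps)
      then have "(\<Prod>x\<in>#A. ev g x) = of_rat (lead_coeff h ^ size A * (((-1) ^ size B) ^ size A * (q / lead_coeff f ^ size B)))"
        unfolding gh 1 by (simp add: of_rat_mult of_rat_power of_rat_minus of_rat_divide)
      then show ?thesis by blast
    qed
  qed
qed

lemma ex_least_vanishing:
  fixes x :: "'a::field_char_0"
  assumes "h0 \<noteq> 0" "ev h0 x = 0"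
  shows "\<exists>f\<noteq>0. \<forall>h. ev h x = 0 \<longleftrightarrow> f dvd h"
proof -
  obtain f where f: "f \<noteq> 0" "ev f x = 0" and min: "\<And>h. h \<noteq> 0 \<Longrightarrow> ev h x = 0 \<Longrightarrow> degree f \<le> degree h"
    using ex_has_least_nat[of "\<lambda>h. h \<noteq> 0 \<and> ev h x = 0" h0 degree] assms by auto
  have "f dvd h" if h: "ev h x = 0" for h
  proof (rule ccontr)
    assume "\<not> f dvd h"
    then have nz: "h mod f \<noteq> 0" by (simp add: mod_eq_0_iff_dvd)
    have "ev h x = ev (h div f * f + h mod f) x" by (simp only: div_mult_mod_eq)
    also have "\<dots> = ev (h mod f) x" using f by (simp only: ev_add ev_mult) simp
    finally have "ev (h mod f) x = 0" using h by simp
    then have "degree f \<le> degree (h mod f)" using min nz by blast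
    then show False using degree_mod_less[OF f(1), of h] nz by auto
  qed
  then show ?thesis using f ev_dvd by blast
qed

text \<open>An algebraic element and any root of its minimal polynomial satisfy the same rational equations.\<close>

lemma minimal_polynomial_transfer:
  fixes x :: "'a::field_char_0"
  assumes "h0 \<noteq> 0" "ev h0 x = 0"
  shows "\<exists>f. f \<noteq> 0 \<and> degree f > 0 \<and> ev f x = 0 \<and>
           (\<forall>y :: 'b::field_char_0. ev f y = 0 \<longrightarrow> (\<forall>h. ev h y = 0 \<longleftrightarrow> ev h x = 0))"
proof -
  obtain f where f: "f \<noteq> 0" "\<And>h. ev h x = 0 \<longleftrightarrow> f dvd h" using ex_least_vanishing[OF assms] by blast
  have fx: "ev f x = 0" using f(2) by simp
  have nonconst: "degree g > 0" if "g \<noteq> 0" "ev g z = 0" for g and z :: "'c::field_char_0"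
  proof (rule ccontr)
    assume "\<not> degree g > 0"
    then obtain c where "g = [:c:]" by (metis degree_eq_zeroE gr0I)
    then show False using that by simp
  qed
  have "ev h y = 0 \<longleftrightarrow> ev h x = 0" if fy: "ev f y = 0" for y :: 'b and h
  proof
    assume "ev h x = 0"
    then show "ev h y = 0" using f(2) fy ev_dvd by blast
  next
    assume hy: "ev h y = 0"
    obtain g where g: "g \<noteq> 0" "\<And>h. ev h y = 0 \<longleftrightarrow> g dvd h"
      using ex_least_vanishing[OF f(1) fy] by blast
    obtain e where e: "f = g * e" using g(2) fy by (auto elim: dvdE)
    have "ev g x = 0"
    proof (rule ccontr)
      assume "ev g x \<noteq> 0"
      then have "ev e x = 0" using fx e by simp
      then have "f dvd e" using f(2) by blast
      moreover have e0: "e \<noteq> 0" using e f(1) by auto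
      ultimately have "degree f \<le> degree e" by (intro dvd_imp_degree_le)
      then have "degree g = 0" using e g(1) e0 by (simp add: degree_mult_eq)
      moreover have "degree g > 0" using nonconst[of g y] g by simp
      ultimately show False by simp
    qed
    then have "f dvd g" using f(2) by blast
    moreover have "g dvd h" using g(2) hy by blast
    ultimately show "ev h x = 0" using f(2) dvd_trans by blast
  qed
  then show ?thesis using f fx nonconst[OF f(1) fx] by blast
qed

text \<open>If \<open>t\<close> is algebraic, \<open>A\<close> consists of its conjugates. If \<open>t\<close> is transcendental, every polynomial
relation at \<open>t\<close> is trivial and \<open>A = {2}\<close> will do; there only polynomials with nonnegative coefficients are
guaranteed to keep a nonzero value, which suffices for sums of powers.\<close>

lemma specialization:
  fixes t :: "'a::field_char_0"
  assumes t: "t \<noteq> 0" "\<And>m. m > 0 \<Longrightarrow> t ^ m \<noteq> 1"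
  shows "\<exists>f A. f \<noteq> 0 \<and> root_mset f A \<and> A \<noteq> {#} \<and>
    (\<forall>h. ev h t = 0 \<longrightarrow> (\<forall>x\<in>#A. ev h x = 0)) \<and>
    (\<forall>h. (\<forall>i. coeff h i \<ge> 0) \<longrightarrow> ev h t \<noteq> 0 \<longrightarrow> (\<forall>x\<in>#A. ev h x \<noteq> 0)) \<and>
    (\<forall>x\<in>#A. \<forall>m>0. x ^ m \<noteq> 1)"
proof (cases "\<exists>h0. h0 \<noteq> 0 \<and> ev h0 t = 0")
  case True
  then obtain f where f: "f \<noteq> 0" "degree f > 0" "\<And>y :: complex. \<And>h. ev f y = 0 \<Longrightarrow> (ev h y = 0 \<longleftrightarrow> ev h t = 0)"
    using minimal_polynomial_transfer[of _ t] by metis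
  obtain A where A: "root_mset f A" "size A = degree f" using ex_root_mset[OF f(1)] by blast
  have iff: "ev h x = 0 \<longleftrightarrow> ev h t = 0" if "x \<in># A" for x h
    using f(3) root_mset_root[OF A(1) that] by blast
  have "x ^ m \<noteq> 1" if "x \<in># A" "m > 0" for x m
    using iff[OF that(1), of "monom 1 m - 1"] t(2)[OF that(2)] by simp
  moreover have "A \<noteq> {#}" using A(2) f(2) by auto
  ultimately show ?thesis using f(1) A(1) iff by (intro exI[of _ f] exI[of _ A]) auto
next
  case False
  have pos: "ev h (2 :: complex) \<noteq> 0" if h: "\<forall>i. coeff h i \<ge> 0" "h \<noteq> 0" for h
  proof
    assume "ev h (2 :: complex) = 0"
    then have "of_rat (poly h 2) = (0 :: complex)"
      by (simp add: ev_def poly_altdef coeff_map_poly of_rat_sum of_rat_mult of_rat_power degree_map_poly)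
    then have "poly h 2 = 0" by simp
    moreover have "poly h 2 > 0" unfolding poly_altdef
    proof (rule sum_pos2[of _ "degree h"])
      show "0 < coeff h (degree h) * 2 ^ degree h"
        using h by (metis leading_coeff_0_iff less_eq_rat_def mult_pos_pos zero_less_numeral zero_less_power)
    qed (use h in auto)
    ultimately show False by simp
  qed
  have "(2 :: complex) ^ m \<noteq> 1" if "m > 0" for m
  proof
    assume "(2 :: complex) ^ m = 1"
    then have "norm ((2 :: complex) ^ m) = 1" by simp
    then have "(2 :: real) ^ m = 1" unfolding norm_power by simp
    then show False using one_less_power[of "2 :: real" m] that by simp
  qed
  moreover have "h = 0" if "ev h t = 0" for h using False that by blast
  moreover have "h \<noteq> 0" if "ev h t \<noteq> 0" for h using that by auto
  moreover have "root_mset [:- 2, 1:] {#2#}"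
    by (simp add: root_mset_def map_poly_pCons of_rat_minus)
  ultimately show ?thesis
    using pos by (intro exI[of _ "[:- 2, 1:]"] exI[of _ "{#2#}"]) fastforce
qed

section \<open>Exponential sums\<close>

text \<open>An exponential sum satisfies a linear recurrence, whose characteristic polynomial is \<open>P\<close>. If the sum equals
\<open>D * \<rho> ^ j / (s + \<nu> * x ^ j)\<close>, the recurrence becomes a relation between the rational functions
\<open>1 / (s + \<nu> * x ^ i * y)\<close> of \<open>y\<close>, valid at the infinitely many points \<open>y = x ^ j\<close>. Their poles are different,
hence all coefficients of \<open>P\<close> vanish.\<close>

lemma exp_sum_not_geometric:
  fixes x s \<nu> D \<rho> :: "'a::field_char_0"
  assumes x: "x \<noteq> 0" "\<And>m. m > 0 \<Longrightarrow> x ^ m \<noteq> 1" and nz: "s \<noteq> 0" "\<nu> \<noteq> 0" "D \<noteq> 0" "\<rho> \<noteq> 0"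
    and eq: "\<And>j. j \<ge> 1 \<Longrightarrow> (s + \<nu> * x ^ j) * (\<Sum>(c, \<mu>)\<leftarrow>xs. c * \<mu> ^ j) = D * \<rho> ^ j"
  shows False
proof -
  define G where "G = (\<lambda>j. \<Sum>(c, \<mu>)\<leftarrow>xs. c * \<mu> ^ j)"
  define P where "P = (\<Prod>(c, \<mu>)\<leftarrow>xs. [:- \<mu>, 1:])"
  define d where "d = degree P"
  have xdist: "x ^ i \<noteq> x ^ j" if "i \<noteq> j" for i j
  proof -
    have *: "x ^ i \<noteq> x ^ j" if ij: "i < j" for i j
    proof
      assume e: "x ^ i = x ^ j"
      have "x ^ j = x ^ i * x ^ (j - i)" using ij by (simp add: power_add[symmetric])
      then have "x ^ (j - i) = 1" using e x(1) by simp
      then show False using x(2)[of "j - i"] ij by simp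
    qed
    show ?thesis using *[of i j] *[of j i] that by (metis linorder_neqE_nat)
  qed
  have P0: "P \<noteq> 0" unfolding P_def by (auto simp: prod_list_zero_iff)
  have root: "poly P \<mu> = 0" if "(c, \<mu>) \<in> set xs" for c \<mu>
    using that unfolding P_def by (induction xs) auto
  have rec: "(\<Sum>i\<le>d. coeff P i * G (j + i)) = 0" for j
  proof -
    have "(\<Sum>i\<le>d. coeff P i * (\<Sum>(c, \<mu>)\<leftarrow>ys. c * \<mu> ^ (j + i))) = (\<Sum>(c, \<mu>)\<leftarrow>ys. c * \<mu> ^ j * poly P \<mu>)" for ys
      by (induction ys) (auto simp: poly_altdef d_def sum.distrib sum_distrib_left power_add algebra_simps)
    also have "(\<Sum>(c, \<mu>)\<leftarrow>xs. c * \<mu> ^ j * poly P \<mu>) = (\<Sum>(c, \<mu>)\<leftarrow>xs. 0)"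
      by (intro arg_cong[of _ _ sum_list] map_cong) (auto simp: root)
    also have "\<dots> = 0" by (induction xs) auto
    finally show ?thesis by (simp add: G_def)
  qed
  have denom: "s + \<nu> * x ^ j \<noteq> 0" if "j \<ge> 1" for j
    using eq[OF that] nz by auto
  have G: "G j = D * \<rho> ^ j / (s + \<nu> * x ^ j)" if "j \<ge> 1" for j
    using eq[OF that] denom[OF that] by (simp add: G_def field_simps)
  define N where "N = (\<Sum>i\<le>d. smult (coeff P i * \<rho> ^ i) (\<Prod>l\<in>{..d} - {i}. [:s, \<nu> * x ^ l:]))"
  have N0: "poly N (x ^ j) = 0" if j: "j \<ge> 1" for j
  proof -
    define Q where "Q = (\<Prod>l\<le>d. s + \<nu> * x ^ (j + l))"
    have "(\<Prod>l\<in>{..d} - {i}. s + \<nu> * x ^ (j + l)) = Q / (s + \<nu> * x ^ (j + i))" if "i \<le> d" for i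
      unfolding Q_def using that denom[of "j + i"] j by (subst prod.remove[of _ i]) auto
    then have "poly N (x ^ j) = (\<Sum>i\<le>d. coeff P i * \<rho> ^ i * (Q / (s + \<nu> * x ^ (j + i))))"
      by (simp add: N_def poly_sum poly_prod power_add algebra_simps)
    also have "\<dots> = (\<Sum>i\<le>d. (Q / (D * \<rho> ^ j)) * (coeff P i * G (j + i)))"
      using nz j by (intro sum.cong refl) (simp add: G power_add)
    also have "\<dots> = 0" by (simp only: sum_distrib_left[symmetric] rec) simp
    finally show ?thesis .
  qed
  have "N = 0"
  proof (rule ccontr)
    assume "N \<noteq> 0"
    then have "finite {y. poly N y = 0}" by (rule poly_roots_finite)
    then have "finite ((\<lambda>j. x ^ j) ` {1..})" by (rule finite_subset[rotated]) (use N0 in auto)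
    moreover have "inj_on (\<lambda>j. x ^ j) {1..}" using xdist by (auto simp: inj_on_def)
    ultimately have "finite {1::nat..}" by (rule finite_imageD)
    then show False by (simp add: infinite_Ici)
  qed
  have "coeff P i = 0" if i: "i \<le> d" for i
  proof -
    define y where "y = - s / (\<nu> * x ^ i)"
    have "0 = (\<Sum>k\<le>d. coeff P k * \<rho> ^ k * (\<Prod>l\<in>{..d} - {k}. s + y * (\<nu> * x ^ l)))"
      using arg_cong[OF \<open>N = 0\<close>, of "\<lambda>N. poly N y"] by (simp add: N_def poly_sum poly_prod)
    also have "\<dots> = (\<Sum>k\<in>{i}. coeff P k * \<rho> ^ k * (\<Prod>l\<in>{..d} - {k}. s + y * (\<nu> * x ^ l)))"
    proof (rule sum.mono_neutral_right)
      show "\<forall>k\<in>{..d} - {i}. coeff P k * \<rho> ^ k * (\<Prod>l\<in>{..d} - {k}. s + y * (\<nu> * x ^ l)) = 0"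
      proof
        fix k assume "k \<in> {..d} - {i}"
        then have "i \<in> {..d} - {k}" using i by auto
        moreover have "s + y * (\<nu> * x ^ i) = 0" using nz x by (simp add: y_def)
        ultimately have "(\<Prod>l\<in>{..d} - {k}. s + y * (\<nu> * x ^ l)) = 0" by (intro prod_zero) auto
        then show "coeff P k * \<rho> ^ k * (\<Prod>l\<in>{..d} - {k}. s + y * (\<nu> * x ^ l)) = 0" by simp
      qed
    qed (use i in auto)
    finally have "coeff P i * \<rho> ^ i * (\<Prod>l\<in>{..d} - {i}. s + y * (\<nu> * x ^ l)) = 0" by simp
    moreover have "s + y * (\<nu> * x ^ l) \<noteq> 0" if "l \<noteq> i" for l
      using xdist[OF that] nz x by (simp add: y_def field_simps)
    then have "(\<Prod>l\<in>{..d} - {i}. s + y * (\<nu> * x ^ l)) \<noteq> 0" by auto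
    ultimately show ?thesis using nz by simp
  qed
  then have "lead_coeff P = 0" by (simp add: d_def)
  then show False using P0 by simp
qed

lemma prod_mset_exp_sum:
  fixes s \<nu> x :: "'b \<Rightarrow> 'a::field"
  shows "\<exists>xs. \<forall>j. (\<Prod>a\<in>#A. s a + \<nu> a * x a ^ j) = (\<Sum>(c, \<mu>)\<leftarrow>xs. c * \<mu> ^ j)"
proof (induction A)
  case empty
  show ?case by (intro exI[of _ "[(1, 1)]"]) simp
next
  case (add a A)
  then obtain xs where xs: "\<And>j. (\<Prod>a\<in>#A. s a + \<nu> a * x a ^ j) = (\<Sum>(c, \<mu>)\<leftarrow>xs. c * \<mu> ^ j)" by blast
  have "(s a + \<nu> a * x a ^ j) * (\<Sum>(c, \<mu>)\<leftarrow>ys. c * \<mu> ^ j) =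
    (\<Sum>(c, \<mu>)\<leftarrow>map (\<lambda>(c, \<mu>). (s a * c, \<mu>)) ys @ map (\<lambda>(c, \<mu>). (\<nu> a * c, x a * \<mu>)) ys. c * \<mu> ^ j)" for j ys
    by (induction ys) (auto simp: algebra_simps power_mult_distrib)
  then show ?case using xs by (intro exI[of _ "map (\<lambda>(c, \<mu>). (s a * c, \<mu>)) xs @ map (\<lambda>(c, \<mu>). (\<nu> a * c, x a * \<mu>)) xs"]) auto
qed

section \<open>Multiplicative dependence and primes of rational numbers\<close>

text \<open>By induction on the number of coordinates: one member of the sequence eliminates the last one.\<close>

lemma ex_finite_spanning:
  fixes E :: "nat \<Rightarrow> nat \<Rightarrow> 'a::field"
  assumes "\<And>k j. j \<ge> N \<Longrightarrow> E k j = 0"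
  shows "\<exists>K. \<forall>k. \<exists>q. \<forall>j. E k j = (\<Sum>i<K. q i * E i j)"
  using assms
proof (induction N arbitrary: E)
  case 0
  then show ?case by (intro exI[of _ 0]) auto
next
  case (Suc N)
  show ?case
  proof (cases "\<forall>k. E k N = 0")
    case True
    have "E k j = 0" if "j \<ge> N" for k j using Suc.prems[of j k] True that by (cases "j = N") auto
    then show ?thesis by (rule Suc.IH)
  next
    case False
    then obtain k0 where k0: "E k0 N \<noteq> 0" by blast
    define c where "c = (\<lambda>k. E k N / E k0 N)"
    define E' where "E' = (\<lambda>k j. E k j - c k * E k0 j)"
    have "E' k j = 0" if "j \<ge> N" for k j
      using Suc.prems[of j] k0 that by (cases "j = N") (auto simp: E'_def c_def)
    then obtain K' where K': "\<forall>k. \<exists>q. \<forall>j. E' k j = (\<Sum>i<K'. q i * E' i j)" using Suc.IH[of E'] by blast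
    have "\<exists>q. \<forall>j. E k j = (\<Sum>i<max K' (Suc k0). q i * E i j)" for k
    proof -
      obtain q where q: "\<And>j. E' k j = (\<Sum>i<K'. q i * E' i j)" using K' by blast
      define a where "a = c k - (\<Sum>i<K'. q i * c i)"
      define q' where "q' = (\<lambda>i. (if i < K' then q i else 0) + (if i = k0 then a else 0))"
      have "E k j = (\<Sum>i<max K' (Suc k0). q' i * E i j)" for j
      proof -
        have "(\<Sum>i<max K' (Suc k0). q' i * E i j) =
            (\<Sum>i<max K' (Suc k0). if i < K' then q i * E i j else 0) + (\<Sum>i<max K' (Suc k0). if i = k0 then a * E i j else 0)"
          unfolding sum.distrib[symmetric] by (intro sum.cong) (auto simp: q'_def algebra_simps)
        also have "(\<Sum>i<max K' (Suc k0). if i < K' then q i * E i j else 0) = (\<Sum>i<K'. q i * E i j)"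
          by (intro sum.mono_neutral_cong_right) auto
        also have "(\<Sum>i<max K' (Suc k0). if i = k0 then a * E i j else 0) = a * E k0 j" by simp
        also have "(\<Sum>i<K'. q i * E i j) = E' k j + (\<Sum>i<K'. q i * c i) * E k0 j"
          unfolding q by (simp add: E'_def sum_subtractf algebra_simps sum_distrib_left sum_distrib_right)
        finally show ?thesis by (simp add: a_def E'_def algebra_simps)
      qed
      then show ?thesis by blast
    qed
    then show ?thesis by blast
  qed
qed

lemma prod_powi: "(\<Prod>i\<in>I. f i) powi n = (\<Prod>i\<in>I. f i powi n)" for f :: "'b \<Rightarrow> 'a::field"
  by (induction I rule: infinite_finite_induct) (auto simp: power_int_mult_distrib)

lemma powi_sum: "x \<noteq> 0 \<Longrightarrow> x powi (\<Sum>i\<in>I. f i) = (\<Prod>i\<in>I. x powi f i)" for x :: "'a::field"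
  by (induction I rule: infinite_finite_induct) (auto simp: power_int_add)

lemma ex_common_denominator:
  fixes q :: "nat \<Rightarrow> rat"
  shows "\<exists>D::int. D > 0 \<and> (\<forall>i<K. \<exists>w. of_int w = of_int D * q i)"
proof (induction K)
  case 0
  show ?case by (intro exI[of _ 1]) auto
next
  case (Suc K)
  then obtain D where D: "D > 0" "\<And>i. i < K \<Longrightarrow> \<exists>w. of_int w = of_int D * q i" by blast
  obtain a b where ab: "b > 0" "q K = of_int a / of_int b"
    by (cases "q K") (auto simp: Fract_of_int_quotient)
  have "\<exists>w. of_int w = of_int (D * b) * q i" if "i < Suc K" for i
  proof (cases "i = K")
    case True
    then show ?thesis using ab by (intro exI[of _ "D * a"]) (simp add: field_simps)
  next
    case False
    then have "i < K" using that by simp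
    then obtain w where "of_int w = of_int D * q i" using D by blast
    then show ?thesis by (intro exI[of _ "w * b"]) (simp add: algebra_simps)
  qed
  then show ?case using D(1) ab(1) by (intro exI[of _ "D * b"]) auto
qed

text \<open>In a group of finite rank, some power of each member of a sequence is a product of powers of finitely many
members: this is \<open>ex_finite_spanning\<close> for the exponent vectors \<open>e / z\<close>, with denominators cleared.\<close>

lemma ex_finite_dependence:
  fixes y :: "nat \<Rightarrow> 'a::field" and u :: "nat \<Rightarrow> 'a"
  assumes y: "\<And>k. y k \<noteq> 0" and u: "\<And>j. j < r \<Longrightarrow> u j \<noteq> 0"
    and rel: "\<And>k. \<exists>z e. z > 0 \<and> y k powi z = (\<Prod>j<r. u j powi e j)"
  shows "\<exists>K. \<forall>k. \<exists>Z n. Z > 0 \<and> y k powi Z = (\<Prod>i<K. y i powi n i)"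
proof -
  obtain z e where ze: "\<And>k. z k > 0" "\<And>k. y k powi z k = (\<Prod>j<r. u j powi e k j)"
    using rel by metis
  define E :: "nat \<Rightarrow> nat \<Rightarrow> rat" where "E = (\<lambda>k j. if j < r then of_int (e k j) / of_int (z k) else 0)"
  obtain K where K: "\<forall>k. \<exists>q. \<forall>j. E k j = (\<Sum>i<K. q i * E i j)"
    using ex_finite_spanning[of r E] by (auto simp: E_def)
  have "\<exists>Z n. Z > 0 \<and> y k powi Z = (\<Prod>i<K. y i powi n i)" for k
  proof -
    obtain q where q: "\<And>j. E k j = (\<Sum>i<K. q i * E i j)" using K by blast
    obtain D where D: "D > 0" "\<And>i. i < K \<Longrightarrow> \<exists>w. of_int w = of_int D * q i"
      using ex_common_denominator by blast
    then obtain w where w: "\<And>i. i < K \<Longrightarrow> of_int (w i) = of_int D * q i" by metis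
    define M where "M = (\<Prod>i<K. z i)"
    have M0: "M > 0" unfolding M_def using ze(1) by (intro prod_pos) auto
    have "\<exists>m. M = z i * m" if "i < K" for i
    proof -
      have "z i dvd M" unfolding M_def using that by (intro dvd_prodI) auto
      then show ?thesis by (rule dvdE) blast
    qed
    then obtain m where m: "\<And>i. i < K \<Longrightarrow> M = z i * m i" by metis
    define n where "n = (\<lambda>i. w i * z k * M)"
    have exponent: "(\<Sum>i<K. e i j * (w i * z k * m i)) = e k j * (D * M)" if j: "j < r" for j
    proof -
      have "of_int (\<Sum>i<K. e i j * (w i * z k * m i)) = (\<Sum>i<K. of_int (D * z k * M) * (q i * E i j))"
        unfolding of_int_sum
      proof (intro sum.cong refl)
        fix i assume i: "i \<in> {..<K}"
        have "of_int M = (of_int (z i) * of_int (m i) :: rat)" using m i by simp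
        moreover have "z i \<noteq> 0" using ze(1)[of i] by simp
        ultimately show "of_int (e i j * (w i * z k * m i)) = of_int (D * z k * M) * (q i * E i j)"
          using w[of i] i j by (simp add: E_def)
      qed
      also have "\<dots> = of_int (D * z k * M) * E k j" by (simp only: sum_distrib_left[symmetric] q[symmetric])
      also have "\<dots> = of_int (e k j * (D * M))" using ze(1)[of k] j by (simp add: E_def)
      finally show ?thesis by (simp only: of_int_eq_iff)
    qed
    have "y k powi (z k * (D * M)) = (\<Prod>j<r. u j powi (e k j * (D * M)))"
      by (simp only: power_int_mult ze(2) prod_powi)
    also have "\<dots> = (\<Prod>j<r. \<Prod>i<K. u j powi (e i j * (w i * z k * m i)))"
      using u by (intro prod.cong refl) (simp add: exponent[symmetric] powi_sum)
    also have "\<dots> = (\<Prod>i<K. \<Prod>j<r. u j powi (e i j * (w i * z k * m i)))"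
      by (rule prod.swap)
    also have "\<dots> = (\<Prod>i<K. y i powi (z i * (w i * z k * m i)))"
      by (simp only: power_int_mult ze(2) prod_powi)
    also have "\<dots> = (\<Prod>i<K. y i powi n i)"
      using m by (intro prod.cong refl) (simp add: n_def algebra_simps)
    finally show ?thesis using ze(1)[of k] D(1) M0 by (intro exI[of _ "z k * (D * M)"] exI[of _ n]) simp
  qed
  then show ?thesis by blast
qed

lemma powi_conv_power: "x \<noteq> 0 \<Longrightarrow> x powi n = x ^ nat n / x ^ nat (- n)" for x :: "'a::field"
  by (auto simp: power_int_def power_inverse divide_inverse)

lemma prod_powi_ev:
  fixes y :: "'a::field_char_0"
  assumes "\<And>i. i \<in> I \<Longrightarrow> ev (P i) y \<noteq> 0 \<and> ev (Q i) y \<noteq> 0"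
  shows "(\<Prod>i\<in>I. (ev (P i) y / ev (Q i) y) powi n i) =
    ev (\<Prod>i\<in>I. P i ^ nat (n i) * Q i ^ nat (- n i)) y / ev (\<Prod>i\<in>I. P i ^ nat (- n i) * Q i ^ nat (n i)) y"
  unfolding ev_prod prod_dividef[symmetric]
  using assms by (intro prod.cong refl) (auto simp: powi_conv_power field_simps)

lemma prod_ev_nonzero:
  fixes y :: "'a::field_char_0"
  assumes "finite I" "\<And>i. i \<in> I \<Longrightarrow> ev (P i) y \<noteq> 0 \<and> ev (Q i) y \<noteq> 0"
  shows "ev (\<Prod>i\<in>I. P i ^ nat (- n i) * Q i ^ nat (n i)) y \<noteq> 0"
  using assms by auto

text \<open>A multiplicative relation between values of polynomials at \<open>t\<close> is a polynomial equation for \<open>t\<close>, once the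
negative exponents are moved to the other side.\<close>

lemma transfer_dependence:
  fixes t :: "'a::field_char_0" and x :: "'b::field_char_0"
  assumes trans: "\<And>h. ev h t = 0 \<Longrightarrow> ev h x = 0"
    and nz: "ev p x \<noteq> 0" "ev q x \<noteq> 0" "\<And>i. i \<in> I \<Longrightarrow> ev (P i) x \<noteq> 0 \<and> ev (Q i) x \<noteq> 0"
    and "finite I" and Z: "Z > 0"
    and rel: "(ev p t / ev q t) powi Z = (\<Prod>i\<in>I. (ev (P i) t / ev (Q i) t) powi n i)"
  shows "(ev p x / ev q x) powi Z = (\<Prod>i\<in>I. (ev (P i) x / ev (Q i) x) powi n i)"
proof -
  have nzt: "ev p t \<noteq> 0" "ev q t \<noteq> 0" "\<And>i. i \<in> I \<Longrightarrow> ev (P i) t \<noteq> 0 \<and> ev (Q i) t \<noteq> 0"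
    using trans nz by blast+
  define num where "num = (\<Prod>i\<in>I. P i ^ nat (n i) * Q i ^ nat (- n i))"
  define den where "den = (\<Prod>i\<in>I. P i ^ nat (- n i) * Q i ^ nat (n i))"
  have t_eq: "(\<Prod>i\<in>I. (ev (P i) t / ev (Q i) t) powi n i) = ev num t / ev den t"
    unfolding num_def den_def by (rule prod_powi_ev) (rule nzt(3))
  have x_eq: "(\<Prod>i\<in>I. (ev (P i) x / ev (Q i) x) powi n i) = ev num x / ev den x"
    unfolding num_def den_def by (rule prod_powi_ev) (rule nz(3))
  have dt: "ev den t \<noteq> 0" unfolding den_def using \<open>finite I\<close> nzt(3) by (rule prod_ev_nonzero)
  have dx: "ev den x \<noteq> 0" unfolding den_def using \<open>finite I\<close> nz(3) by (rule prod_ev_nonzero)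
  have Zn: "v powi Z = v ^ nat Z" for v :: "'d::field" using Z by (simp add: power_int_def)
  have "ev p t ^ nat Z * ev den t = ev q t ^ nat Z * ev num t"
    using rel nzt dt unfolding t_eq Zn by (simp add: power_divide field_simps)
  then have "ev (p ^ nat Z * den - q ^ nat Z * num) t = 0" by simp
  then have "ev (p ^ nat Z * den - q ^ nat Z * num) x = 0" by (rule trans)
  then have "ev p x ^ nat Z * ev den x = ev q x ^ nat Z * ev num x" by simp
  then show ?thesis
    using nz dx unfolding x_eq Zn by (simp add: power_divide field_simps)
qed

lemma prod_mset_dependence:
  fixes f :: "'b \<Rightarrow> 'a::field"
  assumes "\<And>x. x \<in># A \<Longrightarrow> f x powi Z = (\<Prod>i\<in>I. h i x powi n i)"
  shows "(\<Prod>x\<in>#A. f x) powi Z = (\<Prod>i\<in>I. (\<Prod>x\<in>#A. h i x) powi n i)"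
  using assms by (induction A) (auto simp: power_int_mult_distrib prod.distrib)

context valuation_ring
begin

lemma p_bounded_ev: "p_bounded x \<Longrightarrow> p_bounded (ev h x)"
  by (induction h) (auto intro: p_bounded_add p_bounded_mult p_bounded_of_rat p_bounded_of_V closed)

lemma unit_or_dvd: "unit (of_rat r) \<or> int p dvd a * b" if "r = of_int a / of_int b"
proof (cases "int p dvd a * b")
  case False
  then have "\<not> int p dvd a" "\<not> int p dvd b" by auto
  then show ?thesis using that by (auto simp: of_rat_divide intro: unit_divide unit_of_int)
qed simp

end

text \<open>Multiply numerator and denominator by the values of \<open>h\<close> at the other roots: the denominator becomes the
norm, which is rational.\<close>

lemma p_bounded_inverse_ev:
  fixes V :: "complex set"
  assumes "valuation_ring V p" and A: "f \<noteq> 0" "root_mset f A"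
    and h: "\<And>x. x \<in># A \<Longrightarrow> ev h x \<noteq> 0" and x: "x \<in># A"
  shows "valuation_ring.p_bounded V p (inverse (ev h x))"
proof -
  interpret valuation_ring V p by fact
  obtain F :: "complex \<Rightarrow> int poly" where F: "\<And>y. y \<in># A \<Longrightarrow> F y \<noteq> 0 \<and> poly (map_poly of_int (F y)) y = 0"
    using ev_eq_0_int_poly[OF A(1)] root_mset_root[OF A(2)] by metis
  have b: "p_bounded (ev h y)" if "y \<in># A" for y
    using F[OF that] by (intro p_bounded_ev p_bounded_algebraic) auto
  obtain q where q: "(\<Prod>x\<in>#A. ev h x) = of_rat q" using prod_mset_rational[OF A] by blast
  obtain A' where A': "A = add_mset x A'" using x by (metis insert_DiffM)
  have "of_rat q \<noteq> (0 :: complex)" unfolding q[symmetric] using h by (auto simp: prod_mset_zero_iff)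
  moreover have "of_rat q = ev h x * (\<Prod>x\<in>#A'. ev h x)" using q A' by simp
  ultimately have "inverse (ev h x) = (\<Prod>x\<in>#A'. ev h x) * of_rat (inverse q)"
    by (auto simp: of_rat_inverse inverse_mult_distrib)
  then show ?thesis using b A' by (simp add: p_bounded_mult p_bounded_prod_mset p_bounded_of_rat)
qed

lemma ex_valuation_rings: "\<exists>V :: nat \<Rightarrow> complex set. \<forall>p. prime p \<longrightarrow> valuation_ring (V p) p"
  using ex_valuation_ring by metis

lemma finite_nonunit_primes:
  fixes V :: "nat \<Rightarrow> complex set"
  assumes V: "\<And>p. prime p \<Longrightarrow> valuation_ring (V p) p" and r: "r \<noteq> 0"
  shows "finite {p. prime p \<and> \<not> valuation_ring.unit (V p) (of_rat r)}"
proof -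
  obtain a b where ab: "b > 0" "r = of_int a / of_int b"
    by (cases r) (auto simp: Fract_of_int_quotient)
  then have nz: "a * b \<noteq> 0" using r by auto
  have "p dvd nat \<bar>a * b\<bar>" if "prime p" "\<not> valuation_ring.unit (V p) (of_rat r)" for p
    using valuation_ring.unit_or_dvd[OF V[OF that(1)] ab(2)] that(2)
    by (auto simp: int_dvd_int_iff[symmetric] simp del: int_dvd_int_iff)
  then have "{p. prime p \<and> \<not> valuation_ring.unit (V p) (of_rat r)} \<subseteq> {p. p dvd nat \<bar>a * b\<bar>}" by auto
  moreover have "finite {p. p dvd nat \<bar>a * b\<bar>}" using nz by (intro finite_divisors_nat) auto
  ultimately show ?thesis by (rule finite_subset)
qed

text \<open>Numerator and denominator of \<open>r\<close> have no prime divisor, so \<open>r\<close> is \<open>1\<close> or \<open>- 1\<close>.\<close>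

lemma unit_everywhere_square:
  fixes V :: "nat \<Rightarrow> complex set"
  assumes V: "\<And>p. prime p \<Longrightarrow> valuation_ring (V p) p"
    and u: "\<And>p. prime p \<Longrightarrow> valuation_ring.unit (V p) (of_rat r)"
  shows "r ^ 2 = 1"
proof -
  obtain a b where ab: "b > 0" "coprime a b" "r = Rat.Fract a b" by (cases r) auto
  have r: "r = of_int a / of_int b" using ab by (simp add: Fract_of_int_quotient)
  have key: "is_unit c" if c: "coprime c d" "\<And>p. prime p \<Longrightarrow> valuation_ring.unit (V p) (of_int c / of_int d)" for c d :: int
  proof (rule ccontr)
    assume "\<not> is_unit c"
    moreover have "c \<noteq> 0"
    proof
      assume "c = 0"
      then have "valuation_ring.unit (V 2) (0 :: complex)" using c(2)[of 2] two_is_prime_nat by simp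
      then show False using valuation_ring.unit_def[OF V[OF two_is_prime_nat]] by blast
    qed
    ultimately obtain P where P: "prime P" "P dvd c" using prime_divisor_exists by blast
    define p where "p = nat P"
    have p2: "int p = P" using prime_ge_0_int[OF P(1)] by (simp add: p_def)
    then have p1: "prime p" using P(1) by (metis prime_nat_int_transfer)
    note p = p1 p2
    interpret valuation_ring "V p" p using V p by blast
    have "\<not> P dvd d" using c(1) P by (metis coprime_common_divisor not_prime_unit)
    then have "unit (of_int d)" using unit_of_int p by simp
    then have "unit (of_int c / of_int d * of_int d)" using c(2)[OF p(1)] unit_mult by blast
    moreover have "of_int d \<noteq> (0 :: complex)" using \<open>\<not> P dvd d\<close> by auto
    ultimately have "unit (of_int c)" by simp
    then show False using small_of_int[of c] P(2) p by (simp add: small_def)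
  qed
  have "is_unit a" using key[of a b] ab(2) u by (simp add: r of_rat_divide)
  moreover have "is_unit b"
  proof (rule key[of b a])
    show "coprime b a" using ab(2) by (simp add: coprime_commute)
    fix p :: nat assume p: "prime p"
    interpret valuation_ring "V p" p using V p by blast
    show "unit (of_int b / of_int a)" using unit_inverse[OF u[OF p]] by (simp add: r of_rat_divide)
  qed
  ultimately have "\<bar>a\<bar> = 1" "\<bar>b\<bar> = 1" by auto
  then have "a ^ 2 = 1" "b ^ 2 = 1" by (metis power2_abs one_power2)+
  then show ?thesis unfolding r power_divide by (metis of_int_power of_int_1 div_by_1)
qed

section \<open>Translated powers of an element of infinite order\<close>

text \<open>The behaviour found in \<open>translated_powers_geometric\<close> persists on sparser progressions. This allows a
common \<open>m\<close> for finitely many primes and conjugates.\<close>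

lemma geometric_multiple:
  assumes "valuation_ring V p" "l > 0"
    and "\<exists>\<alpha> \<theta>. \<alpha> \<noteq> 0 \<and> \<theta> \<noteq> 0 \<and> (\<forall>j\<ge>1. valuation_ring.unit V ((s + x ^ (c + m * j)) / (\<alpha> * \<theta> ^ j)))"
  shows "\<exists>\<alpha> \<theta>. \<alpha> \<noteq> 0 \<and> \<theta> \<noteq> 0 \<and> (\<forall>j\<ge>1. valuation_ring.unit V ((s + x ^ (c + m * l * j)) / (\<alpha> * \<theta> ^ j)))"
proof -
  obtain \<alpha> \<theta> where a: "\<alpha> \<noteq> 0" "\<theta> \<noteq> 0" 
      "\<And>j. j \<ge> 1 \<Longrightarrow> valuation_ring.unit V ((s + x ^ (c + m * j)) / (\<alpha> * \<theta> ^ j))"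
    using assms(3) by blast
  have "valuation_ring.unit V ((s + x ^ (c + m * l * j)) / (\<alpha> * (\<theta> ^ l) ^ j))" if "j \<ge> 1" for j
    using a(3)[of "l * j"] assms(2) that by (simp add: power_mult mult.assoc Suc_le_eq)
  then show ?thesis using a(1,2) by (intro exI[of _ \<alpha>] exI[of _ "\<theta> ^ l"]) simp
qed

text \<open>The norms \<open>g k\<close> of \<open>S + t ^ (k1 + k)\<close> have all their primes in a finite set \<open>\<Sigma>\<close>, since they inherit the
multiplicative relations of the elements themselves. Along the progression \<open>m * j\<close> the second quotients
\<open>w (j + 1) * w 1 / (w j * w 2)\<close> of norms are units at the primes of \<open>\<Sigma>\<close> by
\<open>translated_powers_geometric\<close>, and at the other primes because each norm is. So they are \<open>1\<close> or \<open>- 1\<close>,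
and the squares of the norms form a geometric sequence, against \<open>exp_sum_not_geometric\<close>.\<close>

theorem translated_powers_not_finitely_many_classes:
  fixes t :: "'a::field_char_0" and u :: "nat \<Rightarrow> 'a" and S :: "rat poly"
  assumes rank: "\<And>j. j < r \<Longrightarrow> u j \<noteq> 0"
      "\<And>x. x \<in> \<Gamma> \<Longrightarrow> \<exists>z e. z > 0 \<and> x powi z = (\<Prod>j<r. u j powi e j)"
    and t: "t \<noteq> 0" "\<And>m. m > 0 \<Longrightarrow> t ^ m \<noteq> 1"
    and S: "\<And>i. coeff S i \<ge> 0" "ev S t \<noteq> 0" and St: "\<And>k. ev S t + t ^ (k1 + k) \<noteq> 0"
    and R: "finite R" "\<And>k. \<exists>k'\<in>R. (ev S t + t ^ (k1 + k)) / (ev S t + t ^ (k1 + k')) \<in> \<Gamma>"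
  shows False
proof -
  obtain f A where f: "f \<noteq> 0" and A: "root_mset f A" "A \<noteq> {#}"
    and trans: "\<And>h x. ev h t = 0 \<Longrightarrow> x \<in># A \<Longrightarrow> ev h x = 0"
    and trans_nz: "\<And>h x. (\<And>i. coeff h i \<ge> 0) \<Longrightarrow> ev h t \<noteq> 0 \<Longrightarrow> x \<in># A \<Longrightarrow> ev h x \<noteq> 0"
    and tors: "\<And>x m. x \<in># A \<Longrightarrow> m > 0 \<Longrightarrow> x ^ m \<noteq> 1"
    using specialization[OF t] by metis
  define P where "P = (\<lambda>k. S + monom 1 (k1 + k))"
  have P_ev: "ev (P k) x = ev S x + x ^ (k1 + k)" for k and x :: "'b::field_char_0" by (simp add: P_def)
  have P_pos: "coeff (P k) i \<ge> 0" for k i using S(1) by (simp add: P_def)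
  have Pt: "ev (P k) t \<noteq> 0" for k using St by (simp add: P_ev)
  have Px: "ev (P k) x \<noteq> 0" if "x \<in># A" for k x
    using trans_nz[OF P_pos Pt that] .
  have Sx: "ev S x \<noteq> 0" if "x \<in># A" for x using trans_nz[OF S that] .
  have x0: "x \<noteq> 0" if "x \<in># A" for x
    using trans_nz[of "monom 1 1" x] t(1) that by simp
  define g where "g = (\<lambda>k. \<Prod>x\<in>#A. ev (P k) x)"
  have g0: "g k \<noteq> 0" for k unfolding g_def using Px by (auto simp: prod_mset_zero_iff)
  have "\<exists>q. g k = of_rat q" for k unfolding g_def by (rule prod_mset_rational[OF f A(1)])
  then obtain G where G: "\<And>k. g k = of_rat (G k)" by metis
  have G0: "G k \<noteq> 0" for k using g0[of k] G[of k] by auto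
  obtain \<sigma> where \<sigma>: "\<And>k. \<sigma> k \<in> R" "\<And>k. ev (P k) t / ev (P (\<sigma> k)) t \<in> \<Gamma>"
    using R(2) unfolding P_ev by metis
  define y where "y = (\<lambda>k. ev (P k) t / ev (P (\<sigma> k)) t)"
  obtain K where K: "\<And>k. \<exists>Z n. Z > 0 \<and> y k powi Z = (\<Prod>i<K. y i powi n i)"
    using ex_finite_dependence[of y r u] rank \<sigma>(2) Pt by (auto simp: y_def)
  have dep: "\<exists>Z n. Z > 0 \<and> (g k / g (\<sigma> k)) powi Z = (\<Prod>i<K. (g i / g (\<sigma> i)) powi n i)" for k
  proof -
    obtain Z n where Z: "Z > 0" and rel: "y k powi Z = (\<Prod>i<K. y i powi n i)" using K by blast
    have "(ev (P k) x / ev (P (\<sigma> k)) x) powi Z = (\<Prod>i<K. (ev (P i) x / ev (P (\<sigma> i)) x) powi n i)"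
      if x: "x \<in># A" for x
      by (rule transfer_dependence[of t x])
         (use trans x Px[OF x] rel Z in \<open>auto simp: y_def\<close>)
    then have "(\<Prod>x\<in>#A. ev (P k) x / ev (P (\<sigma> k)) x) powi Z =
       (\<Prod>i<K. (\<Prod>x\<in>#A. ev (P i) x / ev (P (\<sigma> i)) x) powi n i)"
      by (rule prod_mset_dependence)
    moreover have "(\<Prod>x\<in>#B. ev (P i) x / ev (P j) x) = (\<Prod>x\<in>#B. ev (P i) x) / (\<Prod>x\<in>#B. ev (P j) x)"
      for i j and B :: "complex multiset" by (induction B) auto
    ultimately show ?thesis using Z by (auto simp: g_def)
  qed
  obtain V :: "nat \<Rightarrow> complex set" where V: "\<And>p. prime p \<Longrightarrow> valuation_ring (V p) p"
    using ex_valuation_rings by blast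
  define bad where "bad = (\<lambda>k. {p. prime p \<and> \<not> valuation_ring.unit (V p) (g k)})"
  define \<Sigma> where "\<Sigma> = (\<Union>k\<in>R \<union> {..<K}. bad k)"
  have fin_bad: "finite (bad k)" for k
    unfolding bad_def G by (rule finite_nonunit_primes[OF V G0])
  have fin: "finite \<Sigma>" unfolding \<Sigma>_def using R(1) fin_bad by auto
  have good: "valuation_ring.unit (V p) (g k)" if p: "prime p" "p \<notin> \<Sigma>" for p k
  proof -
    interpret valuation_ring "V p" p using V p by blast
    have uR: "unit (g i)" if "i \<in> R \<union> {..<K}" for i
      using p that unfolding \<Sigma>_def bad_def by blast
    obtain Z n where Z: "Z > 0" and rel: "(g k / g (\<sigma> k)) powi Z = (\<Prod>i<K. (g i / g (\<sigma> i)) powi n i)"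
      using dep by blast
    have "unit ((g k / g (\<sigma> k)) powi Z)"
      unfolding rel using uR \<sigma>(1) by (intro unit_prod unit_powi unit_divide) auto
    then have "unit ((g k / g (\<sigma> k)) ^ nat Z)" using Z by (simp add: power_int_def)
    then have "unit (g k / g (\<sigma> k))" by (rule unit_power_D) (use Z in simp)
    then have "unit (g k / g (\<sigma> k) * g (\<sigma> k))" using uR \<sigma>(1) by (intro unit_mult) auto
    then show ?thesis using g0[of "\<sigma> k"] by simp
  qed
  define geo where "geo = (\<lambda>p x m. \<exists>\<alpha> \<theta>. \<alpha> \<noteq> 0 \<and> \<theta> \<noteq> 0 \<and>
     (\<forall>j\<ge>1. valuation_ring.unit (V p) ((ev S x + x ^ (k1 + m * j)) / (\<alpha> * \<theta> ^ j))))"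
  \<comment> \<open>geo p x m states that the conjugates s + x ^ (k1 + m * j) have linear p-adic valuation in j.\<close>
  have "\<exists>m>0. geo p x m" if p: "p \<in> \<Sigma>" and x: "x \<in># A" for p x
  proof -
    have Vp: "valuation_ring (V p) p" using V p by (auto simp: \<Sigma>_def bad_def)
    then interpret valuation_ring "V p" p .
    obtain F :: "int poly" where F: "F \<noteq> 0" "poly (map_poly of_int F) x = 0"
      using ev_eq_0_int_poly[OF f root_mset_root[OF A(1) x]] by blast
    have "\<exists>m>0. \<exists>\<alpha> \<theta>. \<alpha> \<noteq> 0 \<and> \<theta> \<noteq> 0 \<and> (\<forall>j\<ge>1. unit ((ev S x + x ^ (k1 + m * j)) / (\<alpha> * \<theta> ^ j)))"
    proof (rule translated_powers_geometric[OF x0[OF x] F Sx[OF x]])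
      show "p_bounded (ev S x)" using F by (intro p_bounded_ev p_bounded_algebraic)
      show "p_bounded (inverse (ev S x))" using p_bounded_inverse_ev[OF Vp f A(1) Sx x] .
      show "ev S x + x ^ k1 \<noteq> 0" using Px[OF x, of 0] by (simp add: P_ev)
      show "p_bounded (inverse (ev S x + x ^ k1))"
        using p_bounded_inverse_ev[OF Vp f A(1) Px[of _ 0] x] by (simp add: P_ev)
    qed
    then show ?thesis by (simp add: geo_def)
  qed
  then obtain M where M: "\<And>p x. p \<in> \<Sigma> \<Longrightarrow> x \<in># A \<Longrightarrow> M p x > 0 \<and> geo p x (M p x)" by metis
  define m where "m = (\<Prod>p\<in>\<Sigma>. \<Prod>x\<in>set_mset A. M p x)"
  have m0: "m > 0" unfolding m_def using M by (intro prod_pos) auto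
  have geo_m: "geo p x m" if p: "p \<in> \<Sigma>" and x: "x \<in># A" for p x
  proof -
    have "M p x dvd (\<Prod>x\<in>set_mset A. M p x)" using x by (intro dvd_prodI) auto
    also have "\<dots> dvd m" unfolding m_def using p fin by (intro dvd_prodI) auto
    finally obtain l where l: "m = M p x * l" by (rule dvdE)
    then have "l > 0" using m0 by auto
    have Vp: "valuation_ring (V p) p" using V p by (auto simp: \<Sigma>_def bad_def)
    show ?thesis unfolding geo_def l
      using M[OF p x] by (intro geometric_multiple[OF Vp \<open>l > 0\<close>]) (simp add: geo_def)
  qed
  define w where "w = (\<lambda>j. g (m * j))"
  have w0: "w j \<noteq> 0" for j by (simp add: w_def g0)
  have unit_ratio: "valuation_ring.unit (V p) (w (Suc j) * w 1 / (w j * w 2))" if p: "prime p" and j: "j \<ge> 1" for p j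
  proof (cases "p \<in> \<Sigma>")
    case False
    interpret valuation_ring "V p" p using V p by blast
    show ?thesis unfolding w_def using good[OF p False] by (intro unit_divide unit_mult)
  next
    case True
    interpret valuation_ring "V p" p using V p by blast
    obtain \<alpha> \<theta> where at: "\<And>x. x \<in># A \<Longrightarrow> \<alpha> x \<noteq> 0 \<and> \<theta> x \<noteq> 0 \<and>
        (\<forall>j\<ge>1. unit ((ev S x + x ^ (k1 + m * j)) / (\<alpha> x * \<theta> x ^ j)))"
      using geo_m[OF True] unfolding geo_def by metis
    define a b where "a = (\<Prod>x\<in>#A. \<alpha> x)" and "b = (\<Prod>x\<in>#A. \<theta> x)"
    have ab: "a \<noteq> 0" "b \<noteq> 0" using at by (auto simp: a_def b_def prod_mset_zero_iff)
    have u: "unit (w i / (a * b ^ i))" if i: "i \<ge> 1" for i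
    proof -
      have "(\<Prod>x\<in>#B. h x / (\<alpha> x * \<theta> x ^ i)) = (\<Prod>x\<in>#B. h x) / ((\<Prod>x\<in>#B. \<alpha> x) * (\<Prod>x\<in>#B. \<theta> x) ^ i)"
        for h and B :: "complex multiset" by (induction B) (auto simp: power_mult_distrib)
      then have "w i / (a * b ^ i) = (\<Prod>x\<in>#A. (ev S x + x ^ (k1 + m * i)) / (\<alpha> x * \<theta> x ^ i))"
        by (simp add: w_def g_def P_ev a_def b_def)
      also have "unit \<dots>" using at i by (intro unit_prod_mset) auto
      finally show ?thesis .
    qed
    have "unit ((w (Suc j) / (a * b ^ Suc j)) * (w 1 / (a * b ^ 1)) / ((w j / (a * b ^ j)) * (w 2 / (a * b ^ 2))))"
      using j by (intro unit_divide unit_mult u) auto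
    also have "(w (Suc j) / (a * b ^ Suc j)) * (w 1 / (a * b ^ 1)) / ((w j / (a * b ^ j)) * (w 2 / (a * b ^ 2))) =
       w (Suc j) * w 1 / (w j * w 2)"
      using ab by (simp add: power2_eq_square field_simps)
    finally show ?thesis .
  qed
  have step: "w (Suc j) ^ 2 = w j ^ 2 * (w 2 / w 1) ^ 2" if j: "j \<ge> 1" for j
  proof -
    define r where "r = G (m * Suc j) * G (m * 1) / (G (m * j) * G (m * 2))"
    have r: "of_rat r = w (Suc j) * w 1 / (w j * w 2)"
      by (simp add: r_def w_def G of_rat_divide of_rat_mult)
    have "r ^ 2 = 1" by (rule unit_everywhere_square[OF V]) (use unit_ratio[OF _ j] r in auto)
    then have "of_rat (r ^ 2) = (1 :: complex)" by simp
    then have "(w (Suc j) * w 1 / (w j * w 2)) ^ 2 = 1" by (simp only: of_rat_power r)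
    then show ?thesis using w0 by (simp add: power_divide power_mult_distrib field_simps)
  qed
  define D where "D = w 1 ^ 2 / (w 2 / w 1) ^ 2"
  have geom: "w j ^ 2 = D * ((w 2 / w 1) ^ 2) ^ j" if "j \<ge> 1" for j
    using that
  proof (induction j rule: nat_induct_at_least)
    case base show ?case using w0 by (simp add: D_def)
  next
    case (Suc j) then show ?case using step[of j] by simp
  qed
  obtain x A' where xA: "A = add_mset x A'" using A(2) by (metis multiset_cases)
  then have x: "x \<in># A" by simp
  obtain xs where xs: "\<And>j. (\<Prod>a\<in>#A' + A. ev S a + a ^ k1 * (a ^ m) ^ j) = (\<Sum>(c, \<mu>)\<leftarrow>xs. c * \<mu> ^ j)"
    using prod_mset_exp_sum[of "\<lambda>a. ev S a" "\<lambda>a. a ^ k1" "\<lambda>a. a ^ m" "A' + A"] by blast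
  show False
  proof (rule exp_sum_not_geometric)
    show "x ^ m \<noteq> 0" using x0[OF x] by simp
    show "(x ^ m) ^ i \<noteq> 1" if "i > 0" for i
      using tors[OF x, of "m * i"] m0 that by (simp add: power_mult)
    show "ev S x \<noteq> 0" by (rule Sx[OF x])
    show "x ^ k1 \<noteq> 0" using x0[OF x] by simp
    show "D \<noteq> 0" "(w 2 / w 1) ^ 2 \<noteq> 0" using w0 by (simp_all add: D_def)
    fix j :: nat assume j: "j \<ge> 1"
    have wj: "w j = (\<Prod>a\<in>#A. ev S a + a ^ k1 * (a ^ m) ^ j)"
      by (simp add: w_def g_def P_ev power_add power_mult)
    have "(ev S x + x ^ k1 * (x ^ m) ^ j) * (\<Sum>(c, \<mu>)\<leftarrow>xs. c * \<mu> ^ j) = w j ^ 2"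
      unfolding xs[symmetric] wj by (simp add: xA power2_eq_square algebra_simps)
    then show "(ev S x + x ^ k1 * (x ^ m) ^ j) * (\<Sum>(c, \<mu>)\<leftarrow>xs. c * \<mu> ^ j) = D * ((w 2 / w 1) ^ 2) ^ j"
      using geom[OF j] by simp
  qed
qed

section \<open>Translated roots of unity\<close>

definition powers :: "'a::monoid_mult \<Rightarrow> 'a set" where
  "powers z = range (\<lambda>i. z ^ i)"

definition torsion :: "'a::monoid_mult \<Rightarrow> bool" where
  "torsion z \<longleftrightarrow> (\<exists>n>0. z ^ n = 1)"

definition has_order :: "'a::monoid_mult \<Rightarrow> nat \<Rightarrow> bool" where
  "has_order z n \<longleftrightarrow> n > 0 \<and> z ^ n = 1 \<and> (\<forall>m>0. m < n \<longrightarrow> z ^ m \<noteq> 1)"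

lemma torsion_has_order: "torsion z \<Longrightarrow> \<exists>n. has_order z n"
  unfolding torsion_def has_order_def
  using exists_least_iff[of "\<lambda>n. n > 0 \<and> z ^ n = 1"] by blast

lemma powers_mult: "x \<in> powers z \<Longrightarrow> y \<in> powers z \<Longrightarrow> x * y \<in> powers z"
  by (auto simp: powers_def power_add[symmetric])

lemma powers_power: "x \<in> powers z \<Longrightarrow> x ^ n \<in> powers z"
  by (auto simp: powers_def power_mult[symmetric])

lemma powers_trans: "x \<in> powers y \<Longrightarrow> y \<in> powers z \<Longrightarrow> x \<in> powers z"
  by (auto simp: powers_def power_mult[symmetric])

lemma powers_inverse:
  fixes z :: "'a::field"
  assumes "torsion z" "x \<in> powers z"
  shows "inverse x \<in> powers z"
proof -
  obtain n where n: "n > 0" "z ^ n = 1" using assms(1) by (auto simp: torsion_def)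
  obtain i where i: "x = z ^ i" using assms(2) by (auto simp: powers_def)
  have "x * z ^ (i * (n - 1)) = z ^ (i * n)"
    unfolding i power_add[symmetric] using n(1) by (cases n) auto
  also have "\<dots> = 1" using n by (simp add: power_mult mult.commute[of i])
  finally have "inverse x = z ^ (i * (n - 1))" by (rule inverse_unique)
  then show ?thesis by (auto simp: powers_def)
qed

lemma has_order_power:
  assumes "has_order z (d * e)" "d > 0"
  shows "has_order (z ^ d) e"
proof -
  have "(z ^ d) ^ m \<noteq> 1" if "m > 0" "m < e" for m
  proof -
    have "d * m > 0" "d * m < d * e" using that assms(2) by auto
    then show ?thesis using assms(1) unfolding has_order_def power_mult[symmetric] by blast
  qed
  then show ?thesis using assms by (auto simp: has_order_def power_mult[symmetric])
qed

text \<open>A polynomial of degree \<open>n\<close> has at most \<open>n\<close> roots, and the powers of \<open>z\<close> supply \<open>n\<close> of them for \<open>X ^ n - 1\<close>.\<close>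

lemma root_of_unity_in_powers:
  fixes z :: "'a::field"
  assumes z: "has_order z n" and x: "x ^ n = 1"
  shows "x \<in> powers z"
proof -
  have n: "n > 0" "z ^ n = 1" using z by (auto simp: has_order_def)
  have z0: "z \<noteq> 0" using n by (auto simp: zero_power)
  let ?P = "monom 1 n - 1 :: 'a poly"
  have P0: "?P \<noteq> 0"
  proof
    assume "?P = 0"
    then have "coeff ?P n = 0" by simp
    then show False using n by simp
  qed
  have roots: "{y. poly ?P y = 0} = {y. y ^ n = 1}" by (simp add: poly_monom)
  have "degree ?P \<le> n" by (intro degree_diff_le) (auto simp: degree_monom_le)
  then have "card {y :: 'a. y ^ n = 1} \<le> n"
    using card_poly_roots_bound[OF P0] unfolding roots by linarith
  moreover have fin: "finite {y :: 'a. y ^ n = 1}" using poly_roots_finite[OF P0] unfolding roots .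
  have inj: "inj_on (\<lambda>i. z ^ i) {..<n}"
  proof (rule linorder_inj_onI')
    fix i j assume ij: "i \<in> {..<n}" "j \<in> {..<n}" "i < j"
    show "z ^ i \<noteq> z ^ j"
    proof
      assume e: "z ^ i = z ^ j"
      have "z ^ j = z ^ i * z ^ (j - i)" using ij by (simp add: power_add[symmetric])
      then have "z ^ (j - i) = 1" using e z0 by simp
      then show False using z ij by (auto simp: has_order_def)
    qed
  qed
  then have "card ((\<lambda>i. z ^ i) ` {..<n}) = n" by (simp add: card_image)
  moreover have sub: "(\<lambda>i. z ^ i) ` {..<n} \<subseteq> {y. y ^ n = 1}"
  proof
    fix y assume "y \<in> (\<lambda>i. z ^ i) ` {..<n}"
    then obtain i where "y = z ^ i" by auto
    then have "y ^ n = (z ^ n) ^ i" by (simp only: power_mult[symmetric] mult.commute)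
    then show "y \<in> {y. y ^ n = 1}" using n by simp
  qed
  ultimately have "(\<lambda>i. z ^ i) ` {..<n} = {y. y ^ n = 1}"
    using fin by (metis card_seteq)
  then show ?thesis using x by (auto simp: powers_def)
qed

text \<open>The induction step when the orders have a common prime \<open>q\<close>. Split \<open>x\<close> into its \<open>q\<close>-part, which is a power of
\<open>y\<close> because its order divides that of \<open>y\<close>, and its part prime to \<open>q\<close>, to which the induction
hypothesis applies.\<close>

lemma two_roots_of_unity_cyclic_aux:
  fixes x y :: "'a::field"
  assumes x: "has_order x a" and y: "has_order y b" and q: "prime q" "q dvd a"
    and le: "multiplicity q a \<le> multiplicity q b"
    and IH: "\<And>x'. \<And>a'. has_order (x' :: 'a) a' \<Longrightarrow> a' < a \<Longrightarrow> \<exists>z. torsion z \<and> x' \<in> powers z \<and> y \<in> powers z"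
  shows "\<exists>z. torsion z \<and> x \<in> powers z \<and> y \<in> powers z"
proof -
  define e where "e = multiplicity q a"
  have a0: "a > 0" and b0: "b > 0" using x y by (auto simp: has_order_def)
  have e0: "e > 0" unfolding e_def using q a0 multiplicity_gt_zero_iff[of a q] prime_gt_1_nat[OF q(1)] by auto
  obtain a1 where a1: "a = q ^ e * a1" "\<not> q dvd a1"
    using multiplicity_decompose'[of a q] q(1) a0 unfolding e_def by (metis not_prime_unit not_gr_zero)
  have "q ^ e dvd b" unfolding e_def using le by (intro multiplicity_dvd')
  then obtain b1 where b1: "b = b1 * q ^ e" by (metis dvdE mult.commute)
  have qe: "q ^ e > 1" using q(1) e0 by (metis one_less_power prime_gt_1_nat)
  have a1_pos: "a1 > 0" using a1 a0 by auto
  have b1_pos: "b1 > 0" using b1 b0 by auto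
  have "has_order (x ^ (q ^ e)) a1"
    by (rule has_order_power) (use x a1(1) prime_gt_0_nat[OF q(1)] in simp_all)
  moreover have "a1 < a" using a1 a1_pos qe by auto
  ultimately obtain z where z: "torsion z" "x ^ (q ^ e) \<in> powers z" "y \<in> powers z" using IH by blast
  have "has_order (x ^ a1) (q ^ e)" using x a1 a1_pos by (intro has_order_power) (auto simp: mult.commute)
  moreover have "has_order (y ^ b1) (q ^ e)" using y b1 b1_pos by (intro has_order_power) auto
  ultimately have "x ^ a1 \<in> powers (y ^ b1)" 
    using root_of_unity_in_powers[of "y ^ b1" "q ^ e" "x ^ a1"] by (simp add: has_order_def)
  then have xa1: "x ^ a1 \<in> powers z" using powers_trans powers_power z(3) by blast
  have "coprime a1 (q ^ e)" using a1(2) q(1)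
    by (metis coprime_commute coprime_power_right_iff prime_imp_coprime)
  then obtain s r where sr: "a1 * s = q ^ e * r + 1"
    using bezout_nat[of a1 "q ^ e"] a1_pos by (metis coprime_iff_gcd_eq_1 not_gr_zero)
  have x0: "x \<noteq> 0" using x by (auto simp: has_order_def zero_power)
  have "(x ^ a1) ^ s = (x ^ (q ^ e)) ^ r * x"
    unfolding power_mult[symmetric] sr by (simp add: power_add)
  then have "x = (x ^ a1) ^ s * inverse ((x ^ (q ^ e)) ^ r)"
    using x0 by simp
  then have "x \<in> powers z"
    using powers_mult[OF powers_power[OF xa1] powers_inverse[OF z(1) powers_power[OF z(2)]]] by metis
  then show ?thesis using z by blast
qed

lemma two_roots_of_unity_cyclic:
  fixes x y :: "'a::field"
  assumes "has_order x a" "has_order y b"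
  shows "\<exists>z. torsion z \<and> x \<in> powers z \<and> y \<in> powers z"
  using assms
proof (induction "a + b" arbitrary: a b x y rule: less_induct)
  case less
  have a0: "a > 0" and b0: "b > 0" using less.prems by (auto simp: has_order_def)
  show ?case
  proof (cases "coprime a b")
    case True
    have xa: "x ^ a = 1" and yb: "y ^ b = 1" using less.prems by (auto simp: has_order_def)
    have x0: "x \<noteq> 0" and y0: "y \<noteq> 0" using xa yb a0 b0 by (auto simp: zero_power)
    define z where "z = x * y"
    have "z ^ (a * b) = (x ^ a) ^ b * (y ^ b) ^ a"
      by (simp add: z_def power_mult_distrib power_mult[symmetric] mult.commute)
    then have "z ^ (a * b) = 1" using xa yb by simp
    then have tz: "torsion z" using a0 b0 unfolding torsion_def by (intro exI[of _ "a * b"]) auto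
    obtain s r where sr: "b * s = a * r + 1"
      using bezout_nat[of b a] b0 True by (metis coprime_iff_gcd_eq_1 coprime_commute not_gr_zero)
    have "z ^ (b * s) = x ^ (b * s) * (y ^ b) ^ s" by (simp add: z_def power_mult_distrib power_mult)
    also have "\<dots> = (x ^ a) ^ r * x" by (simp add: yb sr power_add power_mult)
    finally have "x = z ^ (b * s)" using xa by simp
    then have xz: "x \<in> powers z" by (auto simp: powers_def)
    have "z \<in> powers z" unfolding powers_def by (rule image_eqI[of _ _ 1]) auto
    then have "z * inverse x \<in> powers z" by (intro powers_mult powers_inverse tz xz)
    moreover have "z * inverse x = y" using x0 by (simp add: z_def)
    ultimately have "y \<in> powers z" by simp
    with tz xz show ?thesis by blast
  next
    case False
    then obtain q where q: "prime q" "q dvd a" "q dvd b"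
      using a0 by (metis coprime_iff_gcd_eq_1 gcd_dvd1 gcd_dvd2 dvd_trans prime_factor_nat)
    show ?thesis
    proof (cases "multiplicity q a \<le> multiplicity q b")
      case True
      show ?thesis
      proof (rule two_roots_of_unity_cyclic_aux[OF less.prems q(1,2) True])
        fix x' a' assume "has_order (x' :: 'a) a'" "a' < a"
        then show "\<exists>z. torsion z \<and> x' \<in> powers z \<and> y \<in> powers z"
          using less.hyps[of a' b x' y] less.prems(2) by simp
      qed
    next
      case False
      have "\<exists>z. torsion z \<and> y \<in> powers z \<and> x \<in> powers z"
      proof (rule two_roots_of_unity_cyclic_aux[OF less.prems(2,1) q(1,3)])
        show "multiplicity q b \<le> multiplicity q a" using False by simp
        fix y' b' assume "has_order (y' :: 'a) b'" "b' < b"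
        then show "\<exists>z. torsion z \<and> y' \<in> powers z \<and> x \<in> powers z"
          using less.hyps[of b' a y' x] less.prems(1) by simp
      qed
      then show ?thesis by blast
    qed
  qed
qed

lemma finite_roots_of_unity_cyclic:
  fixes A :: "'a::field set"
  assumes "finite A" "\<And>x. x \<in> A \<Longrightarrow> torsion x"
  shows "\<exists>z. torsion z \<and> A \<subseteq> powers z"
  using assms
proof (induction A rule: finite_induct)
  case empty
  have "torsion (1 :: 'a)" unfolding torsion_def by (intro exI[of _ 1]) simp
  then show ?case by blast
next
  case (insert x A)
  then obtain y where y: "torsion y" "A \<subseteq> powers y" by blast
  obtain a b where "has_order x a" "has_order y b"
    using torsion_has_order y(1) insert.prems by blast
  then obtain z where "torsion z" "x \<in> powers z" "y \<in> powers z"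
    using two_roots_of_unity_cyclic by blast
  then show ?case using y(2) powers_trans by blast
qed

text \<open>Two circles with different centres meet in at most two points. For \<open>y\<close> on the unit circle, the distance
fixes the real part of \<open>cnj s * y\<close>, hence its imaginary part up to sign.\<close>

lemma unit_circle_equidistant:
  fixes s :: complex
  assumes s: "s \<noteq> 0" and Y: "finite Y" "\<And>y. y \<in> Y \<Longrightarrow> norm y = 1 \<and> norm (s + y) = \<rho>"
  shows "card Y \<le> 2"
proof -
  \<comment> \<open>The value of Re (cnj s * y) determined by norm (s + y) = rho and norm y = 1.\<close>
  define \<kappa> where "\<kappa> = (\<rho> ^ 2 - norm s ^ 2 - 1) / 2"
  define b where "b = sqrt (norm s ^ 2 - \<kappa> ^ 2)"
  have "cnj s * y \<in> {Complex \<kappa> b, Complex \<kappa> (- b)}" if y: "y \<in> Y" for y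
  proof -
    have "(Re s + Re y) ^ 2 + (Im s + Im y) ^ 2 = \<rho> ^ 2" "Re y ^ 2 + Im y ^ 2 = 1"
      using Y(2)[OF y] cmod_power2[of "s + y"] cmod_power2[of y] by auto
    moreover have "norm s ^ 2 = Re s ^ 2 + Im s ^ 2" by (rule cmod_power2)
    ultimately have re: "Re (cnj s * y) = \<kappa>"
      unfolding \<kappa>_def by (simp add: power2_eq_square algebra_simps)
    have "norm (cnj s * y) = norm s" using Y(2)[OF y] by (simp add: norm_mult)
    then have "\<kappa> ^ 2 + Im (cnj s * y) ^ 2 = norm s ^ 2"
      using cmod_power2[of "cnj s * y"] re by simp
    then have "b = \<bar>Im (cnj s * y)\<bar>" unfolding b_def by (simp add: algebra_simps flip: real_sqrt_abs)
    then show ?thesis using re by (auto simp: complex_eq_iff abs_if split: if_splits)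
  qed
  then have "(\<lambda>y. cnj s * y) ` Y \<subseteq> {Complex \<kappa> b, Complex \<kappa> (- b)}" by blast
  then have "card ((\<lambda>y. cnj s * y) ` Y) \<le> card {Complex \<kappa> b, Complex \<kappa> (- b)}" by (intro card_mono) auto
  also have "\<dots> \<le> 2" by (simp add: card_insert_if)
  finally show ?thesis using s by (subst (asm) card_image) (auto simp: inj_on_def)
qed

text \<open>Three elements \<open>S + v\<close> in one class have equal \<open>L\<close>-th powers for some \<open>L\<close>. With \<open>\<zeta>\<close> a root of unity generating
all elements involved, this is a polynomial equation for \<open>\<zeta>\<close>. It holds also for a complex root
\<open>w\<close> of the minimal polynomial of \<open>\<zeta>\<close>, where it gives equal absolute values.\<close>

theorem translated_roots_of_unity_not_finitely_many_classes:
  fixes \<Gamma> D V :: "'a::field_char_0 set"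
  assumes tors: "\<And>x. x \<in> \<Gamma> \<Longrightarrow> torsion x" and D: "infinite D" "D \<subseteq> \<Gamma>"
    and V: "finite V" "V \<subseteq> \<Gamma>" "\<Sum>V \<noteq> 0"
    and R: "finite R" "R \<subseteq> \<Gamma>" "\<And>v. v \<in> D \<Longrightarrow> \<exists>v'\<in>R. \<exists>u\<in>\<Gamma>. \<Sum>V + v = u * (\<Sum>V + v')"
  shows False
proof -
  have "D = (\<Union>v'\<in>R. {v \<in> D. \<exists>u\<in>\<Gamma>. \<Sum>V + v = u * (\<Sum>V + v')})" using R(3) by blast
  then obtain v' where v': "v' \<in> R" "infinite {v \<in> D. \<exists>u\<in>\<Gamma>. \<Sum>V + v = u * (\<Sum>V + v')}"
    using D(1) R(1) by (metis (no_types, lifting) finite_UN_I)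
  obtain T where T: "T \<subseteq> {v \<in> D. \<exists>u\<in>\<Gamma>. \<Sum>V + v = u * (\<Sum>V + v')}" "finite T" "card T = 3"
    using infinite_arbitrarily_large[OF v'(2)] by blast
  have "\<exists>u l. \<Sum>V + v = u * (\<Sum>V + v') \<and> l > 0 \<and> u ^ l = 1" if "v \<in> T" for v
    using T(1) tors that unfolding torsion_def by blast
  then obtain u l where ul: "\<And>v. v \<in> T \<Longrightarrow> \<Sum>V + v = u v * (\<Sum>V + v') \<and> l v > 0 \<and> u v ^ l v = 1"
    by metis
  define L where "L = (\<Prod>v\<in>T. l v)"
  have L0: "L > 0" unfolding L_def using ul by (intro prod_pos) auto
  have powL: "(\<Sum>V + v) ^ L = (\<Sum>V + v') ^ L" if v: "v \<in> T" for v
  proof -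
    have "l v dvd L" unfolding L_def using v T(2) by (intro dvd_prodI) auto
    then have "u v ^ L = 1" using ul[OF v] by (auto elim!: dvdE simp: power_mult)
    then show ?thesis using ul[OF v] by (metis power_mult_distrib mult_1)
  qed
  have "finite (V \<union> T \<union> {v'})" using V T by simp
  moreover have "torsion x" if "x \<in> V \<union> T \<union> {v'}" for x using tors V(2) T(1) D(2) v'(1) R(2) that by blast
  ultimately obtain \<zeta> where z: "torsion \<zeta>" "V \<union> T \<union> {v'} \<subseteq> powers \<zeta>"
    using finite_roots_of_unity_cyclic by meson
  have "\<forall>v\<in>V \<union> T \<union> {v'}. \<exists>i. \<zeta> ^ i = v" using z(2) by (auto simp: powers_def)
  then obtain a where a: "\<And>v. v \<in> V \<union> T \<union> {v'} \<Longrightarrow> \<zeta> ^ a v = v" by metis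
  obtain N where N: "N > 0" "\<zeta> ^ N = 1" using z(1) by (auto simp: torsion_def)
  define h0 :: "rat poly" where "h0 = monom 1 N - 1"
  have "h0 \<noteq> 0"
  proof
    assume "h0 = 0"
    then have "coeff h0 N = 0" by simp
    then show False using N by (simp add: h0_def)
  qed
  moreover have "ev h0 \<zeta> = 0" using N by (simp add: h0_def)
  ultimately obtain f where f: "f \<noteq> 0" "degree f > 0"
      "\<And>y :: complex. \<And>h. ev f y = 0 \<Longrightarrow> (ev h y = 0 \<longleftrightarrow> ev h \<zeta> = 0)"
    using minimal_polynomial_transfer[of h0 \<zeta>] by metis
  obtain A where A: "root_mset f A" "size A = degree f" using ex_root_mset[OF f(1)] by blast
  obtain w where "w \<in># A" using A(2) f(2) by (metis multiset_nonemptyE size_empty less_numeral_extra(3))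
  then have iff: "ev h w = 0 \<longleftrightarrow> ev h \<zeta> = 0" for h using f(3) root_mset_root[OF A(1)] by blast
  have "w ^ N = 1" using iff[of h0] N by (simp add: h0_def)
  then have "norm w ^ N = 1 ^ N" by (simp add: norm_power[symmetric])
  then have w1: "norm w = 1" by (rule power_eq_imp_eq_base) (use N(1) in auto)
  define s where "s = (\<Sum>v\<in>V. w ^ a v)"
  have sumV: "(\<Sum>v\<in>V. \<zeta> ^ a v) = \<Sum>V" by (rule sum.cong) (simp_all add: a)
  have s0: "s \<noteq> 0" using iff[of "\<Sum>v\<in>V. monom 1 (a v)"] V(3) sumV by (simp add: s_def)
  have transL: "(s + w ^ a v) ^ L = (s + w ^ a v') ^ L" if v: "v \<in> T" for v
  proof -
    define h where "h = ((\<Sum>v\<in>V. monom 1 (a v)) + monom 1 (a v)) ^ L - ((\<Sum>v\<in>V. monom 1 (a v)) + monom (1::rat) (a v')) ^ L"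
    have "ev h \<zeta> = (\<Sum>V + v) ^ L - (\<Sum>V + v') ^ L" using a[of v] a[of v'] v by (simp add: h_def sumV)
    then have "ev h \<zeta> = 0" using powL[OF v] by simp
    then have "ev h w = 0" using iff by blast
    then show ?thesis by (simp add: h_def s_def)
  qed
  have "norm (s + w ^ a v) = norm (s + w ^ a v')" if v: "v \<in> T" for v
  proof (rule power_eq_imp_eq_base)
    show "norm (s + w ^ a v) ^ L = norm (s + w ^ a v') ^ L" using transL[OF v] by (metis norm_power)
  qed (use L0 in auto)
  then have "card ((\<lambda>v. w ^ a v) ` T) \<le> 2"
    using T(2) w1 by (intro unit_circle_equidistant[OF s0]) (auto simp: norm_power)
  moreover have "inj_on (\<lambda>v. w ^ a v) T"
  proof (rule inj_onI)
    fix v1 v2 assume v: "v1 \<in> T" "v2 \<in> T" "w ^ a v1 = w ^ a v2"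
    then have "ev (monom 1 (a v1) - monom 1 (a v2)) w = 0" by simp
    then have "ev (monom 1 (a v1) - monom 1 (a v2)) \<zeta> = 0" using iff by blast
    then have "\<zeta> ^ a v1 = \<zeta> ^ a v2" by simp
    then show "v1 = v2" using a[of v1] a[of v2] v by simp
  qed
  ultimately show False using T(3) by (simp add: card_image)
qed

section \<open>The groups of units\<close>

lemma mult_grp_simps [simp]:
  "carrier mult_grp = {x. x \<noteq> 0}" "x \<otimes>\<^bsub>mult_grp\<^esub> y = x * y" "\<one>\<^bsub>mult_grp\<^esub> = 1"
  by (simp_all add: mult_grp_def)

lemma mult_grp_power_simps [simp]:
  "carrier mult_grp_power = {x. \<forall>i. x $ i \<noteq> 0}" "x \<otimes>\<^bsub>mult_grp_power\<^esub> y = x * y"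
  "\<one>\<^bsub>mult_grp_power\<^esub> = 1"
  by (simp_all add: mult_grp_power_def)

lemma inv_mult_grp:
  fixes x :: "'a::field"
  assumes x: "x \<noteq> 0"
  shows "inv\<^bsub>mult_grp\<^esub> x = inverse x"
proof -
  interpret comm_group "mult_grp :: 'a monoid" by (rule comm_group_mult_grp)
  show ?thesis using x by (intro inv_equality) auto
qed

lemma inv_mult_grp_power:
  fixes x :: "'a::field ^ 'n::finite"
  assumes x: "\<And>i. x $ i \<noteq> 0"
  shows "inv\<^bsub>mult_grp_power\<^esub> x = (\<chi> i. inverse (x $ i))"
proof -
  interpret comm_group "mult_grp_power :: ('a ^ 'n) monoid" by (rule comm_group_mult_grp_power)
  show ?thesis using x by (intro inv_equality) (auto simp: vec_eq_iff)
qed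

lemma int_pow_mult_grp:
  fixes x :: "'a::field"
  assumes "x \<noteq> 0"
  shows "x [^]\<^bsub>mult_grp\<^esub> (z::int) = x powi z"
proof -
  interpret comm_group "mult_grp :: 'a monoid" by (rule comm_group_mult_grp)
  have nat: "x [^]\<^bsub>mult_grp\<^esub> (n::nat) = x ^ n" for n
    by (induction n) (auto simp: mult.commute)
  show ?thesis using assms by (simp add: int_pow_def2 nat inv_mult_grp power_int_def power_inverse)
qed

lemma int_pow_mult_grp_power:
  fixes x :: "'a::field ^ 'n::finite"
  assumes "\<And>i. x $ i \<noteq> 0"
  shows "x [^]\<^bsub>mult_grp_power\<^esub> (z::int) = (\<chi> i. x $ i powi z)"
proof -
  interpret comm_group "mult_grp_power :: ('a ^ 'n) monoid" by (rule comm_group_mult_grp_power)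
  have nat: "x [^]\<^bsub>mult_grp_power\<^esub> (n::nat) = (\<chi> i. x $ i ^ n)" for n
    by (induction n) (auto simp: mult.commute vec_eq_iff)
  show ?thesis using assms
    by (simp add: int_pow_def2 nat inv_mult_grp_power power_int_def power_inverse)
qed

lemma finprod_mult_grp:
  assumes "finite A" "\<And>a. a \<in> A \<Longrightarrow> f a \<noteq> (0 :: 'a::field)"
  shows "finprod mult_grp f A = prod f A"
proof -
  interpret comm_group "mult_grp :: 'a monoid" by (rule comm_group_mult_grp)
  show ?thesis using assms by (induction A rule: finite_induct) (auto simp: Pi_def)
qed

lemma finprod_mult_grp_power:
  fixes f :: "'b \<Rightarrow> 'a::field ^ 'n::finite"
  assumes "finite A" "\<And>a i. a \<in> A \<Longrightarrow> f a $ i \<noteq> 0"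
  shows "finprod mult_grp_power f A = (\<chi> i. \<Prod>a\<in>A. f a $ i)"
proof -
  interpret comm_group "mult_grp_power :: ('a ^ 'n) monoid" by (rule comm_group_mult_grp_power)
  show ?thesis using assms by (induction A rule: finite_induct) (auto simp: Pi_def vec_eq_iff)
qed

lemma subgroup_mult_grpD:
  assumes "subgroup G (mult_grp :: 'a::field monoid)"
  shows "x \<in> G \<Longrightarrow> x \<noteq> 0" "1 \<in> G" "x \<in> G \<Longrightarrow> y \<in> G \<Longrightarrow> x * y \<in> G" "x \<in> G \<Longrightarrow> inverse x \<in> G"
    "x \<in> G \<Longrightarrow> x ^ n \<in> G"
proof -
  interpret subgroup G mult_grp by fact
  show nz: "x \<in> G \<Longrightarrow> x \<noteq> 0" and 1: "1 \<in> G" and m: "x \<in> G \<Longrightarrow> y \<in> G \<Longrightarrow> x * y \<in> G" for x y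
    using subset one_closed m_closed by auto
  show "x \<in> G \<Longrightarrow> inverse x \<in> G" using m_inv_closed[of x] nz[of x] by (simp add: inv_mult_grp)
  show "x \<in> G \<Longrightarrow> x ^ n \<in> G" by (induction n) (auto intro: 1 m)
qed

lemma subgroup_set_power:
  assumes G: "subgroup G (mult_grp :: 'a::field monoid)"
  shows "subgroup (set_power G :: ('a ^ 'n::finite) set) mult_grp_power"
proof
  show "set_power G \<subseteq> carrier (mult_grp_power :: ('a ^ 'n) monoid)"
    using subgroup_mult_grpD(1)[OF G] by (auto simp: set_power_def)
next
  fix x :: "'a ^ 'n" assume "x \<in> set_power G"
  then show "inv\<^bsub>mult_grp_power\<^esub> x \<in> set_power G"
    using subgroup_mult_grpD[OF G] by (subst inv_mult_grp_power) (auto simp: set_power_def)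
qed (use subgroup_mult_grpD[OF G] in \<open>auto simp: set_power_def\<close>)

lemma finite_rank_mult_grpD:
  assumes G: "subgroup G (mult_grp :: 'a::field monoid)" and "finite_rank mult_grp G"
  shows "\<exists>(r::nat) u. (\<forall>j<r. u j \<in> G) \<and>
    (\<forall>x\<in>G. \<exists>z>0. \<exists>e. x powi z = (\<Prod>j<r. u j powi e j))"
proof -
  obtain r :: nat and u where u: "\<And>j. j < r \<Longrightarrow> u j \<in> G" and rel: "\<And>x. x \<in> G \<Longrightarrow> \<exists>(z::int) (e :: nat \<Rightarrow> int). z > 0 \<and>
       x [^]\<^bsub>mult_grp\<^esub> z = (\<Otimes>\<^bsub>mult_grp\<^esub>j\<in>{..<r}. u j [^]\<^bsub>mult_grp\<^esub> e j)"
    using assms(2) unfolding finite_rank_def by blast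
  have "\<exists>z>0. \<exists>e. x powi z = (\<Prod>j<r. u j powi e j)" if x: "x \<in> G" for x
  proof -
    obtain z e where ze: "z > 0" "x [^]\<^bsub>mult_grp\<^esub> (z::int) = (\<Otimes>\<^bsub>mult_grp\<^esub>j\<in>{..<r}. u j [^]\<^bsub>mult_grp\<^esub> (e j :: int))"
      using rel[OF x] by blast
    have nz: "u j \<noteq> 0" if "j < r" for j using u[OF that] subgroup_mult_grpD(1)[OF G] by blast
    have "(\<Otimes>\<^bsub>mult_grp\<^esub>j\<in>{..<r}. u j [^]\<^bsub>mult_grp\<^esub> e j) = (\<Prod>j<r. u j [^]\<^bsub>mult_grp\<^esub> e j)"
      using nz by (intro finprod_mult_grp) (auto simp: int_pow_mult_grp)
    also have "\<dots> = (\<Prod>j<r. u j powi e j)"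
      using nz by (intro prod.cong) (auto simp: int_pow_mult_grp)
    finally show ?thesis using ze subgroup_mult_grpD(1)[OF G x] by (auto simp: int_pow_mult_grp)
  qed
  then show ?thesis using u by blast
qed

text \<open>Generators: each of the \<open>r\<close> generators of \<open>G\<close> placed in each of the \<open>N\<close> coordinates. The pair of coordinate
number \<open>q\<close> and generator number \<open>k\<close> is encoded as \<open>q * r + k\<close>.\<close>

lemma finite_rank_set_power:
  assumes G: "subgroup G (mult_grp :: 'a::field monoid)" and fr: "finite_rank mult_grp G"
  shows "finite_rank mult_grp_power (set_power G :: ('a ^ 'n::finite) set)"
proof -
  obtain r :: nat and u where u: "\<And>j. j < r \<Longrightarrow> u j \<in> G"
    and rel: "\<And>x. x \<in> G \<Longrightarrow> \<exists>z>0. \<exists>e. x powi z = (\<Prod>j<r. u j powi e j)"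
    using finite_rank_mult_grpD[OF G fr] by blast
  define N where "N = CARD('n)"
  obtain h :: "nat \<Rightarrow> 'n" where h: "bij_betw h {..<N} UNIV"
    using ex_bij_betw_nat_finite[of "UNIV :: 'n set"] by (auto simp: N_def lessThan_atLeast0)
  define w :: "nat \<Rightarrow> 'a ^ 'n" where "w = (\<lambda>j. \<chi> i. if i = h (j div r) then u (j mod r) else 1)"
  have wG: "w j \<in> set_power G" if "j < N * r" for j
  proof -
    have "r > 0" using that by (cases r) auto
    then show ?thesis using u subgroup_mult_grpD(2)[OF G] by (auto simp: w_def set_power_def)
  qed
  have w0: "w j $ i \<noteq> 0" if "j < N * r" for j i
    using wG[OF that] subgroup_mult_grpD(1)[OF G] by (auto simp: set_power_def)
  have "\<exists>(z::int) (e :: nat \<Rightarrow> int). z > 0 \<and>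
       x [^]\<^bsub>mult_grp_power\<^esub> z = (\<Otimes>\<^bsub>mult_grp_power\<^esub>j\<in>{..<N * r}. w j [^]\<^bsub>mult_grp_power\<^esub> e j)"
    if x: "x \<in> set_power G" for x
  proof -
    have xi: "x $ i \<in> G" for i using x by (simp add: set_power_def)
    then have x0: "x $ i \<noteq> 0" for i using subgroup_mult_grpD(1)[OF G] by blast
    obtain z e where ze: "\<And>i. z i > 0" "\<And>i. x $ i powi z i = (\<Prod>j<r. u j powi e i j)"
      using rel[OF xi] by metis
    define Z where "Z = (\<Prod>i\<in>UNIV. z i)"
    have Z0: "Z > 0" unfolding Z_def using ze(1) by (intro prod_pos) auto
    have "\<exists>m. Z = z i * m" for i
    proof -
      have "z i dvd Z" unfolding Z_def by (intro dvd_prodI) auto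
      then show ?thesis by (rule dvdE) blast
    qed
    then obtain m where m: "\<And>i. Z = z i * m i" by metis
    define E where "E = (\<lambda>j. e (h (j div r)) (j mod r) * m (h (j div r)))"
    have "x $ i powi Z = (\<Prod>j<N * r. (w j [^]\<^bsub>mult_grp_power\<^esub> E j) $ i)" for i
    proof -
      have "i \<in> h ` {..<N}" using h by (simp add: bij_betw_def)
      then obtain q0 where q0: "q0 < N" "h q0 = i" by auto
      have hq: "i = h q \<longleftrightarrow> q = q0" if "q < N" for q
        using h q0 that by (auto simp: bij_betw_def inj_on_def)
      have "(\<Prod>j<N * r. (w j [^]\<^bsub>mult_grp_power\<^esub> E j) $ i) = (\<Prod>j<N * r. w j $ i powi E j)"
        using w0 by (intro prod.cong) (auto simp: int_pow_mult_grp_power)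
      also have "\<dots> = (\<Prod>(q, k)\<in>{..<N} \<times> {..<r}. w (q * r + k) $ i powi E (q * r + k))"
      proof (rule prod.reindex_bij_witness[of _ "\<lambda>(q, k). q * r + k" "\<lambda>j. (j div r, j mod r)"])
        fix j assume j: "j \<in> {..<N * r}"
        then have "r > 0" by (cases r) auto
        then show "(j div r, j mod r) \<in> {..<N} \<times> {..<r}" using j by (auto simp: less_mult_imp_div_less)
      next
        fix b assume "b \<in> {..<N} \<times> {..<r}"
        then obtain q k where b: "b = (q, k)" "q < N" "k < r" by auto
        have "q * r + k < Suc q * r" using b by simp
        also have "\<dots> \<le> N * r" using b by (intro mult_le_mono1) simp
        finally show "(\<lambda>(q, k). q * r + k) b \<in> {..<N * r}" using b by simp
      qed auto
      also have "\<dots> = (\<Prod>q<N. \<Prod>k<r. w (q * r + k) $ i powi E (q * r + k))"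
        by (simp add: prod.cartesian_product)
      also have "\<dots> = (\<Prod>q<N. if q = q0 then (\<Prod>k<r. u k powi (e i k * m i)) else 1)"
        using hq q0 by (intro prod.cong refl) (auto simp: w_def E_def intro!: prod.cong)
      also have "\<dots> = (\<Prod>k<r. u k powi (e i k * m i))" using q0 by simp
      also have "\<dots> = (x $ i powi z i) powi m i"
        by (simp only: ze(2) prod_powi power_int_mult)
      also have "\<dots> = x $ i powi Z" by (simp only: power_int_mult[symmetric] m[symmetric])
      finally show ?thesis ..
    qed
    moreover have "(w j [^]\<^bsub>mult_grp_power\<^esub> E j) $ i \<noteq> 0" if "j < N * r" for i j
      using w0[OF that] by (simp add: int_pow_mult_grp_power)
    ultimately have "x [^]\<^bsub>mult_grp_power\<^esub> Z = (\<Otimes>\<^bsub>mult_grp_power\<^esub>j\<in>{..<N * r}. w j [^]\<^bsub>mult_grp_power\<^esub> E j)"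
      using x0 by (subst finprod_mult_grp_power) (auto simp: int_pow_mult_grp_power vec_eq_iff)
    then show ?thesis using Z0 by blast
  qed
  then show ?thesis unfolding finite_rank_def using wG by blast
qed

section \<open>Equations with all coefficients equal\<close>

text \<open>Extend a basis of \<open>W\<close> by a vector outside \<open>W\<close>, take a linear map that vanishes on the basis but not
on the new vector, and read off a row of its matrix.\<close>

lemma proper_subspace_functional:
  fixes W :: "('a::field ^ 'n::finite) set"
  assumes "vec.subspace W" "W \<noteq> UNIV"
  shows "\<exists>c. (\<exists>i. c i \<noteq> 0) \<and> (\<forall>x\<in>W. (\<Sum>i\<in>UNIV. c i * x $ i) = 0)"
proof -
  obtain x0 where x0: "x0 \<notin> W" using assms(2) by (auto simp: set_eq_iff)
  obtain B where B: "B \<subseteq> W" "vec.independent B" "W \<subseteq> vec.span B"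
    by (rule vec.basis_exists[of W])
  have "vec.span B \<subseteq> W" using vec.span_minimal[OF B(1) assms(1)] .
  then have x0B: "x0 \<notin> vec.span B" using x0 by blast
  then have "vec.independent (insert x0 B)" using B(2) by (simp add: vec.independent_insert)
  then obtain g :: "'a ^ 'n \<Rightarrow> 'a ^ 'n" where g: "Vector_Spaces.linear (*s) (*s) g"
      "\<forall>x\<in>insert x0 B. g x = (if x = x0 then 1 else 0)"
    using vec.linear_independent_extend[of "insert x0 B" "\<lambda>x. if x = x0 then 1 else 0"] by blast
  have gB: "g x = 0" if x: "x \<in> B" for x
  proof -
    have "x \<noteq> x0" using vec.span_base[OF x] x0B by auto
    then show ?thesis using g(2) x by simp
  qed
  have gW: "g x = 0" if "x \<in> W" for x
    using vec.linear_eq_0_on_span[OF g(1) gB] B(3) that by blast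
  define c where "c = (\<lambda>j. matrix g $ undefined $ j)"
  have c: "(\<Sum>j\<in>UNIV. c j * x $ j) = g x $ undefined" for x
    using matrix_works[OF g(1), of x] unfolding c_def matrix_vector_mult_def
    by (simp add: vec_eq_iff)
  have "(\<Sum>j\<in>UNIV. c j * x0 $ j) = 1" unfolding c using g(2) by simp
  then have "\<exists>i. c i \<noteq> 0" by (rule contrapos_pp) simp
  then show ?thesis using c gW by auto
qed

lemma generic_not_coverable:
  fixes V :: "'a::field set"
  assumes gen: "generic TYPE('n::finite) V" and V: "card V = CARD('n)" "V \<subseteq> G"
  shows "\<not> coverable_by_fewer CARD('n)
    (nondegenerate_solutions (set_power G) ((\<chi> i. inverse (\<Sum>V)) :: 'a ^ 'n))"
proof
  let ?S = "nondegenerate_solutions (set_power G) ((\<chi> i. inverse (\<Sum>V)) :: 'a ^ 'n)"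
  assume "coverable_by_fewer CARD('n) ?S"
  then have "\<exists>F. finite F \<and> card F < CARD('n) \<and> (\<forall>W\<in>F. vec.subspace W \<and> W \<noteq> UNIV) \<and> ?S \<subseteq> \<Union>F"
    by (simp only: coverable_by_fewer_def)
  then obtain F where *: "finite F \<and> card F < CARD('n) \<and> (\<forall>W\<in>F. vec.subspace W \<and> W \<noteq> UNIV) \<and> ?S \<subseteq> \<Union>F" ..
  then have F: "finite F" "card F < CARD('n)" "?S \<subseteq> \<Union>F" by simp_all
  have proper: "vec.subspace W" "W \<noteq> UNIV" if "W \<in> F" for W using * that by simp_all
  have "\<forall>W\<in>F. \<exists>d. (\<exists>i. d i \<noteq> 0) \<and> (\<forall>x\<in>W. (\<Sum>i\<in>UNIV. d i * x $ i) = 0)"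
    using proper_subspace_functional[OF proper] by simp
  from bchoice[OF this] obtain c
    where "\<forall>W\<in>F. (\<exists>i. c W i \<noteq> 0) \<and> (\<forall>x\<in>W. (\<Sum>i\<in>UNIV. c W i * x $ i) = 0)" ..
  then have c: "\<exists>i. c W i \<noteq> 0" "\<forall>x\<in>W. (\<Sum>i\<in>UNIV. c W i * x $ i) = 0" if "W \<in> F" for W
    using that by simp_all
  have "card (c ` F) < card (UNIV :: 'n set)" using card_image_le[OF F(1), of c] F(2) by linarith
  then obtain \<sigma> :: "'n \<Rightarrow> 'a" where \<sigma>: "bij_betw \<sigma> UNIV V" "\<forall>d\<in>c ` F. (\<Sum>i\<in>UNIV. d i * \<sigma> i) \<noteq> 0"
    using generic_bijection_avoids[OF gen, of UNIV "c ` F"] V(1) F(1) c by auto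
  define x :: "'a ^ 'n" where "x = (\<chi> i. \<sigma> i)"
  have "V \<noteq> {}" using V(1) by auto
  then have T: "\<Sum>V \<noteq> 0" using generic_sum[OF gen, of V] by blast
  have inj: "inj \<sigma>" and im: "range \<sigma> = V" using \<sigma>(1) by (auto simp: bij_betw_def)
  have sums: "(\<Sum>i\<in>I. (\<chi> i. inverse (\<Sum>V)) $ i * x $ i) = inverse (\<Sum>V) * \<Sum>(\<sigma> ` I)" for I
  proof -
    have "\<Sum>(\<sigma> ` I) = (\<Sum>i\<in>I. \<sigma> i)"
      using inj by (subst sum.reindex) (auto intro: inj_on_subset)
    then show ?thesis by (simp add: x_def sum_distrib_left)
  qed
  have "x \<in> ?S"
    unfolding nondegenerate_solutions_def
  proof (intro CollectI conjI allI impI)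
    show "x \<in> set_power G" using im V(2) by (auto simp: set_power_def x_def)
    show "(\<Sum>i\<in>UNIV. (\<chi> i. inverse (\<Sum>V)) $ i * x $ i) = 1" unfolding sums im using T by simp
    fix I :: "'n set" assume "I \<noteq> {}"
    then have "\<Sum>(\<sigma> ` I) \<noteq> 0" using generic_sum[OF gen, of "\<sigma> ` I"] im by blast
    then show "(\<Sum>i\<in>I. (\<chi> i. inverse (\<Sum>V)) $ i * x $ i) \<noteq> 0" unfolding sums using T by simp
  qed
  then have "x \<in> \<Union>F" using F(3) by (rule subsetD[rotated])
  then obtain W where W: "W \<in> F" "x \<in> W" by (rule UnionE)
  then have "(\<Sum>i\<in>UNIV. c W i * \<sigma> i) = 0" using c(2)[OF W(1)] by (auto simp: x_def)
  then show False using \<sigma>(2) W(1) by simp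
qed

text \<open>The tuple with all entries \<open>1 / (S + v)\<close> is equivalent to the one for \<open>v'\<close> only if \<open>S + v\<close> and \<open>S + v'\<close>
differ by a factor from \<open>G\<close>.\<close>

lemma finitely_many_classes_imp:
  fixes V G :: "'a::field set"
  assumes G: "subgroup G mult_grp" and V: "V \<subseteq> G" "card V + 1 = CARD('n)"
    and D: "D \<subseteq> G" "\<And>v. v \<in> D \<Longrightarrow> v \<notin> V \<and> generic TYPE('n::finite) (insert v V)"
    and fin: "finite ({a \<in> carrier mult_grp_power.
        \<not> coverable_by_fewer CARD('n) (nondegenerate_solutions (set_power G) (a :: 'a ^ 'n))} // Gamma_equiv (set_power G))"
  shows "\<exists>R\<subseteq>D. finite R \<and> (\<forall>v\<in>D. \<exists>v'\<in>R. \<exists>u\<in>G. \<Sum>V + v = u * (\<Sum>V + v'))"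
proof -
  let ?A = "{a \<in> carrier mult_grp_power.
        \<not> coverable_by_fewer CARD('n) (nondegenerate_solutions (set_power G) (a :: 'a ^ 'n))}"
  let ?E = "Gamma_equiv (set_power G) :: (('a ^ 'n) \<times> ('a ^ 'n)) set"
  have E: "equiv (carrier mult_grp_power) ?E" using equiv_Gamma_equiv[OF subgroup_set_power[OF G]] .
  define a :: "'a \<Rightarrow> 'a ^ 'n" where "a = (\<lambda>v. \<chi> i. inverse (\<Sum>V + v))"
  have sum: "\<Sum>(insert v V) = \<Sum>V + v" and nz: "\<Sum>V + v \<noteq> 0" if v: "v \<in> D" for v
  proof -
    have "finite (insert v V)" using D(2)[OF v] by (intro generic_finite) auto
    then have "finite V" by simp
    then show s: "\<Sum>(insert v V) = \<Sum>V + v" using D(2)[OF v] by (simp add: add.commute)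
    show "\<Sum>V + v \<noteq> 0" unfolding s[symmetric] using D(2)[OF v] by (intro generic_sum) auto
  qed
  have aA: "a v \<in> ?A" if v: "v \<in> D" for v
  proof -
    have "finite (insert v V)" using D(2)[OF v] by (intro generic_finite) auto
    then have "card (insert v V) = CARD('n)" using D(2)[OF v] V(2) by simp
    then have "\<not> coverable_by_fewer CARD('n) (nondegenerate_solutions (set_power G) (a v))"
      using generic_not_coverable[of "insert v V" G] D v V(1) by (auto simp: a_def sum[OF v])
    then show ?thesis using nz[OF v] by (simp add: a_def)
  qed
  have "(\<lambda>v. ?E `` {a v}) ` D \<subseteq> ?A // ?E" using aA by (auto intro: quotientI)
  then have "finite ((\<lambda>v. ?E `` {a v}) ` D)" using fin finite_subset by blast
  from finite_subset_image[OF this subset_refl] obtain R where R: "R \<subseteq> D" "finite R"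
      "(\<lambda>v. ?E `` {a v}) ` D = (\<lambda>v. ?E `` {a v}) ` R" by blast
  have "\<exists>v'\<in>R. \<exists>u\<in>G. \<Sum>V + v = u * (\<Sum>V + v')" if v: "v \<in> D" for v
  proof -
    have "?E `` {a v} \<in> (\<lambda>v. ?E `` {a v}) ` R" using R(3) v by blast
    then obtain v' where v': "v' \<in> R" "?E `` {a v} = ?E `` {a v'}" by blast
    have "(a v, a v') \<in> ?E" using v' E aA R(1) by (intro eq_equiv_class[OF v'(2) E]) blast
    then obtain u where u: "u \<in> set_power G" "a v' = u * a v" by (auto simp: Gamma_equiv_def)
    then have "inverse (\<Sum>V + v') = u $ undefined * inverse (\<Sum>V + v)" by (simp add: a_def vec_eq_iff)
    then have "\<Sum>V + v = u $ undefined * (\<Sum>V + v')"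
      using nz[OF v] nz[of v'] v'(1) R(1) by (auto simp: field_simps)
    moreover have "u $ undefined \<in> G" using u(1) by (simp add: set_power_def)
    ultimately show ?thesis using v'(1) by blast
  qed
  then show ?thesis using R by blast
qed

section \<open>Infinitely many classes\<close>

theorem mainTheorem2:
  fixes \<Gamma>\<^sub>1 :: "'a::field_char_0 set"
    and \<Gamma> :: "('a ^ 'n::finite) set"
  assumes "CARD('n) \<ge> 2"
    and "subgroup \<Gamma>\<^sub>1 mult_grp"
    and "infinite \<Gamma>\<^sub>1"
    and "finite_rank mult_grp \<Gamma>\<^sub>1"
    and "\<Gamma> = set_power \<Gamma>\<^sub>1"
  shows "subgroup \<Gamma> mult_grp_power \<and> finite_rank mult_grp_power \<Gamma> \<and>
         infinite ({a \<in> carrier mult_grp_power.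
                      \<not> coverable_by_fewer CARD('n) (nondegenerate_solutions \<Gamma> a)}
                   // Gamma_equiv \<Gamma>)"
proof (intro conjI)
  note G = subgroup_mult_grpD[OF assms(2)]
  show "subgroup \<Gamma> mult_grp_power" unfolding assms(5) by (rule subgroup_set_power[OF assms(2)])
  show "finite_rank mult_grp_power \<Gamma>" unfolding assms(5) by (rule finite_rank_set_power[OF assms(2,4)])
  show "infinite ({a \<in> carrier mult_grp_power.
      \<not> coverable_by_fewer CARD('n) (nondegenerate_solutions \<Gamma> a)} // Gamma_equiv \<Gamma>)"
  proof
    assume "finite ({a \<in> carrier mult_grp_power.
      \<not> coverable_by_fewer CARD('n) (nondegenerate_solutions \<Gamma> a)} // Gamma_equiv \<Gamma>)"
    then have fin: "finite ({a \<in> carrier mult_grp_power.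
        \<not> coverable_by_fewer CARD('n) (nondegenerate_solutions (set_power \<Gamma>\<^sub>1) (a :: 'a ^ 'n))} // Gamma_equiv (set_power \<Gamma>\<^sub>1))"
      by (simp only: assms(5))
    have prep: "\<exists>V\<subseteq>D. card V + 1 = CARD('n) \<and> finite V \<and> \<Sum>V \<noteq> 0 \<and>
        finite {v. v \<in> V \<or> \<not> generic TYPE('n) (insert v V)}" if D: "infinite D" for D :: "'a set"
    proof -
      obtain V where V: "V \<subseteq> D" "generic TYPE('n) V" "card V = CARD('n) - 1"
        using ex_generic[OF D] by blast
      have "V \<noteq> {}" using V(3) assms(1) by auto
      then have "\<Sum>V \<noteq> 0" using generic_sum[OF V(2)] by blast
      moreover have "finite {v. v \<in> V \<or> \<not> generic TYPE('n) (insert v V)}"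
        using finite_not_generic_insert[OF V(2)] generic_finite[OF V(2)] by (simp add: Collect_disj_eq)
      ultimately show ?thesis using V generic_finite[OF V(2)] assms(1) by auto
    qed
    show False
    proof (cases "\<forall>x\<in>\<Gamma>\<^sub>1. torsion x")
      case True
      obtain V where V: "V \<subseteq> \<Gamma>\<^sub>1" "card V + 1 = CARD('n)" "finite V" "\<Sum>V \<noteq> 0"
          "finite {v. v \<in> V \<or> \<not> generic TYPE('n) (insert v V)}"
        using prep[OF assms(3)] by blast
      define D where "D = \<Gamma>\<^sub>1 - {v. v \<in> V \<or> \<not> generic TYPE('n) (insert v V)}"
      have D: "infinite D" unfolding D_def using assms(3) V(5) by (rule Diff_infinite_finite[rotated])
      have DG: "D \<subseteq> \<Gamma>\<^sub>1" by (auto simp: D_def)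
      have Dgen: "v \<notin> V \<and> generic TYPE('n) (insert v V)" if "v \<in> D" for v
        using that by (simp add: D_def)
      obtain R where R: "R \<subseteq> D" "finite R" "\<forall>v\<in>D. \<exists>v'\<in>R. \<exists>u\<in>\<Gamma>\<^sub>1. \<Sum>V + v = u * (\<Sum>V + v')"
        using finitely_many_classes_imp[OF assms(2) V(1,2) DG Dgen fin] by blast
      show False
      proof (rule translated_roots_of_unity_not_finitely_many_classes[of \<Gamma>\<^sub>1 D V R])
        show "torsion x" if "x \<in> \<Gamma>\<^sub>1" for x using True that by blast
        show "R \<subseteq> \<Gamma>\<^sub>1" using R(1) DG by blast
        show "\<exists>v'\<in>R. \<exists>u\<in>\<Gamma>\<^sub>1. \<Sum>V + v = u * (\<Sum>V + v')" if "v \<in> D" for v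
          using R(3) that by (rule bspec)
      qed (fact D DG V R)+
    next
      case False
      then obtain t where t: "t \<in> \<Gamma>\<^sub>1" "\<not> torsion t" by blast
      have t0: "t \<noteq> 0" using G(1) t(1) .
      have t1: "t ^ m \<noteq> 1" if "m > 0" for m using t(2) that unfolding torsion_def by blast
      have inj: "inj (\<lambda>k. t ^ k)"
      proof (rule linorder_injI)
        fix i j :: nat assume ij: "i < j"
        show "t ^ i \<noteq> t ^ j"
        proof
          assume e: "t ^ i = t ^ j"
          have "t ^ j = t ^ i * t ^ (j - i)" using ij by (simp add: power_add[symmetric])
          then have "t ^ (j - i) = 1" using e t0 by simp
          then show False using t1[of "j - i"] ij by simp
        qed
      qed
      then have "infinite (range (\<lambda>k. t ^ k))" by (rule range_inj_infinite)
      from prep[OF this] obtain V where V: "V \<subseteq> range (\<lambda>k. t ^ k)" "card V + 1 = CARD('n)" "finite V" "\<Sum>V \<noteq> 0"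
          "finite {v. v \<in> V \<or> \<not> generic TYPE('n) (insert v V)}"
        by blast
      have "finite ((\<lambda>k. t ^ k) -` {v. v \<in> V \<or> \<not> generic TYPE('n) (insert v V)})"
        using V(5) inj by (rule finite_vimageI)
      then obtain k1 where k1: "\<And>k. t ^ k \<in> {v. v \<in> V \<or> \<not> generic TYPE('n) (insert v V)} \<Longrightarrow> k < k1"
        unfolding finite_nat_set_iff_bounded by auto
      \<comment> \<open>The exponents start at k1 to stay clear of the finitely many powers that do not extend V to a generic set.\<close>
      define D where "D = range (\<lambda>k. t ^ (k1 + k))"
      have DG: "D \<subseteq> \<Gamma>\<^sub>1" using G(5)[OF t(1)] by (auto simp: D_def)
      have Dgen: "v \<notin> V \<and> generic TYPE('n) (insert v V)" if "v \<in> D" for v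
        using k1 that by (fastforce simp: D_def)
      have VG: "V \<subseteq> \<Gamma>\<^sub>1" using V(1) G(5)[OF t(1)] by blast
      obtain R where R: "R \<subseteq> D" "finite R" "\<forall>v\<in>D. \<exists>v'\<in>R. \<exists>u\<in>\<Gamma>\<^sub>1. \<Sum>V + v = u * (\<Sum>V + v')"
        using finitely_many_classes_imp[OF assms(2) VG V(2) DG Dgen fin] by blast
      obtain Ex where Ex: "V = (\<lambda>k. t ^ k) ` Ex" using V(1) by (auto simp: subset_image_iff)
      define S :: "rat poly" where "S = (\<Sum>e\<in>Ex. monom 1 e)"
      have evS: "ev S t = \<Sum>V"
        unfolding Ex using inj by (subst sum.reindex) (auto simp: S_def intro: inj_on_subset)
      obtain r :: nat and u where u: "\<And>j. j < r \<Longrightarrow> u j \<in> \<Gamma>\<^sub>1"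
        and rel: "\<And>x. x \<in> \<Gamma>\<^sub>1 \<Longrightarrow> \<exists>z>0. \<exists>e. x powi z = (\<Prod>j<r. u j powi e j)"
        using finite_rank_mult_grpD[OF assms(2,4)] by blast
      have St: "\<Sum>V + t ^ (k1 + k) \<noteq> 0" for k
      proof -
        have "t ^ (k1 + k) \<in> D" by (auto simp: D_def)
        then have g: "t ^ (k1 + k) \<notin> V" "generic TYPE('n) (insert (t ^ (k1 + k)) V)" using Dgen by auto
        have "\<Sum>(insert (t ^ (k1 + k)) V) \<noteq> 0" using generic_sum[OF g(2)] by blast
        then show ?thesis using g(1) V(3) by (simp add: add.commute)
      qed
      show False
      proof (rule translated_powers_not_finitely_many_classes[of r u \<Gamma>\<^sub>1 t S k1 "{k. t ^ (k1 + k) \<in> R}"])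
        show "u j \<noteq> 0" if "j < r" for j using u[OF that] G(1) by blast
        show "\<exists>z e. z > 0 \<and> x powi z = (\<Prod>j<r. u j powi e j)" if "x \<in> \<Gamma>\<^sub>1" for x using rel[OF that] by blast
        show "coeff S i \<ge> 0" for i by (auto simp: S_def coeff_sum intro!: sum_nonneg)
        show "ev S t \<noteq> 0" using V(4) evS by simp
        show "ev S t + t ^ (k1 + k) \<noteq> 0" for k using St by (simp add: evS)
        have "{k. t ^ (k1 + k) \<in> R} = (\<lambda>k. t ^ (k1 + k)) -` R" by auto
        moreover have "inj (\<lambda>k. t ^ (k1 + k))" 
          by (rule injI, drule injD[OF inj]) simp
        ultimately show "finite {k. t ^ (k1 + k) \<in> R}" using R(2) finite_vimageI by metis
        show "\<exists>k'\<in>{k. t ^ (k1 + k) \<in> R}. (ev S t + t ^ (k1 + k)) / (ev S t + t ^ (k1 + k')) \<in> \<Gamma>\<^sub>1" for k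
        proof -
          have "t ^ (k1 + k) \<in> D" by (auto simp: D_def)
          then obtain v' u where v': "v' \<in> R" "u \<in> \<Gamma>\<^sub>1" "\<Sum>V + t ^ (k1 + k) = u * (\<Sum>V + v')" using R(3) by blast
          obtain k' where k': "v' = t ^ (k1 + k')" using v'(1) R(1) by (auto simp: D_def)
          have "(ev S t + t ^ (k1 + k)) / (ev S t + t ^ (k1 + k')) = u"
            using v'(3) St[of k'] by (simp add: evS k')
          then show ?thesis using v' k' by auto
        qed
      qed (use t0 t1 in auto)
    qed
  qed
qed

end
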